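(* Let $G$ be a normed Abelian group with optimal transport plans. Assume that for every geodesic metric space $X$ and every $0$-chain $R=\sum_{i=1}^n g_i[\![x_i]\!]$ with $x_i\in X$, $g_i\in G$ and $\sum_{i=1}^n g_i=0$ there exist a tree $(T,d)$ and a $1$-Lipschitz map $f:X\to T$ such that $\mathrm{Fill}_{G,T}(f_\#R)=\mathrm{Fill}_{G,X}(R)$. Then $G$ has nonbranching optimal transport plans.
   Context: A normed Abelian group $(G,|\cdot|)$ is an Abelian group $G$ with a function $|\cdot|:G\to\mathbb R_{\ge 0}$ such that $|g+h|\le |g|+|h|$, $|-g|=|g|$ for all $g,h\in G$, and $|g|=0$ if and only if $g=0$. $G$ has optimal transport plans if for every $n\ge 1$, all $g_1,\dots,g_n\in G$ with $g_1+\dots+g_n=0$ and every $n$-point metric space $(\{x_1,\dots,x_n\},d)$, the infimum of $\sum_{1\le i<j\le n}|g_{ij}|\,d(x_i,x_j)$ over all families $(g_{ij})_{i,j=1}^n$ in $G$ with $g_{ij}=-g_{ji}$, $g_{ii}=0$ and $g_i=\sum_{j=1}^n g_{ij}$ is achieved. $G$ has nonbranching optimal transport plans if it has optimal transport plans and for every finite collection $g_1,\dots,g_n\in G$ with $\sum_{i=1}^n g_i=0$ there are $g_{ij}\in G$, $i,j=1,\dots,n$, with $g_{ij}=-g_{ji}$, $g_{ii}=0$, $g_i=\sum_{j=1}^n g_{ij}$ and $|g_i|=\sum_{j=1}^n|g_{ij}|$ for all $i,j=1,\dots,n$. Here a tree $(T,d)$ is a tree $T$ (a uniquely arcwise connected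 space) with a metric $d$ for which it is Lipschitz path connected (any two points are joined by a Lipschitz path); $d$ need not be geodesic. $f_\#R=\sum_{i=1}^n g_i[\![f(x_i)]\!]$. Chains (in the sense of De Pauw and Hardt) in a metric space $Y$. A finitely supported $0$-chain is a finite formal sum $Z=\sum_i g_i[\![p_i]\!]$, $g_i\in G$, $p_i\in Y$ (coefficients at equal points are added); its mass $\mathbf M(Z)$ is the sum of the norms of the coefficients at the distinct points. A rectifiable $1$-chain $S\in\mathcal R_1(Y;G)$ is given by a $G$-valued orientation $\mathbf g:A\to G$ on an oriented $1$-rectifiable Borel set $A\subset Y$ (reversing the orientation of $A$ on a set changes the sign of $\mathbf g$ there; modifications on $\mathcal H^1$-null sets are ignored) with finite mass $\mathbf M(S)=\int_A|\mathbf g|\,d\mathcal H^1$. For a Lipschitz path $\gamma:[0,1]\to Y$ and $g\in G$, $\gamma_\#(g[\![0,1]\!])$ denotes the rectifiable chain obtained by pushing forward the oriented interval with coefficient $g$ (contributions over the preimages of a point are added according to orientation). Lipschitz chains $\mathcal L_1(Y;G)$ are finite sums of such chains. The boundary is the additive map with $\partial\gamma_\#(g[\![0,1]\!])=g[\![\gamma(1)]\!]-g[\![\gamma(0)]\!]$ on Lipschitz chains, extended to rectifiable chains by flat continuity: for $C\in\mathcal R_1(Y;G)$ and a finitely supported $0$-chain $Z$, $\partial C=Z$ means that there are Lipschitz chains $C_q$ with $\mathbf M(C-C_q)\to0$ and $\mathcal F(\partial C_q-Z)\to0$, where $\mathcal F(W)=\inf\{\mathbf M(W-\partial Q)+\mathbf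 M(Q):Q\in\mathcal L_1(Y;G)\}$. The filling length is $\mathrm{Fill}_{G,Y}(Z)=\inf\{\mathbf M(C):C\in\mathcal R_1(Y;G),\ \partial C=Z\}$. *)

theory Defs
  imports "HOL-Analysis.Analysis" "HOL-Library.Poly_Mapping"
begin

section \<open>Normed Abelian groups and transport plans\<close>

definition normed_ab_group :: "('g::ab_group_add \<Rightarrow> real) \<Rightarrow> bool" where
  "normed_ab_group N \<longleftrightarrow>
     (\<forall>g. 0 \<le> N g) \<and> (\<forall>g h. N (g + h) \<le> N g + N h) \<and> (\<forall>g. N (- g) = N g) \<and>
     (\<forall>g. N g = 0 \<longleftrightarrow> g = 0)"

definition transport_plan :: "nat \<Rightarrow> (nat \<Rightarrow> 'g::ab_group_add) \<Rightarrow> (nat \<Rightarrow> nat \<Rightarrow> 'g) \<Rightarrow> bool" where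
  "transport_plan n g h \<longleftrightarrow>
     (\<forall>i\<in>{1..n}. \<forall>j\<in>{1..n}. h i j = - h j i) \<and> (\<forall>i\<in>{1..n}. h i i = 0) \<and>
     (\<forall>i\<in>{1..n}. g i = (\<Sum>j=1..n. h i j))"

definition transport_cost ::
    "('g \<Rightarrow> real) \<Rightarrow> nat \<Rightarrow> (nat \<Rightarrow> nat \<Rightarrow> real) \<Rightarrow> (nat \<Rightarrow> nat \<Rightarrow> 'g) \<Rightarrow> real" where
  "transport_cost N n d h = (\<Sum>i=1..n. \<Sum>j\<in>{i<..n}. N (h i j) * d i j)"

text \<open>An \<open>n\<close>-point metric space \<open>{x\<^sub>1, \<dots>, x\<^sub>n}\<close> is given by a metric on the set of labels \<open>{1..n}\<close>.\<close>

definition optimal_transport_plans :: "('g::ab_group_add \<Rightarrow> real) \<Rightarrow> bool" where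
  "optimal_transport_plans N \<longleftrightarrow>
     (\<forall>n\<ge>1. \<forall>(g :: nat \<Rightarrow> 'g) d. (\<Sum>i=1..n. g i) = 0 \<longrightarrow> Metric_space {1..n} d \<longrightarrow>
        (\<exists>h. transport_plan n g h \<and>
             transport_cost N n d h = (INF h'\<in>{h'. transport_plan n g h'}. transport_cost N n d h')))"

definition nonbranching_optimal_transport_plans :: "('g::ab_group_add \<Rightarrow> real) \<Rightarrow> bool" where
  "nonbranching_optimal_transport_plans N \<longleftrightarrow>
     optimal_transport_plans N \<and>
     (\<forall>n (g :: nat \<Rightarrow> 'g). (\<Sum>i=1..n. g i) = 0 \<longrightarrow>
        (\<exists>h. transport_plan n g h \<and> (\<forall>i\<in>{1..n}. N (g i) = (\<Sum>j=1..n. N (h i j)))))"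


section \<open>Geodesic spaces and trees\<close>

definition geodesic_space :: "'x metric \<Rightarrow> bool" where
  "geodesic_space X \<longleftrightarrow>
     (\<forall>x\<in>mspace X. \<forall>y\<in>mspace X. \<exists>\<gamma>::real \<Rightarrow> 'x.
        \<gamma> \<in> {0..mdist X x y} \<rightarrow> mspace X \<and> \<gamma> 0 = x \<and> \<gamma> (mdist X x y) = y \<and>
        (\<forall>s\<in>{0..mdist X x y}. \<forall>t\<in>{0..mdist X x y}. mdist X (\<gamma> s) (\<gamma> t) = \<bar>s - t\<bar>))"

definition lipschitz_path :: "'y metric \<Rightarrow> (real \<Rightarrow> 'y) \<Rightarrow> bool" where
  "lipschitz_path Y \<gamma> \<longleftrightarrow> Lipschitz_continuous_map (submetric euclidean_metric {0..1}) Y \<gamma>"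

text \<open>Metric spaces are Hausdorff, so an injective path is a homeomorphism onto its image.\<close>

definition arc_between :: "'y topology \<Rightarrow> 'y \<Rightarrow> 'y \<Rightarrow> 'y set \<Rightarrow> bool" where
  "arc_between X x y A \<longleftrightarrow>
     (\<exists>\<gamma>. pathin X \<gamma> \<and> inj_on \<gamma> {0..1} \<and> \<gamma> 0 = x \<and> \<gamma> 1 = y \<and> A = \<gamma> ` {0..1})"

definition tree :: "'t metric \<Rightarrow> bool" where
  "tree T \<longleftrightarrow>
     (\<forall>x\<in>mspace T. \<forall>y\<in>mspace T. x \<noteq> y \<longrightarrow> (\<exists>!A. arc_between (mtopology_of T) x y A)) \<and>
     (\<forall>x\<in>mspace T. \<forall>y\<in>mspace T. \<exists>\<gamma>. lipschitz_path T \<gamma> \<and> \<gamma> 0 = x \<and> \<gamma> 1 = y)"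

definition one_lipschitz :: "'x metric \<Rightarrow> 't metric \<Rightarrow> ('x \<Rightarrow> 't) \<Rightarrow> bool" where
  "one_lipschitz X T f \<longleftrightarrow>
     f \<in> mspace X \<rightarrow> mspace T \<and>
     (\<forall>x\<in>mspace X. \<forall>y\<in>mspace X. mdist T (f x) (f y) \<le> mdist X x y)"


section \<open>One-dimensional Hausdorff measure\<close>

definition ediameter :: "'y metric \<Rightarrow> 'y set \<Rightarrow> ennreal" where
  "ediameter Y B = (SUP x\<in>B. SUP y\<in>B. ennreal (mdist Y x y))"

definition hausdorff_pre :: "'y metric \<Rightarrow> real \<Rightarrow> 'y set \<Rightarrow> ennreal" where
  "hausdorff_pre Y \<delta> A =
     (INF B\<in>{B :: nat \<Rightarrow> 'y set. A \<subseteq> (\<Union>i. B i) \<and> (\<forall>i. B i \<subseteq> mspace Y \<and> ediameter Y (B i) \<le> ennreal \<delta>)}.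
        suminf (\<lambda>i. ediameter Y (B i)))"

definition hausdorff_outer :: "'y metric \<Rightarrow> 'y set \<Rightarrow> ennreal" where
  "hausdorff_outer Y A = (SUP \<delta>\<in>{0<..}. hausdorff_pre Y \<delta> A)"

definition hausdorff_measure :: "'y metric \<Rightarrow> 'y measure" where
  "hausdorff_measure Y = measure_of (mspace Y) {U. openin (mtopology_of Y) U} (hausdorff_outer Y)"

text \<open>
  The measure built by \<^const>\<open>measure_of\<close> would be zero if \<^const>\<open>hausdorff_outer\<close> were not a measure on
  the Borel sets; the following lemmas show that it is one (it is a metric outer measure).
\<close>

lemma hausdorff_pre_antimono: "0 < \<delta> \<Longrightarrow> \<delta> \<le> \<delta>' \<Longrightarrow> hausdorff_pre Y \<delta>' A \<le> hausdorff_pre Y \<delta> A"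
  unfolding hausdorff_pre_def by (rule INF_superset_mono) (auto intro: order_trans ennreal_leI)

lemma hausdorff_pre_mono: "A \<subseteq> B \<Longrightarrow> hausdorff_pre Y \<delta> A \<le> hausdorff_pre Y \<delta> B"
  unfolding hausdorff_pre_def by (rule INF_superset_mono) auto

lemma hausdorff_outer_mono: "A \<subseteq> B \<Longrightarrow> hausdorff_outer Y A \<le> hausdorff_outer Y B"
  unfolding hausdorff_outer_def by (intro SUP_mono) (auto intro: hausdorff_pre_mono)

lemma hausdorff_outer_empty: "hausdorff_outer Y {} = 0"
proof -
  have "hausdorff_pre Y \<delta> {} \<le> 0" for \<delta>
    unfolding hausdorff_pre_def
    by (rule INF_lower2[where i="\<lambda>_. {}"]) (auto simp: ediameter_def bot_ennreal)
  then show ?thesis by (auto simp: hausdorff_outer_def SUP_eq_iff)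
qed

lemma hausdorff_pre_countable:
  fixes A :: "nat \<Rightarrow> 'y set"
  shows "hausdorff_pre Y \<delta> (\<Union>n. A n) \<le> suminf (\<lambda>n. hausdorff_pre Y \<delta> (A n))"
proof (rule ennreal_le_epsilon)
  fix e :: real assume fin: "suminf (\<lambda>n. hausdorff_pre Y \<delta> (A n)) < top" and e: "0 < e"
  have finn: "hausdorff_pre Y \<delta> (A n) < top" for n
    using fin by (metis ennreal_suminf_lessD)
  have "\<exists>B::nat \<Rightarrow> 'y set. A n \<subseteq> (\<Union>i. B i) \<and> (\<forall>i. B i \<subseteq> mspace Y \<and> ediameter Y (B i) \<le> ennreal \<delta>) \<and>
      suminf (\<lambda>i. ediameter Y (B i)) \<le> hausdorff_pre Y \<delta> (A n) + ennreal (e * (1/2)^Suc n)" for n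
  proof -
    have "hausdorff_pre Y \<delta> (A n) < hausdorff_pre Y \<delta> (A n) + ennreal (e * (1/2)^Suc n)"
      using finn[of n] e by (simp add: ennreal_zero_less_divide less_top[symmetric])
    then show ?thesis
      unfolding hausdorff_pre_def INF_less_iff by (auto intro: less_imp_le)
  qed
  then obtain B :: "nat \<Rightarrow> nat \<Rightarrow> 'y set" where B: "\<And>n. A n \<subseteq> (\<Union>i. B n i)"
    "\<And>n i. B n i \<subseteq> mspace Y" "\<And>n i. ediameter Y (B n i) \<le> ennreal \<delta>"
    "\<And>n. suminf (\<lambda>i. ediameter Y (B n i)) \<le> hausdorff_pre Y \<delta> (A n) + ennreal (e * (1/2)^Suc n)"
    by metis
  have "hausdorff_pre Y \<delta> (\<Union>n. A n) \<le> suminf (\<lambda>k. ediameter Y (case prod_decode k of (n,i) \<Rightarrow> B n i))"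
    unfolding hausdorff_pre_def
  proof (rule INF_lower, intro CollectI conjI subsetI allI)
    fix x assume "x \<in> (\<Union>n. A n)"
    then obtain n where "x \<in> A n" by blast
    then obtain i where "x \<in> B n i" using B(1) by blast
    then show "x \<in> (\<Union>k. case prod_decode k of (n,i) \<Rightarrow> B n i)"
      by (auto intro!: exI[of _ "prod_encode (n,i)"])
  next
    fix k x assume "x \<in> (case prod_decode k of (n,i) \<Rightarrow> B n i)"
    then show "x \<in> mspace Y" using B(2)[of "fst (prod_decode k)" "snd (prod_decode k)"]
      by (auto simp: case_prod_beta)
  next
    fix k show "ediameter Y (case prod_decode k of (n,i) \<Rightarrow> B n i) \<le> ennreal \<delta>"
      using B(3) by (simp add: case_prod_beta)
  qed
  also have "\<dots> = suminf (\<lambda>n. suminf (\<lambda>i. ediameter Y (B n i)))"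
    using suminf_ennreal_2dimen[of "\<lambda>n. suminf (\<lambda>i. ediameter Y (B n i))" "\<lambda>(n,i). ediameter Y (B n i)"]
    by (simp add: case_prod_beta')
  also have "\<dots> \<le> suminf (\<lambda>n. hausdorff_pre Y \<delta> (A n) + ennreal (e * (1/2)^Suc n))"
    by (intro suminf_le B(4)) auto
  also have "\<dots> = suminf (\<lambda>n. hausdorff_pre Y \<delta> (A n)) + suminf (\<lambda>n. ennreal (e * (1/2)^Suc n))"
    by (rule suminf_add[symmetric]) auto
  also have "suminf (\<lambda>n. ennreal (e * (1/2)^Suc n)) = ennreal e"
    using sums_mult[OF power_half_series, of e] e
    by (subst suminf_ennreal_eq[of _ e]) auto
  finally show "hausdorff_pre Y \<delta> (\<Union>n. A n) \<le> suminf (\<lambda>n. hausdorff_pre Y \<delta> (A n)) + ennreal e" .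
qed

lemma hausdorff_outer_countable:
  "hausdorff_outer Y (\<Union>n. A n) \<le> suminf (\<lambda>n. hausdorff_outer Y (A n))"
  unfolding hausdorff_outer_def
proof (rule SUP_least)
  fix \<delta> :: real assume "\<delta> \<in> {0<..}"
  then show "hausdorff_pre Y \<delta> (\<Union>n. A n) \<le> suminf (\<lambda>n. SUP \<delta>\<in>{0<..}. hausdorff_pre Y \<delta> (A n))"
    by (intro order_trans[OF hausdorff_pre_countable] suminf_le) (auto intro: SUP_upper)
qed

lemma hausdorff_outer_Un: "hausdorff_outer Y (A \<union> B) \<le> hausdorff_outer Y A + hausdorff_outer Y B"
proof -
  have "hausdorff_outer Y (\<Union>n. binaryset A B n) \<le> suminf (\<lambda>n. hausdorff_outer Y (binaryset A B n))"
    by (rule hausdorff_outer_countable)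
  also have "\<dots> = hausdorff_outer Y A + hausdorff_outer Y B"
    by (rule suminf_binaryset_eq) (rule hausdorff_outer_empty)
  finally show ?thesis by (simp add: UN_binaryset_eq)
qed

lemma hausdorff_outer_separated:
  assumes r: "0 < r" and sep: "\<And>x y. x \<in> A \<Longrightarrow> y \<in> B \<Longrightarrow> r \<le> mdist Y x y"
  shows "hausdorff_outer Y A + hausdorff_outer Y B \<le> hausdorff_outer Y (A \<union> B)"
proof -
  have *: "hausdorff_pre Y \<delta> A + hausdorff_pre Y \<delta> B \<le> hausdorff_pre Y \<delta> (A \<union> B)"
    if d: "0 < \<delta>" "\<delta> < r" for \<delta>
    unfolding hausdorff_pre_def[of _ _ "A \<union> B"]
  proof (rule INF_greatest, safe)
    fix C :: "nat \<Rightarrow> 'a set"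
    assume C: "A \<union> B \<subseteq> (\<Union>i. C i)" "\<forall>i. C i \<subseteq> mspace Y \<and> ediameter Y (C i) \<le> ennreal \<delta>"
    have disj: "C i \<inter> A = {} \<or> C i \<inter> B = {}" for i
    proof (rule ccontr)
      assume "\<not> ?thesis"
      then obtain x y where xy: "x \<in> C i" "x \<in> A" "y \<in> C i" "y \<in> B" by auto
      have "ennreal (mdist Y x y) \<le> ediameter Y (C i)"
        unfolding ediameter_def by (intro SUP_upper2[OF xy(1)] SUP_upper2[OF xy(3)]) auto
      then have "ennreal (mdist Y x y) \<le> ennreal \<delta>" using C(2) by (meson order_trans)
      then have "mdist Y x y \<le> \<delta>" using d by (simp add: ennreal_le_iff)
      with sep[OF xy(2,4)] d show False by simp
    qed
    define CA where "CA i = (if C i \<inter> A = {} then {} else C i)" for i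
    define CB where "CB i = (if C i \<inter> A = {} then C i else {})" for i
    have e: "ediameter Y {} = 0" by (simp add: ediameter_def bot_ennreal)
    have "hausdorff_pre Y \<delta> A \<le> suminf (\<lambda>i. ediameter Y (CA i))"
      unfolding hausdorff_pre_def by (rule INF_lower) (use C in \<open>auto simp: CA_def e; blast\<close>)
    moreover have "hausdorff_pre Y \<delta> B \<le> suminf (\<lambda>i. ediameter Y (CB i))"
    proof -
      have "x \<in> (\<Union>i. CB i)" if xB: "x \<in> B" for x
      proof -
        obtain i where i: "x \<in> C i" using xB C(1) by blast
        then have "C i \<inter> A = {}" using disj[of i] xB by blast
        then show ?thesis using i by (auto simp: CB_def)
      qed
      then show ?thesis
        unfolding hausdorff_pre_def by (intro INF_lower) (use C in \<open>auto simp: CB_def e\<close>)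
    qed
    moreover have "suminf (\<lambda>i. ediameter Y (CA i)) + suminf (\<lambda>i. ediameter Y (CB i)) = suminf (\<lambda>i. ediameter Y (C i))"
      by (subst suminf_add) (auto intro!: suminf_cong simp: CA_def CB_def e)
    ultimately show "hausdorff_pre Y \<delta> A + hausdorff_pre Y \<delta> B \<le> suminf (\<lambda>i. ediameter Y (C i))"
      by (metis add_mono)
  qed
  have *: "hausdorff_pre Y \<delta> A + hausdorff_pre Y \<delta>' B \<le> hausdorff_outer Y (A \<union> B)"
    if "0 < \<delta>" "0 < \<delta>'" for \<delta> \<delta>'
  proof -
    define m where "m = min (min \<delta> \<delta>') (r/2)"
    have m: "0 < m" "m < r" "m \<le> \<delta>" "m \<le> \<delta>'" using that r by (auto simp: m_def)
    have "hausdorff_pre Y \<delta> A + hausdorff_pre Y \<delta>' B \<le> hausdorff_pre Y m A + hausdorff_pre Y m B"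
      using m by (intro add_mono hausdorff_pre_antimono) auto
    also have "\<dots> \<le> hausdorff_pre Y m (A \<union> B)" using *[OF m(1,2)] .
    also have "\<dots> \<le> hausdorff_outer Y (A \<union> B)" unfolding hausdorff_outer_def by (rule SUP_upper) (use m in auto)
    finally show ?thesis .
  qed
  have "(1::real) \<in> {0<..}" by simp
  then have ne: "{0<..} \<noteq> ({}::real set)" by blast
  have "(SUP \<delta>\<in>{0<..}. hausdorff_pre Y \<delta> A) + (SUP \<delta>'\<in>{0<..}. hausdorff_pre Y \<delta>' B)
      = (SUP \<delta>'\<in>{0<..}. SUP \<delta>\<in>{0<..}. hausdorff_pre Y \<delta> A + hausdorff_pre Y \<delta>' B)"
    by (simp only: ennreal_SUP_add_left[OF ne, symmetric] ennreal_SUP_add_right[OF ne])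
  also have "\<dots> \<le> hausdorff_outer Y (A \<union> B)" using * by (intro SUP_least) simp
  finally show ?thesis
    by (simp only: hausdorff_outer_def[of Y A] hausdorff_outer_def[of Y B])
qed

lemma hausdorff_outer_open:
  fixes Y :: "'y metric"
  assumes U: "openin (mtopology_of Y) U" and X: "X \<subseteq> mspace Y"
  shows "hausdorff_outer Y (X \<inter> U) + hausdorff_outer Y (X - U) \<le> hausdorff_outer Y X"
proof (cases "hausdorff_outer Y X = top")
  case False
  let ?H = "hausdorff_outer Y"
  interpret Metric_space "mspace Y" "mdist Y" by simp
  define Xn where "Xn n = {x\<in>X \<inter> U. \<forall>y\<in>X-U. 1 / real (Suc n) \<le> mdist Y x y}" for n
  define R where "R n = Xn (Suc n) - Xn n" for n
  have mono1: "Xn n \<subseteq> Xn (Suc n)" for n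
  proof -
    have "1 / real (Suc (Suc n)) \<le> 1 / real (Suc n)" by (simp add: frac_le)
    then show ?thesis unfolding Xn_def by (auto intro: order_trans)
  qed
  have mono: "m \<le> n \<Longrightarrow> Xn m \<subseteq> Xn n" for m n
    using lift_Suc_mono_le[of Xn, OF mono1] by blast
  have UN: "X \<inter> U = (\<Union>n. Xn n)"
  proof (intro equalityI subsetI)
    fix x assume x: "x \<in> X \<inter> U"
    then obtain r where r: "0 < r" "mball x r \<subseteq> U"
      using U unfolding mtopology_of_def openin_mtopology by auto
    obtain n where n: "1 / real (Suc n) < r" using r(1) nat_approx_posE by metis
    have "x \<in> Xn n"
    proof -
      have "1 / real (Suc n) \<le> mdist Y x y" if "y \<in> X - U" for y
      proof (rule ccontr)
        assume "\<not> ?thesis"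
        then have "y \<in> mball x r" using n that x X by (auto simp: in_mball)
        then show False using r that by auto
      qed
      then show ?thesis using x by (auto simp: Xn_def)
    qed
    then show "x \<in> (\<Union>n. Xn n)" by blast
  qed (auto simp: Xn_def)
  have sepR: "?H A + ?H (R (m+2)) \<le> ?H (A \<union> R (m+2))" if A: "A \<subseteq> Xn (Suc m)" for A m
  proof (rule hausdorff_outer_separated[where r="1 / real (m+2) - 1 / real (m+3)"])
    show "0 < 1 / real (m+2) - 1 / real (m+3)" by (simp add: frac_less2)
    fix x z assume x: "x \<in> A" and z: "z \<in> R (m+2)"
    have xX: "x \<in> X" "\<And>y. y \<in> X - U \<Longrightarrow> 1 / real (m+2) \<le> mdist Y x y" using x A by (auto simp: Xn_def)
    have zX: "z \<in> X" using z by (auto simp: R_def Xn_def)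
    obtain y where y: "y \<in> X - U" "mdist Y z y < 1 / real (m+3)"
      using z by (auto simp: R_def Xn_def not_le algebra_simps)
    have "mdist Y x y \<le> mdist Y x z + mdist Y z y"
      using xX zX y X by (intro triangle) auto
    then show "1 / real (m+2) - 1 / real (m+3) \<le> mdist Y x z"
      using xX(2)[OF y(1)] y(2) by linarith
  qed
  have alt: "(\<Sum>k<n. ?H (R (2*k + p))) \<le> ?H X" for n p
  proof -
    have "(\<Sum>k<n. ?H (R (2*k + p))) \<le> ?H (\<Union>k<n. R (2*k+p))"
    proof (induction n)
      case (Suc n)
      show ?case
      proof (cases n)
        case 0 then show ?thesis by (simp add: lessThan_Suc)
      next
        case (Suc m)
        have sub: "(\<Union>k<n. R (2*k+p)) \<subseteq> Xn (Suc (2*m+p))"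
        proof (rule UN_least)
          fix k assume "k \<in> {..<n}"
          then have "Xn (Suc (2*k+p)) \<subseteq> Xn (Suc (2*m+p))" using Suc by (intro mono) auto
          then show "R (2*k+p) \<subseteq> Xn (Suc (2*m+p))" by (auto simp: R_def)
        qed
        have "(\<Sum>k<Suc n. ?H (R (2*k + p))) \<le> ?H (\<Union>k<n. R (2*k+p)) + ?H (R (2*n+p))"
          using Suc.IH by (simp add: add_right_mono)
        also have "\<dots> \<le> ?H ((\<Union>k<n. R (2*k+p)) \<union> R (2*n+p))"
          using sepR[OF sub] Suc by (simp add: algebra_simps)
        also have "(\<Union>k<n. R (2*k+p)) \<union> R (2*n+p) = (\<Union>k<Suc n. R (2*k+p))"
          by (auto simp: lessThan_Suc)
        finally show ?thesis .
      qed
    qed (simp add: hausdorff_outer_empty)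
    also have "\<dots> \<le> ?H X" by (rule hausdorff_outer_mono) (auto simp: R_def Xn_def)
    finally show ?thesis .
  qed
  have part: "(\<Sum>k<2*n. ?H (R k)) = (\<Sum>k<n. ?H (R (2*k))) + (\<Sum>k<n. ?H (R (2*k+1)))" for n
    by (induction n) (auto simp: algebra_simps)
  have "(\<Sum>k<n. ?H (R k)) \<le> ?H X + ?H X" for n
  proof -
    have "(\<Sum>k<n. ?H (R k)) \<le> (\<Sum>k<2*n. ?H (R k))" by (rule sum_mono2) auto
    also have "\<dots> \<le> ?H X + ?H X" unfolding part using alt[of 0 n] alt[of 1 n] by (intro add_mono) auto
    finally show ?thesis .
  qed
  then have "suminf (\<lambda>k. ?H (R k)) \<le> ?H X + ?H X"
    by (intro suminf_le_const summableI)
  then have fin: "suminf (\<lambda>k. ?H (R k)) \<noteq> top"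
    using False by (auto simp: top_unique)
  have tail: "(\<lambda>n. suminf (\<lambda>k. ?H (R (k + n)))) \<longlonglongrightarrow> 0"
  proof -
    have f: "\<And>k. ?H (R k) \<noteq> top" using fin ennreal_suminf_lessD[of "\<lambda>k. ?H (R k)" top] by (simp add: less_top)
    have "summable (\<lambda>k. enn2real (?H (R k)))"
      using fin f by (intro summable_suminf_not_top) (simp_all add: ennreal_enn2real_if)
    from suminf_exist_split2[OF this]
    have "(\<lambda>n. suminf (\<lambda>k. enn2real (?H (R (k+n))))) \<longlonglongrightarrow> 0" .
    then have "(\<lambda>n. ennreal (suminf (\<lambda>k. enn2real (?H (R (k+n)))))) \<longlonglongrightarrow> ennreal 0"
      by (rule tendsto_ennrealI)
    moreover have "ennreal (suminf (\<lambda>k. enn2real (?H (R (k+n))))) = suminf (\<lambda>k. ?H (R (k+n)))" for n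
      using summable_ignore_initial_segment[OF \<open>summable (\<lambda>k. enn2real (?H (R k)))\<close>, of n] f
      by (subst suminf_ennreal2[symmetric]) (auto simp: less_top)
    ultimately show ?thesis by simp
  qed
  have le: "?H (X \<inter> U) + ?H (X - U) \<le> ?H X + suminf (\<lambda>k. ?H (R (k + n)))" for n
  proof -
    have cov: "X \<inter> U \<subseteq> Xn n \<union> (\<Union>k. R (k + n))"
    proof
      fix x assume x: "x \<in> X \<inter> U"
      then have ex: "\<exists>m. x \<in> Xn m" using UN by auto
      define m where "m = (LEAST m. x \<in> Xn m)"
      have m: "x \<in> Xn m" "\<And>k. k < m \<Longrightarrow> x \<notin> Xn k"
        using ex unfolding m_def by (auto intro: LeastI_ex dest: not_less_Least)
      show "x \<in> Xn n \<union> (\<Union>k. R (k + n))"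
      proof (cases "m \<le> n")
        case True then show ?thesis using mono m by blast
      next
        case F: False
        then have "x \<in> R (m - 1)" using m by (cases m) (auto simp: R_def)
        moreover have "m - 1 = (m - 1 - n) + n" using F by simp
        ultimately have "x \<in> R ((m - 1 - n) + n)" by simp
        then show ?thesis by blast
      qed
    qed
    have "?H (X \<inter> U) \<le> ?H (Xn n) + suminf (\<lambda>k. ?H (R (k + n)))"
      using hausdorff_outer_mono[OF cov, of Y] hausdorff_outer_Un[of Y "Xn n" "\<Union>k. R (k + n)"]
        hausdorff_outer_countable[of Y "\<lambda>k. R (k+n)"]
      by (meson add_left_mono order_trans)
    then have "?H (X \<inter> U) + ?H (X - U) \<le> (?H (Xn n) + ?H (X - U)) + suminf (\<lambda>k. ?H (R (k + n)))"
      by (drule_tac add_right_mono[where c="?H (X - U)"]) (simp add: ac_simps)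
    also have "?H (Xn n) + ?H (X - U) \<le> ?H (Xn n \<union> (X - U))"
      by (rule hausdorff_outer_separated[of "1 / real (Suc n)"]) (auto simp: Xn_def)
    also have "\<dots> \<le> ?H X" by (rule hausdorff_outer_mono) (auto simp: Xn_def)
    finally show ?thesis by (simp add: add_right_mono)
  qed
  have "(\<lambda>n. ?H X + suminf (\<lambda>k. ?H (R (k + n)))) \<longlonglongrightarrow> ?H X + 0"
    by (intro tendsto_intros tail)
  then show ?thesis
    using le by (intro LIMSEQ_le_const[where X="\<lambda>n. ?H X + suminf (\<lambda>k. ?H (R (k + n)))"]) auto
qed simp

theorem measure_space_hausdorff:
  "measure_space (mspace Y) (sigma_sets (mspace Y) {U. openin (mtopology_of Y) U}) (hausdorff_outer Y)"
proof -
  let ?L = "lambda_system (mspace Y) (Pow (mspace Y)) (hausdorff_outer Y)"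
  interpret P: sigma_algebra "mspace Y" "Pow (mspace Y)" by (rule sigma_algebra_Pow)
  have "outer_measure_space (Pow (mspace Y)) (hausdorff_outer Y)"
    unfolding outer_measure_space_def positive_def increasing_def countably_subadditive_def
    by (auto simp: hausdorff_outer_empty hausdorff_outer_mono hausdorff_outer_countable)
  then have L: "measure_space (mspace Y) ?L (hausdorff_outer Y)" by (rule P.caratheodory_lemma)
  then have sL: "sigma_algebra (mspace Y) ?L" by (simp add: measure_space_def)
  have "{U. openin (mtopology_of Y) U} \<subseteq> ?L"
  proof safe
    fix U assume U: "openin (mtopology_of Y) U"
    then have UY: "U \<subseteq> mspace Y" using openin_subset by fastforce
    have "hausdorff_outer Y (X \<inter> U) + hausdorff_outer Y (X - U) = hausdorff_outer Y X" if "X \<subseteq> mspace Y" for X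
      using hausdorff_outer_open[OF U that] hausdorff_outer_Un[of Y "X \<inter> U" "X - U"]
      by (simp add: Int_Diff_Un antisym)
    then show "U \<in> ?L" using UY by (auto simp: P.lambda_system_eq)
  qed
  then have "sigma_sets (mspace Y) {U. openin (mtopology_of Y) U} \<subseteq> ?L"
    by (rule sigma_algebra.sigma_sets_subset[OF sL])
  then show ?thesis
    by (rule measure_down[OF L sigma_algebra_sigma_sets, rotated]) (use openin_subset in \<open>fastforce\<close>)
qed

lemma emeasure_hausdorff_measure:
  assumes "A \<in> sets (hausdorff_measure Y)"
  shows "emeasure (hausdorff_measure Y) A = hausdorff_outer Y A"
proof -
  have sub: "{U. openin (mtopology_of Y) U} \<subseteq> Pow (mspace Y)" using openin_subset by fastforce
  show ?thesis
    using assms measure_space_hausdorff[of Y] unfolding hausdorff_measure_def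
    by (simp add: emeasure_measure_of_conv sub)
qed


section \<open>Chains of dimension zero\<close>

text \<open>
  Finitely supported \<open>0\<close>-chains are elements of \<^typ>\<open>'y \<Rightarrow>\<^sub>0 'g\<close>; \<^term>\<open>Poly_Mapping.single p g\<close>
  is the chain \<open>g\<close> times the point mass at \<open>p\<close>.
\<close>

definition mass0 :: "('g::zero \<Rightarrow> real) \<Rightarrow> ('y \<Rightarrow>\<^sub>0 'g) \<Rightarrow> real" where
  "mass0 N Z = (\<Sum>p\<in>Poly_Mapping.keys Z. N (Poly_Mapping.lookup Z p))"


section \<open>Chains of dimension one\<close>

text \<open>
  A chart \<open>(K, \<phi>)\<close> is an injective Lipschitz parametrisation of \<open>\<phi> ` K\<close> by a compact subset of the
  line; it orients \<open>\<phi> ` K\<close> by the standard orientation of the line.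
\<close>

type_synonym 'y chart = "real set \<times> (real \<Rightarrow> 'y)"

definition chart_image :: "'y chart \<Rightarrow> 'y set" where
  "chart_image c = snd c ` fst c"

definition chart :: "'y metric \<Rightarrow> 'y chart \<Rightarrow> bool" where
  "chart Y c \<longleftrightarrow>
     compact (fst c) \<and> inj_on (snd c) (fst c) \<and>
     Lipschitz_continuous_map (submetric euclidean_metric (fst c)) Y (snd c)"

text \<open>
  For a Lipschitz curve fragment \<open>\<gamma>\<close> on \<open>L\<close> that meets \<open>\<phi> ` K\<close>, the transition function
  \<open>\<phi>\<inverse> \<circ> \<gamma>\<close> is differentiable with nonzero derivative (within its domain) at every preimage under
  \<open>\<gamma>\<close> of almost every point of \<open>\<phi> ` K\<close>. The sign of the derivative says whether \<open>\<gamma>\<close> runs through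
  the point along or against the orientation of the chart. (At isolated points of the domain the
  derivative is arbitrary; there are only countably many of them.)
\<close>

definition transition_deriv :: "'y chart \<Rightarrow> real set \<Rightarrow> (real \<Rightarrow> 'y) \<Rightarrow> real \<Rightarrow> real \<Rightarrow> bool" where
  "transition_deriv c L \<gamma> s r \<longleftrightarrow>
     ((\<lambda>u. inv_into (fst c) (snd c) (\<gamma> u)) has_real_derivative r)
       (at s within {u\<in>L. \<gamma> u \<in> chart_image c})"

text \<open>
  A \<open>1\<close>-chain \<open>S\<close> is recorded by its coefficients: \<open>S c y\<close> is the coefficient of \<open>S\<close> at the point
  \<open>y \<in> chart_image c\<close> with respect to the orientation of \<open>c\<close>. In this form chains are added
  pointwise. Only the values at almost every point of \<open>chart_image c\<close>, for actual charts \<open>c\<close>, matter.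
\<close>

type_synonym ('y, 'g) chain1 = "'y chart \<Rightarrow> 'y \<Rightarrow> 'g"

text \<open>
  The push-forward under \<open>\<gamma>\<close> of the subset \<open>L\<close> of the oriented line with coefficient \<open>\<theta>\<close>: the
  contributions of the preimages of \<open>y\<close>, finitely many for almost every \<open>y\<close>, are added with sign.
\<close>

definition push_forward ::
    "real set \<Rightarrow> (real \<Rightarrow> 'y) \<Rightarrow> (real \<Rightarrow> 'g::ab_group_add) \<Rightarrow> ('y, 'g) chain1" where
  "push_forward L \<gamma> \<theta> c y =
     (\<Sum>s\<in>{s\<in>L. \<gamma> s = y}.
        if \<exists>r>0. transition_deriv c L \<gamma> s r then \<theta> s
        else if \<exists>r<0. transition_deriv c L \<gamma> s r then - \<theta> s
        else 0)"

definition chain_eq :: "'y metric \<Rightarrow> ('y, 'g) chain1 \<Rightarrow> ('y, 'g) chain1 \<Rightarrow> bool" where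
  "chain_eq Y S S' \<longleftrightarrow>
     (\<forall>c. chart Y c \<longrightarrow> (AE y in hausdorff_measure Y. y \<in> chart_image c \<longrightarrow> S c y = S' c y))"


subsection \<open>Rectifiable chains\<close>

text \<open>
  Every \<open>1\<close>-rectifiable Borel set is, up to a null set, a countable disjoint union of images of
  charts (Kirchheim), and an orientation of it is such a decomposition. So an oriented
  \<open>1\<close>-rectifiable set is a sequence of charts with disjoint images.
\<close>

definition oriented_set :: "'y metric \<Rightarrow> (nat \<Rightarrow> 'y chart) \<Rightarrow> bool" where
  "oriented_set Y \<kappa> \<longleftrightarrow> (\<forall>i. chart Y (\<kappa> i)) \<and> disjoint_family (\<lambda>i. chart_image (\<kappa> i))"

definition carrier_set :: "(nat \<Rightarrow> 'y chart) \<Rightarrow> 'y set" where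
  "carrier_set \<kappa> = (\<Union>i. chart_image (\<kappa> i))"

definition orientation_mass ::
    "('g \<Rightarrow> real) \<Rightarrow> 'y metric \<Rightarrow> (nat \<Rightarrow> 'y chart) \<Rightarrow> ('y \<Rightarrow> 'g) \<Rightarrow> ennreal" where
  "orientation_mass N Y \<kappa> g =
     (\<integral>\<^sup>+ y. ennreal (N (g y)) * indicator (carrier_set \<kappa>) y \<partial>hausdorff_measure Y)"

text \<open>Measurability of \<open>g\<close> is strong measurability: Borel measurable with separable range.\<close>

definition group_orientation ::
    "('g::ab_group_add \<Rightarrow> real) \<Rightarrow> 'y metric \<Rightarrow> (nat \<Rightarrow> 'y chart) \<Rightarrow> ('y \<Rightarrow> 'g) \<Rightarrow> bool" where
  "group_orientation N Y \<kappa> g \<longleftrightarrow>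
     oriented_set Y \<kappa> \<and>
     (\<forall>h e. {y \<in> carrier_set \<kappa>. N (g y - h) < e} \<in> sets (hausdorff_measure Y)) \<and>
     (\<exists>D. countable D \<and> (\<forall>y\<in>carrier_set \<kappa>. \<forall>e>0. \<exists>h\<in>D. N (g y - h) < e)) \<and>
     orientation_mass N Y \<kappa> g < \<infinity>"

definition oriented_chain :: "(nat \<Rightarrow> 'y chart) \<Rightarrow> ('y \<Rightarrow> 'g::ab_group_add) \<Rightarrow> ('y, 'g) chain1" where
  "oriented_chain \<kappa> g c y =
     (\<Sum>i\<in>{i. y \<in> chart_image (\<kappa> i)}.
        push_forward (fst (\<kappa> i)) (snd (\<kappa> i)) (\<lambda>s. g (snd (\<kappa> i) s)) c y)"

definition rectifiable_chain ::
    "('g::ab_group_add \<Rightarrow> real) \<Rightarrow> 'y metric \<Rightarrow> ('y, 'g) chain1 \<Rightarrow> bool" where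
  "rectifiable_chain N Y S \<longleftrightarrow>
     (\<exists>\<kappa> g. group_orientation N Y \<kappa> g \<and> chain_eq Y S (oriented_chain \<kappa> g))"

text \<open>
  All group-valued orientations representing \<open>S\<close> have the same mass, so the infimum only selects
  this common value (and is \<open>\<infinity>\<close> if \<open>S\<close> is not rectifiable).
\<close>

definition mass ::
    "('g::ab_group_add \<Rightarrow> real) \<Rightarrow> 'y metric \<Rightarrow> ('y, 'g) chain1 \<Rightarrow> ennreal" where
  "mass N Y S =
     (INF (\<kappa>, g)\<in>{(\<kappa>, g). group_orientation N Y \<kappa> g \<and> chain_eq Y S (oriented_chain \<kappa> g)}.
        orientation_mass N Y \<kappa> g)"


subsection \<open>Lipschitz chains, boundary and filling length\<close>

text \<open>The list \<open>[(g\<^sub>1, \<gamma>\<^sub>1), \<dots>]\<close> stands for the sum of the push-forwards of \<open>g\<^sub>i\<close> times \<open>[0,1]\<close> under \<open>\<gamma>\<^sub>i\<close>.\<close>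

type_synonym ('y, 'g) lipschitz_sum = "('g \<times> (real \<Rightarrow> 'y)) list"

definition lipschitz_chain :: "'y metric \<Rightarrow> ('y, 'g) lipschitz_sum \<Rightarrow> bool" where
  "lipschitz_chain Y P \<longleftrightarrow> (\<forall>(g, \<gamma>)\<in>set P. lipschitz_path Y \<gamma>)"

definition chain_of :: "('y, 'g::ab_group_add) lipschitz_sum \<Rightarrow> ('y, 'g) chain1" where
  "chain_of P c y = (\<Sum>(g, \<gamma>)\<leftarrow>P. push_forward {0..1} \<gamma> (\<lambda>_. g) c y)"

definition lipschitz_boundary :: "('y, 'g::ab_group_add) lipschitz_sum \<Rightarrow> 'y \<Rightarrow>\<^sub>0 'g" where
  "lipschitz_boundary P =
     (\<Sum>(g, \<gamma>)\<leftarrow>P. Poly_Mapping.single (\<gamma> 1) g - Poly_Mapping.single (\<gamma> 0) g)"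

definition flat_norm ::
    "('g::ab_group_add \<Rightarrow> real) \<Rightarrow> 'y metric \<Rightarrow> ('y \<Rightarrow>\<^sub>0 'g) \<Rightarrow> ennreal" where
  "flat_norm N Y W =
     (INF Q\<in>{Q. lipschitz_chain Y Q}.
        ennreal (mass0 N (W - lipschitz_boundary Q)) + mass N Y (chain_of Q))"

definition has_boundary ::
    "('g::ab_group_add \<Rightarrow> real) \<Rightarrow> 'y metric \<Rightarrow> ('y, 'g) chain1 \<Rightarrow> ('y \<Rightarrow>\<^sub>0 'g) \<Rightarrow> bool" where
  "has_boundary N Y S Z \<longleftrightarrow>
     (\<exists>P :: nat \<Rightarrow> ('y, 'g) lipschitz_sum.
        (\<forall>q. lipschitz_chain Y (P q)) \<and>
        (\<lambda>q. mass N Y (\<lambda>c y. S c y - chain_of (P q) c y)) \<longlonglongrightarrow> 0 \<and>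
        (\<lambda>q. flat_norm N Y (lipschitz_boundary (P q) - Z)) \<longlonglongrightarrow> 0)"

definition filling_length ::
    "('g::ab_group_add \<Rightarrow> real) \<Rightarrow> 'y metric \<Rightarrow> ('y \<Rightarrow>\<^sub>0 'g) \<Rightarrow> ennreal" where
  "filling_length N Y Z =
     (INF S\<in>{S. rectifiable_chain N Y S \<and> has_boundary N Y S Z}. mass N Y S)"

end

theory Submission
  imports Defs
begin

text \<open>
  The hypothesis is tested on circles only. Let the circle have length \<open>n\<close> and carry the elements
  \<open>g 1, \<dots>, g n\<close> at \<open>n\<close> equidistant points. A chain that fills this configuration has, up to a small
  error, a constant coefficient on each of the \<open>n\<close> arcs, and the coefficient changes by \<open>g i\<close> at the
  \<open>i\<close>-th point. So the chain is described by a single element \<open>c\<close>, and the filling length is at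
  least the infimum over \<open>c\<close> of the sum of the norms of \<open>c - (g 1 + \<dots> + g k)\<close>
  (\<open>filling_length_circle\<close>). In a tree, on the other hand, the image of the configuration is filled
  by a star: join all the points to a common centre \<open>p\<close> by arcs and put \<open>g i\<close> on the \<open>i\<close>-th arc.
  Where arcs run together the coefficients add up, so the mass is at most the sum of \<open>N (g i)\<close> times
  the length of the \<open>i\<close>-th arc (\<open>filling_length_star\<close>).

  For \<open>n = 3\<close> the midpoint of the longest of the three arcs in the tree has distance at most \<open>1/2\<close>
  from all three points. Equality of the filling lengths then yields transports along the sides of
  the triangle whose total cost is at most half of \<open>N (g 1) + N (g 2) + N (g 3)\<close>. The triangle
  inequality gives the opposite estimate, hence each \<open>N (g i)\<close> is the sum of the norms of the two
  transports at \<open>i\<close> (\<open>three_point_splitting\<close>). For \<open>n = 4\<close> the midpoint \<open>p\<close> between the images of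
  the points \<open>1\<close> and \<open>3\<close> has some distance \<open>\<alpha>\<close> from these two and at most \<open>1 - \<alpha>\<close> from the other
  two. If \<open>N (g 1) + N (g 3) = N (g 2) + N (g 4)\<close>, the bound for the mass of the star is the same
  for all \<open>\<alpha>\<close>, and again all the triangle inequalities are sharp (\<open>norm_refinement\<close>). In both cases the
  transports are exact and not only optimal up to \<open>\<epsilon>\<close> because \<open>N\<close> has optimal transport plans.

  These two properties suffice for any number of points (\<open>nonbranching_plan_exists\<close>): merge two of
  the points, take a plan for the merged configuration, separate the two points by
  \<open>three_point_splitting\<close>, and distribute the transports of the merged point among the two by
  repeated use of \<open>norm_refinement\<close>.

  The lower bound on the circle rests on the fact that almost every level of a Lipschitz function on
  the line is crossed transversally at each of its preimages
  (\<open>lipschitz_ae_level_transversal\<close>): then preimages can be counted with signs, and the count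
  depends only on the values at the end points (\<open>sum_signed_crossings\<close>). The upper bound in the tree
  rests on the parametrisation of arcs by their Hausdorff measure (\<open>arclength_coherent\<close>), which gives
  overlapping arcs the same parameter and the same orientation.
\<close>


section \<open>Lipschitz functions on the line\<close>

lemma emeasure_UN_countable_le:
  assumes F: "countable F" and J: "\<And>k. k \<in> F \<Longrightarrow> J k \<in> sets M"
  shows "emeasure M (\<Union>k\<in>F. J k) \<le> (\<integral>\<^sup>+k. emeasure M (J k) \<partial>count_space F)"
proof -
  have "emeasure M (\<Union>k\<in>F. J k) = (\<integral>\<^sup>+x. indicator (\<Union>k\<in>F. J k) x \<partial>M)"
    using F J by (intro nn_integral_indicator[symmetric] sets.countable_UN'') auto
  also have "\<dots> \<le> (\<integral>\<^sup>+x. (\<integral>\<^sup>+k. indicator (J k) x \<partial>count_space F) \<partial>M)"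
  proof (rule nn_integral_mono)
    fix x
    show "(indicator (\<Union>k\<in>F. J k) x :: ennreal) \<le> (\<integral>\<^sup>+k. indicator (J k) x \<partial>count_space F)"
    proof (cases "x \<in> (\<Union>k\<in>F. J k)")
      case True
      then obtain k where k: "k \<in> F" "x \<in> J k" by blast
      have "(1::ennreal) = (\<integral>\<^sup>+i. indicator {k} i \<partial>count_space F)"
        using k by (subst nn_integral_indicator) auto
      also have "\<dots> \<le> (\<integral>\<^sup>+i. indicator (J i) x \<partial>count_space F)"
        using k by (intro nn_integral_mono) (auto simp: indicator_def)
      finally show ?thesis using True by simp
    qed simp
  qed
  also have "\<dots> = (\<integral>\<^sup>+k. (\<integral>\<^sup>+x. indicator (J k) x \<partial>M) \<partial>count_space F)"
    using F J by (intro nn_integral_count_space_nn_integral) auto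
  also have "\<dots> = (\<integral>\<^sup>+k. emeasure M (J k) \<partial>count_space F)"
    using J by (intro nn_integral_cong) auto
  finally show ?thesis .
qed

text \<open>
  Vitali's theorem covers \<open>E\<close>, up to a null set, by disjoint intervals inside
  \<open>G\<close> with short images, and a Lipschitz function maps the remaining null set to a null
  set. Open supersets take the place of the outer measure, since \<open>E\<close> may fail to be
  measurable.
\<close>

lemma vitali_image_outer:
  fixes v :: "real \<Rightarrow> real"
  assumes lip: "C-lipschitz_on UNIV v" and G: "open G" "E \<subseteq> G" and p: "0 \<le> p" and e: "0 < e"
    and I: "\<And>x d. x \<in> E \<Longrightarrow> 0 < d \<Longrightarrow>
      \<exists>a b c. a < b \<and> x \<in> {a..b} \<and> b - a < d \<and> v ` {a..b} \<subseteq> {c..c + p * (b - a)}"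
  obtains G' where "open G'" "v ` E \<subseteq> G'" "emeasure lborel G' \<le> ennreal p * emeasure lborel G + ennreal e"
proof -
  define K where "K = {(a, b). a < b \<and> {a..b} \<subseteq> G \<and> (\<exists>c. v ` {a..b} \<subseteq> {c..c + p * (b - a)})}"
  define m where "m = (\<lambda>(a::real, b::real). (a + b) / 2)"
  define r where "r = (\<lambda>(a::real, b::real). (b - a) / 2)"
  have cb: "cball (m k) (r k) = {fst k..snd k}" for k
    by (cases k) (auto simp: m_def r_def cball_eq_atLeastAtMost field_simps)
  have "\<exists>i. i \<in> K \<and> x \<in> cball (m i) (r i) \<and> r i < d" if x: "x \<in> E" and d: "0 < d" for x d
  proof -
    obtain t where t: "t > 0" "ball x t \<subseteq> G" using G x by (meson open_contains_ball subsetD)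
    obtain a b c where abc: "a < b" "x \<in> {a..b}" "b - a < min d t" "v ` {a..b} \<subseteq> {c..c + p * (b - a)}"
      using I[OF x, of "min d t"] d t by auto
    have "{a..b} \<subseteq> ball x t" using abc by (auto simp: dist_real_def)
    then have "(a, b) \<in> K" using abc t by (auto simp: K_def)
    moreover have "r (a, b) < d" using abc by (simp add: r_def)
    ultimately show ?thesis using abc(2) cb[of "(a,b)"] by (intro exI[of _ "(a,b)"]) auto
  qed
  note cov = this
  have rpos: "0 < r k" if "k \<in> K" for k using that by (auto simp: K_def r_def)
  obtain F where F: "countable F" "F \<subseteq> K"
     "pairwise (\<lambda>i j. disjnt (cball (m i) (r i)) (cball (m j) (r j))) F"
     "negligible (E - (\<Union>i\<in>F. cball (m i) (r i)))"
    by (rule Vitali_covering_theorem_cballs[of K r E m, OF rpos cov])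
  define c where "c k = (SOME c. v ` {fst k..snd k} \<subseteq> {c..c + p * (snd k - fst k)})" for k
  have c: "v ` {fst k..snd k} \<subseteq> {c k..c k + p * (snd k - fst k)}" if "k \<in> K" for k
  proof -
    have "\<exists>c. v ` {fst k..snd k} \<subseteq> {c..c + p * (snd k - fst k)}"
      using that unfolding K_def by (cases k) (simp only: mem_Collect_eq prod.case fst_conv snd_conv)
    then show ?thesis unfolding c_def by (rule someI_ex)
  qed
  define J where "J k = {c k..c k + p * (snd k - fst k)}" for k
  define Z where "Z = v ` (E - (\<Union>i\<in>F. cball (m i) (r i)))"
  have Z: "negligible Z"
    unfolding Z_def
    by (rule negligible_locally_Lipschitz_image[OF _ F(4)])
       (use lip in \<open>auto simp: lipschitz_on_def dist_norm intro!: exI[of _ UNIV] exI[of _ C]\<close>)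
  define A where "A = (\<Union>k\<in>F. J k) \<union> Z"
  have Jm: "(\<Union>k\<in>F. J k) \<in> sets lebesgue"
    unfolding J_def using F(1) by (intro sets.countable_UN'') auto
  then have Am: "A \<in> sets lebesgue"
    unfolding A_def using negligible_imp_sets[OF Z] by (rule sets.Un)
  have vE: "v ` E \<subseteq> A"
    using c F(2) unfolding A_def Z_def J_def cb by fastforce
  have "emeasure lebesgue A \<le> emeasure lebesgue (\<Union>k\<in>F. J k) + emeasure lebesgue Z"
    unfolding A_def using Jm negligible_imp_sets[OF Z]
    by (rule emeasure_subadditive)
  also have "emeasure lebesgue Z = 0" using Z negligible_iff_emeasure0[OF negligible_imp_sets[OF Z]] by blast
  also have "emeasure lebesgue (\<Union>k\<in>F. J k) \<le> (\<integral>\<^sup>+k. emeasure lebesgue (J k) \<partial>count_space F)"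
    by (rule emeasure_UN_countable_le) (auto simp: J_def F)
  also have "\<dots> = (\<integral>\<^sup>+k. ennreal p * emeasure lborel {fst k..snd k} \<partial>count_space F)"
    using F(2) p by (intro nn_integral_cong) (auto simp: J_def K_def ennreal_mult' )
  also have "\<dots> = ennreal p * (\<integral>\<^sup>+k. emeasure lborel {fst k..snd k} \<partial>count_space F)"
    by (rule nn_integral_cmult) auto
  also have "(\<integral>\<^sup>+k. emeasure lborel {fst k..snd k} \<partial>count_space F) = emeasure lborel (\<Union>k\<in>F. {fst k..snd k})"
    using F by (intro emeasure_UN_countable[symmetric])
      (auto simp: cb disjoint_family_on_def pairwise_def disjnt_def)
  also have "\<dots> \<le> emeasure lborel G"
  proof (rule emeasure_mono)
    have "{fst k..snd k} \<subseteq> G" if "k \<in> F" for k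
      using F(2) that unfolding K_def by (cases k) auto
    then show "(\<Union>k\<in>F. {fst k..snd k}) \<subseteq> G" by blast
  qed (use G in simp)
  finally have Ale: "emeasure lebesgue A \<le> ennreal p * emeasure lborel G"
    by (auto simp: mult_left_mono)
  obtain G' where G': "open G'" "A \<subseteq> G'" "(G' - A) \<in> lmeasurable" "emeasure lebesgue (G' - A) < ennreal e"
    using sets_lebesgue_outer_open[OF Am e] by blast
  have "emeasure lborel G' = emeasure lebesgue (A \<union> (G' - A))"
    using G' by (simp add: Un_absorb1)
  also have "\<dots> \<le> emeasure lebesgue A + emeasure lebesgue (G' - A)"
    using Am G' by (intro emeasure_subadditive) auto
  also have "\<dots> \<le> ennreal p * emeasure lborel G + ennreal e"
    using Ale G'(4) by (intro add_mono) auto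
  finally show ?thesis using that[of G'] G' vE by blast
qed

lemma bilipschitz_inverse:
  fixes U :: "real \<Rightarrow> real"
  assumes c: "0 < c" and lo: "\<And>x y. x \<le> y \<Longrightarrow> c * (y - x) \<le> U y - U x"
    and hi: "\<And>x y. x \<le> y \<Longrightarrow> U y - U x \<le> C * (y - x)"
  obtains W where "\<And>x. W (U x) = x" "\<And>y. U (W y) = y" "(1/c)-lipschitz_on UNIV W" "C-lipschitz_on UNIV U"
    "mono U" "mono W"
proof -
  have U: "\<bar>U x - U y\<bar> \<le> C * \<bar>x - y\<bar>" for x y
  proof -
    have *: "\<bar>U x - U y\<bar> \<le> C * \<bar>x - y\<bar>" if "x \<le> y" for x y
    proof -
      have "0 \<le> c * (y - x)" using that c by simp
      then show ?thesis using lo[OF that] hi[OF that] that by (simp add: abs_if)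
    qed
    show ?thesis using *[of x y] *[of y x] by (cases "x \<le> y") (auto simp: abs_minus_commute)
  qed
  have "C \<ge> 0" using lo[of 0 1] hi[of 0 1] c by simp
  then have LU: "C-lipschitz_on UNIV U" using U by (auto simp: lipschitz_on_def dist_real_def)
  have inc: "c * \<bar>x - y\<bar> \<le> \<bar>U x - U y\<bar>" for x y
    using lo[of x y] lo[of y x] by (cases "x \<le> y") (auto simp: abs_if)
  have "inj U"
  proof (rule injI)
    fix x y assume "U x = U y"
    then have "c * \<bar>x - y\<bar> \<le> 0" using inc[of x y] by simp
    then show "x = y" using c by (simp add: mult_le_0_iff)
  qed
  have "\<exists>x. U x = y" for y
  proof -
    define r where "r = \<bar>y - U 0\<bar> / c"
    have r: "r \<ge> 0" "c * r = \<bar>y - U 0\<bar>" using c by (auto simp: r_def)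
    have "U (-r) \<le> y" "y \<le> U r" using lo[of "-r" 0] lo[of 0 r] r by auto
    moreover have "continuous_on {-r..r} U"
      using LU by (meson lipschitz_on_continuous_on continuous_on_subset subset_UNIV)
    ultimately show ?thesis using IVT'[of U "-r" y r] r by auto
  qed
  then have "surj U" unfolding surj_def by metis
  define W where "W = inv U"
  have 1: "W (U x) = x" "U (W y) = y" for x y
    using \<open>inj U\<close> \<open>surj U\<close> by (auto simp: W_def surj_f_inv_f)
  have "\<bar>W x - W y\<bar> \<le> 1/c * \<bar>x - y\<bar>" for x y
    using inc[of "W x" "W y"] c by (simp add: 1 field_simps)
  then have "(1/c)-lipschitz_on UNIV W" using c by (auto simp: lipschitz_on_def dist_real_def)
  moreover have mU: "mono U" 
  proof (rule monoI)
    fix x y :: real assume "x \<le> y"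
    moreover from this have "0 \<le> c * (y - x)" using c by simp
    ultimately show "U x \<le> U y" using lo[of x y] by linarith
  qed
  moreover have "mono W"
  proof (rule monoI, rule ccontr)
    fix x y :: real assume "x \<le> y" "\<not> W x \<le> W y"
    then have "U (W y) \<le> U (W x)" using mU by (simp add: monoD)
    then have "x = y" using \<open>x \<le> y\<close> 1 by simp
    then show False using \<open>\<not> W x \<le> W y\<close> by simp
  qed
  ultimately show ?thesis using that[of W] 1 LU by blast
qed

text \<open>
  Small quotients make \<open>U\<close> shrink \<open>E\<close> by the factor \<open>p\<close>, and
  large quotients make the inverse of \<open>U\<close> shrink \<open>U ` E\<close> by the factor
  \<open>1/q\<close>. So the outer measure of \<open>E\<close> is at most \<open>p/q < 1\<close>
  times itself.
\<close>

lemma negligible_oscillating_quotients: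
  fixes U :: "real \<Rightarrow> real"
  assumes c: "0 < c" and lo: "\<And>x y. x \<le> y \<Longrightarrow> c * (y - x) \<le> U y - U x"
    and hi: "\<And>x y. x \<le> y \<Longrightarrow> U y - U x \<le> C * (y - x)" and pq: "0 \<le> p" "p < q"
    and E: "bounded E"
    and P: "\<And>x d. x \<in> E \<Longrightarrow> 0 < d \<Longrightarrow> \<exists>a b. a < b \<and> x \<in> {a..b} \<and> b - a < d \<and> U b - U a \<le> p * (b - a)"
    and Q: "\<And>x d. x \<in> E \<Longrightarrow> 0 < d \<Longrightarrow> \<exists>a b. a < b \<and> x \<in> {a..b} \<and> b - a < d \<and> q * (b - a) \<le> U b - U a"
  shows "negligible E"
proof -
  obtain W where W: "\<And>x. W (U x) = x" "\<And>y. U (W y) = y" "(1/c)-lipschitz_on UNIV W" "C-lipschitz_on UNIV U"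
    "mono U" "mono W"
    using bilipschitz_inverse[OF c lo hi] by metis
  have C: "C \<ge> 0" "C > 0" using lo[of 0 1] hi[of 0 1] c by auto
  define \<G> where "\<G> = {m. \<exists>G. open G \<and> E \<subseteq> G \<and> emeasure lborel G \<le> ennreal m \<and> 0 \<le> m}"
  have step: "(p / q) * m + e \<in> \<G>" if m: "m \<in> \<G>" and e: "e > 0" for m e
  proof -
    obtain G where G: "open G" "E \<subseteq> G" "emeasure lborel G \<le> ennreal m" "0 \<le> m" using m by (auto simp: \<G>_def)
    define e1 where "e1 = min 1 q * e / 2"
    have e1: "e1 > 0" "e1 / q \<le> e / 2"
      using e pq by (auto simp: e1_def min_def field_simps)
    obtain G1 where G1: "open G1" "U ` E \<subseteq> G1" "emeasure lborel G1 \<le> ennreal p * emeasure lborel G + ennreal e1"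
    proof (rule vitali_image_outer[OF W(4) G(1,2) pq(1) e1(1)])
      fix x d :: real assume "x \<in> E" "0 < d"
      then obtain a b where ab: "a < b" "x \<in> {a..b}" "b - a < d" "U b - U a \<le> p * (b - a)" using P by blast
      then have "U ` {a..b} \<subseteq> {U a..U a + p * (b - a)}"
        using W(5) by (auto simp: mono_def) (smt (verit))
      then show "\<exists>a b c. a < b \<and> x \<in> {a..b} \<and> b - a < d \<and> U ` {a..b} \<subseteq> {c..c + p * (b - a)}"
        using ab by blast
    qed (rule that)
    obtain G2 where G2: "open G2" "W ` (U ` E) \<subseteq> G2" "emeasure lborel G2 \<le> ennreal (1/q) * emeasure lborel G1 + ennreal (e/2)"
    proof (rule vitali_image_outer[OF W(3) G1(1,2), of "1/q" "e/2"])
      fix y d :: real assume "y \<in> U ` E" "0 < d"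
      then obtain x where x: "x \<in> E" "y = U x" by blast
      obtain a b where ab: "a < b" "x \<in> {a..b}" "b - a < d / C" "q * (b - a) \<le> U b - U a" 
        using Q[OF x(1), of "d / C"] C \<open>0 < d\<close> by auto
      have "0 < q * (b - a)" using ab pq by simp
      then have "U a < U b" using ab by linarith
      moreover have "U b - U a < d"
        using hi[of a b] ab C by (simp add: field_simps)
      moreover have "y \<in> {U a..U b}" using W(5) ab x by (auto simp: mono_def)
      moreover have "W ` {U a..U b} \<subseteq> {a..a + (1/q) * (U b - U a)}"
      proof -
        have "W (U a) \<le> W z" "W z \<le> W (U b)" if "z \<in> {U a..U b}" for z using W(6) that by (auto simp: mono_def)
        moreover have "b \<le> a + (1/q) * (U b - U a)" using ab pq by (simp add: field_simps)
        ultimately show ?thesis unfolding W(1) by fastforce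
      qed
      ultimately show "\<exists>a b c. a < b \<and> y \<in> {a..b} \<and> b - a < d \<and> W ` {a..b} \<subseteq> {c..c + (1/q) * (b - a)}"
        by blast
    qed (use pq e that in auto)
    have "emeasure lborel G1 \<le> ennreal (p * m + e1)"
    proof -
      have "emeasure lborel G1 \<le> ennreal p * ennreal m + ennreal e1"
        using G1(3) G(3) by (meson add_right_mono mult_left_mono order_trans zero_le)
      then show ?thesis using G(4) pq e1 by (simp add: ennreal_mult' ennreal_plus)
    qed
    then have "emeasure lborel G2 \<le> ennreal (1/q) * ennreal (p * m + e1) + ennreal (e/2)"
      using G2(3) by (meson add_right_mono mult_left_mono order_trans zero_le)
    also have "\<dots> = ennreal ((1/q) * (p * m + e1) + e/2)"
    proof -
      have "0 \<le> p * m + e1" "0 \<le> 1 / q" using G(4) pq e1 by auto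
      then show ?thesis using e pq by (simp only: ennreal_mult[symmetric] ennreal_plus[symmetric] mult_nonneg_nonneg)
    qed
    also have "\<dots> \<le> ennreal ((p / q) * m + e)"
    proof (rule ennreal_leI)
      have "(1/q) * (p * m + e1) + e/2 = (p / q) * m + e1 / q + e/2" by (simp add: add_divide_distrib)
      then show "(1/q) * (p * m + e1) + e/2 \<le> (p / q) * m + e" using e1(2) by linarith
    qed
    finally have "emeasure lborel G2 \<le> ennreal ((p / q) * m + e)" .
    moreover have "E \<subseteq> G2" using G2(2) W(1) by (auto simp: image_image)
    ultimately show ?thesis using G2(1) G(4) pq e unfolding \<G>_def by auto
  qed
  obtain r where r: "E \<subseteq> ball 0 r" "r > 0" using E bounded_subset_ballD by blast
  have ne: "2 * r \<in> \<G>"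
    unfolding \<G>_def using r by (auto intro!: exI[of _ "ball 0 r"] simp: ball_eq_greaterThanLessThan)
  have bdd: "bdd_below \<G>" by (rule bdd_belowI[of _ 0]) (auto simp: \<G>_def)
  have ne': "\<G> \<noteq> {}" using ne by blast
  then have I0: "Inf \<G> \<ge> 0" by (rule cInf_greatest) (auto simp: \<G>_def)
  have contract: "Inf \<G> \<le> (p / q) * m" if "m \<in> \<G>" for m
  proof (rule field_le_epsilon)
    fix e :: real assume "0 < e"
    show "Inf \<G> \<le> (p / q) * m + e" using step[OF that \<open>0 < e\<close>] bdd by (rule cInf_lower)
  qed
  have "Inf \<G> = 0"
  proof (rule ccontr)
    assume "Inf \<G> \<noteq> 0"
    then have pos: "Inf \<G> > 0" using I0 by simp
    have pq1: "p / q < 1" "0 \<le> p / q" using pq by auto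
    obtain s where s: "p / q < s" "s < 1" using dense[OF pq1(1)] by blast
    moreover have "0 < s" using pq1(2) s(1) by (rule le_less_trans)
    ultimately have s: "p / q < s" "s < 1" "s > 0" by blast+
    have "Inf \<G> < Inf \<G> / s" using pos s by (simp add: field_simps)
    then obtain m where m: "m \<in> \<G>" "m < Inf \<G> / s" using cInf_lessD[of \<G> "Inf \<G> / s"] ne by auto
    have "Inf \<G> \<le> (p / q) * m" using m(1) by (rule contract)
    also have "\<dots> \<le> s * m" using s m(1) by (intro mult_right_mono) (auto simp: \<G>_def)
    also have "\<dots> < Inf \<G>" using m s by (simp add: field_simps)
    finally show False by simp
  qed
  show ?thesis
    unfolding negligible_outer_le
  proof (intro allI impI)
    fix e :: real assume "e > 0"
    then obtain m where "m \<in> \<G>" "m < e" using cInf_lessD[of \<G> e] ne \<open>Inf \<G> = 0\<close> by auto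
    then obtain G where G: "open G" "E \<subseteq> G" "emeasure lborel G \<le> ennreal m" "0 \<le> m" by (auto simp: \<G>_def)
    have fin: "emeasure lborel G < \<infinity>" using G(3) by (auto intro: le_less_trans)
    have "G \<in> lmeasurable" using fin G(1) by (intro fmeasurableI) auto
    moreover have "measure lebesgue G \<le> e"
    proof -
      have "emeasure lborel G \<le> ennreal e" using G(3) \<open>m < e\<close> by (meson ennreal_leI less_imp_le order_trans)
      then show ?thesis using G(1) \<open>e > 0\<close> by (simp add: measure_def enn2real_leI)
    qed
    ultimately show "\<exists>T. E \<subseteq> T \<and> T \<in> lmeasurable \<and> measure lebesgue T \<le> e" using G(2) by blast
  qed
qed

text \<open>
  A large linear function added to \<open>v\<close> makes it increasing and bi-Lipschitz. Where the
  derivative does not exist, two rational numbers separate the lower limit of the difference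
  quotients from the upper one.
\<close>

theorem lipschitz_differentiable_ae:
  fixes v :: "real \<Rightarrow> real"
  assumes v: "C-lipschitz_on UNIV v"
  shows "negligible {x. \<not> v differentiable (at x)}"
proof -
  define c where "c = C + 1"
  have C: "C \<ge> 0" and c: "c > 0" using v by (auto simp: lipschitz_on_def c_def)
  define U where "U x = v x + 2 * c * x" for x
  have vb: "\<bar>v x - v y\<bar> \<le> c * \<bar>x - y\<bar>" for x y
  proof -
    have "\<bar>v x - v y\<bar> \<le> C * \<bar>x - y\<bar>" using v by (auto simp: lipschitz_on_def dist_real_def)
    also have "\<dots> \<le> c * \<bar>x - y\<bar>" by (intro mult_right_mono) (auto simp: c_def)
    finally show ?thesis .
  qed
  have lo: "c * (y - x) \<le> U y - U x" if "x \<le> y" for x y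
    using vb[of x y] that by (simp add: U_def algebra_simps abs_if split: if_splits)
  have hi: "U y - U x \<le> (3 * c) * (y - x)" if "x \<le> y" for x y
    using vb[of x y] that by (simp add: U_def algebra_simps abs_if split: if_splits)
  define f where "f x h = (U (x + h) - U x) / h" for x h
  have f: "c \<le> f x h" "f x h \<le> 3 * c" if "h \<noteq> 0" for x h
    using lo[of x "x + h"] lo[of "x + h" x] hi[of x "x + h"] hi[of "x + h" x] that
    unfolding f_def by (cases "h > 0"; simp add: field_simps)+
  define E where "E p q n = {x \<in> ball 0 (real n). (\<exists>\<^sub>F h in at 0. f x h \<le> p) \<and> (\<exists>\<^sub>F h in at 0. q \<le> f x h)}" for p q n
  have neg: "negligible (E p q n)" if pq: "0 \<le> p" "p < q" for p q n
  proof (rule negligible_oscillating_quotients[OF c lo hi pq])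
    show "bounded (E p q n)" by (rule bounded_subset[of "ball 0 (real n)"]) (auto simp: E_def)
  next
    fix x d :: real assume "x \<in> E p q n" "0 < d"
    then obtain h where h: "h \<noteq> 0" "\<bar>h\<bar> < d" "f x h \<le> p"
      by (auto simp: E_def frequently_def eventually_at not_le)
    then show "\<exists>a b. a < b \<and> x \<in> {a..b} \<and> b - a < d \<and> U b - U a \<le> p * (b - a)"
      unfolding f_def
      by (cases "h > 0"; intro exI[of _ "min x (x + h)"] exI[of _ "max x (x + h)"]) (auto simp: field_simps)
  next
    fix x d :: real assume "x \<in> E p q n" "0 < d"
    then obtain h where h: "h \<noteq> 0" "\<bar>h\<bar> < d" "q \<le> f x h"
      by (auto simp: E_def frequently_def eventually_at not_le)
    then show "\<exists>a b. a < b \<and> x \<in> {a..b} \<and> b - a < d \<and> q * (b - a) \<le> U b - U a"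
      unfolding f_def
      by (cases "h > 0"; intro exI[of _ "min x (x + h)"] exI[of _ "max x (x + h)"]) (auto simp: field_simps)
  qed
  have cover: "x \<in> (\<Union>(p, q, n)\<in>{(p, q, n). p \<in> \<rat> \<and> q \<in> \<rat> \<and> 0 \<le> p \<and> p < q}. E p q n)"
    if nd: "\<not> v differentiable (at x)" for x
  proof (rule ccontr)
    obtain n where n: "\<bar>x\<bar> < real n" using reals_Archimedean2 by blast
    assume "\<not> ?thesis"
    then have not_both: "\<not> ((\<exists>\<^sub>F h in at 0. f x h \<le> p) \<and> (\<exists>\<^sub>F h in at 0. q \<le> f x h))"
      if "p \<in> \<rat>" "q \<in> \<rat>" "0 \<le> p" "p < q" for p q
      using that n by (force simp: E_def)
    \<comment> \<open>the supremum of \<open>S\<close> is the lower limit of the quotients, hence their limit\<close>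
    define S where "S = {p. \<forall>\<^sub>F h in at 0. p \<le> f x h}"
    have ev: "\<forall>\<^sub>F h in at (0::real). h \<noteq> 0" by (rule eventually_neq_at_within)
    have cS: "c \<in> S" unfolding S_def using ev by (auto elim!: eventually_mono simp: f)
    have Sle: "p \<le> 3 * c" if "p \<in> S" for p
    proof -
      have "\<forall>\<^sub>F h in at (0::real). p \<le> f x h \<and> h \<noteq> 0" using that ev by (auto simp: S_def eventually_conj_iff)
      then obtain h where "p \<le> f x h" "h \<noteq> 0" using eventually_happens'[of "at (0::real)"] by force
      then show ?thesis using f(2)[of h x] by linarith
    qed
    have bS: "bdd_above S" using Sle by (meson bdd_aboveI)
    define l where "l = Sup S"
    have lc: "c \<le> l" unfolding l_def using cS bS by (rule cSup_upper)
    have "(f x \<longlongrightarrow> l) (at 0)"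
    proof (rule order_tendstoI)
      fix a assume "a < l"
      then obtain p where "p \<in> S" "a < p" unfolding l_def using less_cSupD[of S a] cS by auto
      then show "\<forall>\<^sub>F h in at 0. a < f x h" unfolding S_def by (auto elim!: eventually_mono)
    next
      fix a assume a: "l < a"
      show "\<forall>\<^sub>F h in at 0. f x h < a"
      proof (rule ccontr)
        assume "\<not> ?thesis"
        then have fr: "\<exists>\<^sub>F h in at 0. a \<le> f x h" by (simp add: frequently_def not_le)
        obtain p where p: "p \<in> \<rat>" "l < p" "p < a" using Rats_dense_in_real[OF a] by blast
        obtain q where q: "q \<in> \<rat>" "p < q" "q < a" using Rats_dense_in_real[OF p(3)] by blast
        have "\<exists>\<^sub>F h in at 0. q \<le> f x h" using fr q by (auto elim!: frequently_elim1)
        then have "\<not> (\<exists>\<^sub>F h in at 0. f x h \<le> p)" using not_both[of p q] p q lc c by auto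
        then have "\<forall>\<^sub>F h in at 0. p \<le> f x h" by (auto simp: frequently_def elim!: eventually_mono)
        then have "p \<le> l" unfolding l_def using bS by (intro cSup_upper) (auto simp: S_def)
        then show False using p by simp
      qed
    qed
    then have "(U has_real_derivative l) (at x)" by (simp add: DERIV_def f_def[abs_def])
    then have "((\<lambda>x. U x - 2 * c * x) has_real_derivative l - 2 * c) (at x)"
      by (auto intro!: derivative_eq_intros)
    moreover have "(\<lambda>x. U x - 2 * c * x) = v" by (auto simp: U_def)
    ultimately have "v differentiable (at x)" by (metis real_differentiable_def)
    then show False using nd by simp
  qed
  have cnt: "countable ({(p, q, n). p \<in> \<rat> \<and> q \<in> \<rat> \<and> 0 \<le> p \<and> p < q} :: (real \<times> real \<times> nat) set)"
    by (rule countable_subset[of _ "\<rat> \<times> \<rat> \<times> UNIV"]) (auto simp: countable_rat)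
  have "negligible (\<Union>k\<in>{(p, q, n). p \<in> \<rat> \<and> q \<in> \<rat> \<and> 0 \<le> p \<and> p < q}. case k of (p, q, n) \<Rightarrow> E p q n)"
    by (rule negligible_countable_Union[OF countable_image[OF cnt]]) (auto intro: neg)
  then show ?thesis
  proof (rule negligible_subset, intro subsetI)
    fix x assume "x \<in> {x. \<not> v differentiable (at x)}"
    then have "\<not> v differentiable (at x)" by simp
    then show "x \<in> (\<Union>k\<in>{(p, q, n). p \<in> \<rat> \<and> q \<in> \<rat> \<and> 0 \<le> p \<and> p < q}. case k of (p, q, n) \<Rightarrow> E p q n)"
      by (rule cover)
  qed
qed

text \<open>
  Close to a critical point the image of an interval is as short as desired compared with the
  interval, so \<open>vitali_image_outer\<close> applies with every \<open>p > 0\<close>.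
\<close>

lemma negligible_critical_values:
  fixes v :: "real \<Rightarrow> real"
  assumes v: "C-lipschitz_on UNIV v"
  shows "negligible (v ` {x. (v has_real_derivative 0) (at x)})"
proof -
  define E where "E n = {x \<in> ball 0 (real (Suc n)). (v has_real_derivative 0) (at x)}" for n
  have "negligible (v ` E n)" for n
    unfolding negligible_outer_le
  proof (intro allI impI)
    fix e :: real assume e: "e > 0"
    define p where "p = e / (4 * real (Suc n))"
    have p: "p > 0" using e by (simp add: p_def)
    have EG: "open (ball 0 (real (Suc n)) :: real set)" "E n \<subseteq> ball 0 (real (Suc n))" "0 \<le> p" "0 < e/2"
      using p e by (auto simp: E_def)
    obtain G where G: "open G" "v ` E n \<subseteq> G"
      "emeasure lborel G \<le> ennreal p * emeasure lborel (ball (0::real) (real (Suc n))) + ennreal (e/2)"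
    proof (rule vitali_image_outer[OF v EG])
      fix x d :: real assume x: "x \<in> E n" and d: "0 < d"
      have "(v has_derivative (\<lambda>h. 0)) (at x)" using x by (simp add: E_def has_field_derivative_def lambda_zero)
      then obtain t where t: "t > 0" "\<And>y. \<bar>y - x\<bar> < t \<Longrightarrow> \<bar>v y - v x\<bar> \<le> p/2 * \<bar>y - x\<bar>"
      proof -
        from \<open>(v has_derivative (\<lambda>h. 0)) (at x)\<close>
        have "\<forall>e>0. \<exists>d>0. \<forall>y. norm (y - x) < d \<longrightarrow> norm (v y - v x - 0) \<le> e * norm (y - x)"
          unfolding has_derivative_at_alt by blast
        then have "\<exists>d>0. \<forall>y. norm (y - x) < d \<longrightarrow> norm (v y - v x - 0) \<le> p/2 * norm (y - x)"
          using p half_gt_zero by blast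
        then show ?thesis using that by auto
      qed
      define h where "h = min (d/2) (t/2)"
      have h: "h > 0" "h < d" "h < t" using d t by (auto simp: h_def)
      have "\<bar>v y - v x\<bar> \<le> p/2 * h" if "y \<in> {x..x+h}" for y
        using t(2)[of y] that h p by (smt (verit) atLeastAtMost_iff mult_left_mono half_gt_zero)
      then have "v ` {x..x+h} \<subseteq> {v x - p/2 * h..(v x - p/2 * h) + p * ((x + h) - x)}"
      proof (intro image_subsetI)
        fix y assume "y \<in> {x..x+h}"
        then have "\<bar>v y - v x\<bar> \<le> p/2 * h" by fact
        moreover have "p * ((x + h) - x) = p/2 * h + p/2 * h" by simp
        ultimately show "v y \<in> {v x - p/2 * h..(v x - p/2 * h) + p * ((x + h) - x)}"
          unfolding atLeastAtMost_iff by linarith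
      qed
      then show "\<exists>a b c. a < b \<and> x \<in> {a..b} \<and> b - a < d \<and> v ` {a..b} \<subseteq> {c..c + p * (b - a)}"
        using h by (intro exI[of _ x] exI[of _ "x+h"] exI[of _ "v x - p/2 * h"]) auto
    qed (rule that)
    have "ennreal p * emeasure lborel (ball (0::real) (real (Suc n))) = ennreal (p * (2 * real (Suc n)))"
      using p by (simp add: ball_eq_greaterThanLessThan ennreal_mult'')
    also have "p * (2 * real (Suc n)) = e/2" using e by (simp add: p_def field_simps)
    finally have le: "emeasure lborel G \<le> ennreal e" using G(3) e by (simp add: ennreal_plus[symmetric] del: ennreal_plus)
    then have "G \<in> lmeasurable" using G(1) by (intro fmeasurableI) (auto intro: le_less_trans)
    moreover have "measure lebesgue G \<le> e"
      using G(1) le e by (simp add: measure_def enn2real_leI)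
    ultimately show "\<exists>T. v ` E n \<subseteq> T \<and> T \<in> lmeasurable \<and> measure lebesgue T \<le> e" using G(2) by blast
  qed
  then have "negligible (\<Union>n. v ` E n)" by (intro negligible_countable_Union) auto
  moreover have "v ` {x. (v has_real_derivative 0) (at x)} \<subseteq> (\<Union>n. v ` E n)"
  proof safe
    fix x assume x: "(v has_real_derivative 0) (at x)"
    obtain n where "\<bar>x\<bar> < real n" using reals_Archimedean2 by blast
    then have "x \<in> E n" using x by (auto simp: E_def)
    then show "v x \<in> (\<Union>n. v ` E n)" by blast
  qed
  ultimately show ?thesis by (rule negligible_subset)
qed

lemma negligible_lipschitz_image:
  fixes v :: "real \<Rightarrow> real"
  assumes v: "C-lipschitz_on UNIV v" and Z: "negligible Z"
  shows "negligible (v ` Z)"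
proof (rule negligible_locally_Lipschitz_image[OF _ Z])
  fix x assume "x \<in> Z"
  have "\<forall>y\<in>Z \<inter> UNIV. norm (v y - v x) \<le> C * norm (y - x)"
    using v by (auto simp: lipschitz_on_def dist_norm)
  then show "\<exists>T B. open T \<and> x \<in> T \<and> (\<forall>y\<in>Z \<inter> T. norm (v y - v x) \<le> B * norm (y - x))"
    by (intro exI[of _ UNIV] exI[of _ C] conjI open_UNIV UNIV_I)
qed (rule order_refl)

text \<open>
  The points without derivative form a null set, which a Lipschitz function maps to a null set, and
  the critical values form a null set as well.
\<close>

lemma lipschitz_ae_level_transversal:
  fixes v :: "real \<Rightarrow> real"
  assumes v: "C-lipschitz_on UNIV v"
  shows "negligible {t. \<exists>s. v s = t \<and> \<not> (\<exists>r. r \<noteq> 0 \<and> (v has_real_derivative r) (at s))}"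
proof -
  have "negligible (v ` {x. \<not> v differentiable (at x)})"
    by (rule negligible_lipschitz_image[OF v lipschitz_differentiable_ae[OF v]])
  then have "negligible (v ` {x. \<not> v differentiable (at x)} \<union> v ` {x. (v has_real_derivative 0) (at x)})"
    using negligible_critical_values[OF v] by (rule negligible_Un)
  then show ?thesis
  proof (rule negligible_subset, intro subsetI)
    fix t assume "t \<in> {t. \<exists>s. v s = t \<and> \<not> (\<exists>r. r \<noteq> 0 \<and> (v has_real_derivative r) (at s))}"
    then obtain s where s: "t = v s" "\<not> (\<exists>r. r \<noteq> 0 \<and> (v has_real_derivative r) (at s))" by blast
    show "t \<in> v ` {x. \<not> v differentiable (at x)} \<union> v ` {x. (v has_real_derivative 0) (at x)}"
    proof (cases "(v has_real_derivative 0) (at s)")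
      case False
      then have "\<not> v differentiable (at s)" using s(2) unfolding real_differentiable_def by (metis (full_types))
      then show ?thesis using s(1) by blast
    qed (use s(1) in blast)
  qed
qed

section \<open>Signed crossings of a level\<close>

text \<open>
  A limit point of zeros would be a zero with derivative \<open>0\<close>.
\<close>

lemma finite_transversal_zeros:
  fixes u :: "real \<Rightarrow> real"
  assumes u: "continuous_on {a..b} u"
    and tr: "\<And>s. s \<in> {a..b} \<Longrightarrow> u s = 0 \<Longrightarrow> \<exists>r. r \<noteq> 0 \<and> (u has_real_derivative r) (at s)"
  shows "finite {s \<in> {a..b}. u s = 0}"
proof (rule ccontr)
  let ?Z = "{s \<in> {a..b}. u s = 0}"
  assume inf: "infinite ?Z"
  have cl: "closed ?Z" by (rule continuous_closed_preimage_constant[OF u]) auto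
  then have "compact ?Z" by (metis (no_types, lifting) bounded_closed_interval bounded_subset compact_eq_bounded_closed mem_Collect_eq subsetI)
  then obtain s where s: "s \<in> ?Z" "s islimpt ?Z"
    using inf Heine_Borel_imp_Bolzano_Weierstrass[of ?Z ?Z] by blast
  then obtain r where r: "r \<noteq> 0" "(u has_real_derivative r) (at s)" using tr by auto
  then have "((\<lambda>y. (u y - u s) / (y - s)) \<longlongrightarrow> r) (at s)" by (simp add: has_field_derivative_iff)
  then have "\<forall>\<^sub>F y in at s. (u y - u s) / (y - s) \<noteq> 0" using r(1) by (rule tendsto_imp_eventually_ne)
  then have "\<forall>\<^sub>F y in at s. y \<notin> ?Z" by (rule eventually_mono) (use s in auto)
  then show False using s(2) by (simp add: islimpt_iff_eventually)
qed

text \<open>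
  The sign of \<open>u\<close> changes at each zero in the direction of the derivative and nowhere
  else; the induction removes the last zero. The sum takes values in a group so that it applies
  directly to the coefficients of \<^const>\<open>push_forward\<close>.
\<close>

lemma sum_signed_crossings:
  fixes u u' :: "real \<Rightarrow> real" and g :: "'g::ab_group_add"
  assumes "continuous_on {a..b} u" "a \<le> b" "u a \<noteq> 0" "u b \<noteq> 0"
    and "\<And>s. s \<in> {a..b} \<Longrightarrow> u s = 0 \<Longrightarrow> u' s \<noteq> 0 \<and> (u has_real_derivative u' s) (at s)"
  shows "(\<Sum>s\<in>{s \<in> {a..b}. u s = 0}. if 0 < u' s then g else - g) = (if 0 < u b then g else 0) - (if 0 < u a then g else 0)"
  using assms
proof (induction "card {s \<in> {a..b}. u s = 0}" arbitrary: b)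
  have same: "sgn (u x) = sgn (u y)" if "continuous_on {x..y} u" "x \<le> y" "\<And>s. s \<in> {x..y} \<Longrightarrow> u s \<noteq> 0" for x y
  proof (rule ccontr)
    assume "sgn (u x) \<noteq> sgn (u y)"
    moreover have "u x \<noteq> 0" "u y \<noteq> 0" using that by auto
    ultimately have "u x < 0 \<and> u y > 0 \<or> u x > 0 \<and> u y < 0" by (auto simp: sgn_if split: if_splits)
    then show False using IVT'[of u x 0 y] IVT2'[of u y 0 x] that by force
  qed
  {
    case 0
    have "finite {s \<in> {a..b}. u s = 0}" using 0 by (intro finite_transversal_zeros) auto
    then have "{s \<in> {a..b}. u s = 0} = {}" using 0 by simp
    moreover from this have "sgn (u a) = sgn (u b)" using same[of a b] 0 by blast
    then have "0 < u a \<longleftrightarrow> 0 < u b" by (metis sgn_greater)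
    ultimately show ?case by (simp only: sum.empty) simp
  next
    case (Suc n)
    let ?Z = "{s \<in> {a..b}. u s = 0}"
    have fin: "finite ?Z" using Suc.prems by (intro finite_transversal_zeros) auto
    have ne: "?Z \<noteq> {}"
    proof
      assume "?Z = {}"
      then show False using Suc.hyps(2) by (simp only: card.empty)
    qed
    define z where "z = Max ?Z"
    have z: "z \<in> ?Z" "\<And>s. s \<in> ?Z \<Longrightarrow> s \<le> z" using fin ne 
    proof -
      show "z \<in> ?Z" unfolding z_def using fin ne by (rule Max_in)
      show "s \<le> z" if "s \<in> ?Z" for s unfolding z_def using fin that by (rule Max_ge)
    qed
    then have "z \<noteq> a" "z \<noteq> b" using Suc.prems by auto
    then have zab: "a < z" "z < b" "u z = 0" using z by auto
    have dz: "u' z \<noteq> 0" "(u has_real_derivative u' z) (at z)" using Suc.prems(5)[of z] z by auto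
    obtain d where d: "d > 0" "\<And>h. 0 < h \<Longrightarrow> h < d \<Longrightarrow> sgn (u (z + h)) = sgn (u' z)"
      "\<And>h. 0 < h \<Longrightarrow> h < d \<Longrightarrow> sgn (u (z - h)) = - sgn (u' z)"
    proof (cases "u' z > 0")
      case True
      obtain d1 where "d1 > 0" "\<And>h. 0 < h \<Longrightarrow> h < d1 \<Longrightarrow> u z < u (z + h)"
        using DERIV_pos_inc_right[OF dz(2) True] by blast
      moreover obtain d2 where "d2 > 0" "\<And>h. 0 < h \<Longrightarrow> h < d2 \<Longrightarrow> u (z - h) < u z"
        using DERIV_pos_inc_left[OF dz(2) True] by blast
      ultimately show ?thesis using zab True by (intro that[of "min d1 d2"]) auto
    next
      case False
      then have F: "u' z < 0" using dz by simp
      obtain d1 where "d1 > 0" "\<And>h. 0 < h \<Longrightarrow> h < d1 \<Longrightarrow> u z > u (z + h)"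
        using DERIV_neg_dec_right[OF dz(2) F] by blast
      moreover obtain d2 where "d2 > 0" "\<And>h. 0 < h \<Longrightarrow> h < d2 \<Longrightarrow> u (z - h) > u z"
        using DERIV_neg_dec_left[OF dz(2) F] by blast
      ultimately show ?thesis using zab F by (intro that[of "min d1 d2"]) auto
    qed
    define h where "h = min (d/2) (min ((z - a) / 2) ((b - z) / 2))"
    define y where "y = (if ?Z - {z} = {} then z - h else max (z - h) ((z + Max (?Z - {z})) / 2))"
    have h: "0 < h" "h < d" "z - h > a" "z + h < b" using d(1) zab by (auto simp: h_def min_def field_simps)
    have y: "z - h \<le> y" "y < z" "\<And>s. s \<in> ?Z - {z} \<Longrightarrow> s < y"
    proof -
      show "z - h \<le> y" by (auto simp: y_def)
      have *: "Max (?Z - {z}) < z" if "?Z - {z} \<noteq> {}"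
      proof -
        have "Max (?Z - {z}) \<in> ?Z - {z}" using fin that by (intro Max_in) auto
        then show ?thesis using z(2)[of "Max (?Z - {z})"] by auto
      qed
      then show "y < z" using h by (auto simp: y_def)
      fix s assume s: "s \<in> ?Z - {z}"
      then have ne': "?Z - {z} \<noteq> {}" by blast
      have "s \<le> Max (?Z - {z})" using fin s by (intro Max_ge) auto
      then have "s < (z + Max (?Z - {z})) / 2" using *[OF ne'] by simp
      then show "s < y" using ne' unfolding y_def by (simp only: if_False)
    qed
    have Zy: "{s \<in> {a..y}. u s = 0} = ?Z - {z}" using y h zab by (auto simp: less_imp_le)
    have "card (?Z - {z}) = n" using Suc.hyps(2) fin z by simp
    then have c: "n = card {s \<in> {a..y}. u s = 0}" using Zy by simp
    have uy: "sgn (u y) = - sgn (u' z)" using d(3)[of "z - y"] y h by simp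
    have uy0: "u y \<noteq> 0" using uy dz by (metis add.inverse_neutral neg_equal_iff_equal sgn_0_0)
    have IH: "(\<Sum>s\<in>{s \<in> {a..y}. u s = 0}. if 0 < u' s then g else - g)
        = (if 0 < u y then g else 0) - (if 0 < u a then g else 0)"
      by (rule Suc.hyps(1)[OF c]) (use Suc.prems y h zab uy0 in \<open>auto intro: continuous_on_subset\<close>)
    have "sgn (u (z + h)) = sgn (u b)"
    proof (rule same)
      fix s assume "s \<in> {z + h..b}"
      then show "u s \<noteq> 0" using z(2)[of s] h zab by auto
    qed (use Suc.prems h zab in \<open>auto intro: continuous_on_subset\<close>)
    then have ub: "sgn (u b) = sgn (u' z)" using d(2)[of h] h by simp
    have iff: "0 < u b \<longleftrightarrow> 0 < u' z" "0 < u y \<longleftrightarrow> \<not> 0 < u' z"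
      using ub uy dz(1) by (auto simp: sgn_if split: if_splits)
    have "(\<Sum>s\<in>?Z. if 0 < u' s then g else - g)
        = (if 0 < u' z then g else - g) + (\<Sum>s\<in>?Z - {z}. if 0 < u' s then g else - g)"
      using fin z(1) by (rule sum.remove)
    also have "\<dots> = (if 0 < u b then g else 0) - (if 0 < u a then g else 0)"
      unfolding IH[unfolded Zy] iff by simp
    finally show ?case .
  }
qed

section \<open>Hausdorff measure of curves\<close>

lemma ediameter_le: "(\<And>x y. x \<in> B \<Longrightarrow> y \<in> B \<Longrightarrow> mdist Y x y \<le> r) \<Longrightarrow> ediameter Y B \<le> ennreal r"
  unfolding ediameter_def by (auto intro!: SUP_least ennreal_leI)

lemma mdist_le_ediameter: "x \<in> B \<Longrightarrow> y \<in> B \<Longrightarrow> ennreal (mdist Y x y) \<le> ediameter Y B"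
  unfolding ediameter_def by (intro SUP_upper2[of x] SUP_upper2[of y]) auto

lemma ediameter_empty [simp]: "ediameter Y {} = 0"
  by (simp add: ediameter_def bot_ennreal)

definition nonexpanding_on :: "'y metric \<Rightarrow> real set \<Rightarrow> (real \<Rightarrow> 'y) \<Rightarrow> bool" where
  "nonexpanding_on Y A \<gamma> \<longleftrightarrow> \<gamma> \<in> A \<rightarrow> mspace Y \<and> (\<forall>s\<in>A. \<forall>t\<in>A. mdist Y (\<gamma> s) (\<gamma> t) \<le> \<bar>s - t\<bar>)"

lemma nonexpanding_on_subset: "nonexpanding_on Y A \<gamma> \<Longrightarrow> B \<subseteq> A \<Longrightarrow> nonexpanding_on Y B \<gamma>"
  by (auto simp: nonexpanding_on_def Pi_iff subset_iff)

lemma nonexpanding_on_image: "nonexpanding_on Y A \<gamma> \<Longrightarrow> \<gamma> ` A \<subseteq> mspace Y"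
  by (auto simp: nonexpanding_on_def)

lemma nonexpanding_on_Lipschitz:
  "nonexpanding_on Y A \<gamma> \<Longrightarrow> Lipschitz_continuous_map (submetric euclidean_metric A) Y \<gamma>"
  unfolding nonexpanding_on_def Lipschitz_continuous_map_def
  by (auto simp: Pi_iff dist_real_def intro!: exI[of _ 1])

text \<open>
  Cut the interval into equal pieces of length at most \<open>\<delta>\<close>.
\<close>

lemma hausdorff_outer_image_interval_le:
  assumes g: "nonexpanding_on Y {a..b} \<gamma>"
  shows "hausdorff_outer Y (\<gamma> ` {a..b}) \<le> ennreal (b - a)"
proof (cases "a \<le> b")
  case False
  then show ?thesis by (simp add: hausdorff_outer_empty)
next
  case ab: True
  show ?thesis
    unfolding hausdorff_outer_def
  proof (rule SUP_least)
    fix \<delta> :: real assume "\<delta> \<in> {0<..}"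
    then have d: "\<delta> > 0" by simp
    obtain m :: nat where m: "(b - a) / \<delta> < real m" using reals_Archimedean2 by blast
    have "0 \<le> (b - a) / \<delta>" using ab d by simp
    then have m0: "m > 0" using m by (cases m) auto
    define h where "h = (b - a) / real m"
    have h: "0 \<le> h" "h \<le> \<delta>" "real m * h = b - a"
      using ab m m0 d by (auto simp: h_def field_simps)
    define I where "I i = {a + real i * h..a + real (Suc i) * h}" for i
    have Isub: "I i \<subseteq> {a..b}" if "i < m" for i
    proof -
      have "real (Suc i) * h \<le> real m * h" using that h by (intro mult_right_mono) auto
      moreover have "0 \<le> real i * h" using h by simp
      ultimately show ?thesis unfolding I_def h(3) by auto
    qed
    have cov: "{a..b} \<subseteq> (\<Union>i<m. I i)"
    proof
      fix s assume s: "s \<in> {a..b}"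
      show "s \<in> (\<Union>i<m. I i)"
      proof (cases "s = a")
        case True
        then show ?thesis using m0 h by (auto simp: I_def intro!: bexI[of _ 0])
      next
        case False
        define i where "i = (LEAST i. s \<le> a + real i * h)"
        have ex: "s \<le> a + real m * h" using s h by simp
        then have i: "s \<le> a + real i * h" "i \<le> m" unfolding i_def by (rule LeastI, rule Least_le)
        have i0: "i \<noteq> 0" using i(1) s False by (cases i) auto
        then obtain k where k: "i = Suc k" by (cases i) auto
        have "\<not> s \<le> a + real k * h" using not_less_Least[of k "\<lambda>i. s \<le> a + real i * h"] k by (simp add: i_def)
        then have "s \<in> I k" using i k by (simp add: I_def)
        then show ?thesis using i(2) k by auto
      qed
    qed
    define B where "B i = (if i < m then \<gamma> ` I i else {})" for i
    have Bd: "ediameter Y (B i) \<le> ennreal h" for i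
    proof (cases "i < m")
      case True
      have "mdist Y (\<gamma> s) (\<gamma> t) \<le> h" if "s \<in> I i" "t \<in> I i" for s t
      proof -
        have "mdist Y (\<gamma> s) (\<gamma> t) \<le> \<bar>s - t\<bar>" using g that Isub[OF True] by (auto simp: nonexpanding_on_def)
        also have "\<dots> \<le> h" using that by (auto simp: I_def abs_le_iff algebra_simps)
        finally show ?thesis .
      qed
      then show ?thesis using True by (auto simp: B_def intro!: ediameter_le)
    qed (simp add: B_def)
    have "hausdorff_pre Y \<delta> (\<gamma> ` {a..b}) \<le> suminf (\<lambda>i. ediameter Y (B i))"
      unfolding hausdorff_pre_def
    proof (rule INF_lower, intro CollectI conjI allI)
      show "\<gamma> ` {a..b} \<subseteq> (\<Union>i. B i)" using cov by (fastforce simp: B_def)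
      show "B i \<subseteq> mspace Y" for i
        using nonexpanding_on_image[OF g] Isub[of i] by (auto simp: B_def)
      show "ediameter Y (B i) \<le> ennreal \<delta>" for i using Bd[of i] h(2) by (meson ennreal_leI order_trans)
    qed
    also have "suminf (\<lambda>i. ediameter Y (B i)) = (\<Sum>i<m. ediameter Y (B i))"
      by (rule suminf_finite) (auto simp: B_def)
    also have "\<dots> \<le> (\<Sum>i<m. ennreal h)" by (rule sum_mono) (rule Bd)
    also have "\<dots> = ennreal (real m * h)"
      using ennreal_mult[of "real m" h] h(1) by (simp add: ennreal_of_nat_eq_real_of_nat)
    finally show "hausdorff_pre Y \<delta> (\<gamma> ` {a..b}) \<le> ennreal (b - a)" using h by simp
  qed
qed

text \<open>
  A set of diameter \<open>r\<close> is mapped by \<open>\<psi>\<close> into an interval of length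
  \<open>r\<close>, so a cover of \<open>A\<close> yields a cover of \<open>{a..b}\<close> by
  intervals.
\<close>

lemma interval_length_le_hausdorff_outer:
  assumes A: "{a..b} \<subseteq> \<psi> ` A" and psi: "\<And>x y. x \<in> A \<Longrightarrow> y \<in> A \<Longrightarrow> \<bar>\<psi> x - \<psi> y\<bar> \<le> mdist Y x y"
  shows "ennreal (b - a) \<le> hausdorff_outer Y A"
proof -
  have "ennreal (b - a) \<le> hausdorff_pre Y 1 A"
    unfolding hausdorff_pre_def
  proof (rule INF_greatest, safe)
    fix B :: "nat \<Rightarrow> 'a set"
    assume cov: "A \<subseteq> (\<Union>i. B i)" and B: "\<forall>i. B i \<subseteq> mspace Y \<and> ediameter Y (B i) \<le> ennreal 1"
    have "\<exists>J. J \<in> sets lborel \<and> \<psi> ` (A \<inter> B i) \<subseteq> J \<and> emeasure lborel J \<le> ediameter Y (B i)" for i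
    proof (cases "A \<inter> B i = {}")
      case True
      then show ?thesis by (intro exI[of _ "{}"]) auto
    next
      case False
      define r where "r = enn2real (ediameter Y (B i))"
      have fin: "ediameter Y (B i) < top" using B by (meson ennreal_less_top le_less_trans)
      have r: "ediameter Y (B i) = ennreal r" using fin by (simp add: r_def)
      have r0: "r \<ge> 0" by (simp add: r_def)
      have dist: "\<bar>\<psi> x - \<psi> y\<bar> \<le> r" if "x \<in> A \<inter> B i" "y \<in> A \<inter> B i" for x y
      proof -
        have "ennreal (mdist Y x y) \<le> ennreal r" using mdist_le_ediameter[of x "B i" y Y] that r by auto
        then have "mdist Y x y \<le> r" using r0 by (simp add: ennreal_le_iff)
        then show ?thesis using psi[of x y] that by auto
      qed
      define c where "c = Inf (\<psi> ` (A \<inter> B i))"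
      obtain x0 where x0: "x0 \<in> A \<inter> B i" using False by blast
      have bdd: "bdd_below (\<psi> ` (A \<inter> B i))"
        using dist[OF _ x0] by (intro bdd_belowI[of _ "\<psi> x0 - r"]) (force simp: abs_le_iff)
      have "c \<le> \<psi> x" if "x \<in> A \<inter> B i" for x unfolding c_def using that bdd by (intro cInf_lower) auto
      moreover have "\<psi> x - r \<le> c" if "x \<in> A \<inter> B i" for x
        unfolding c_def using dist[OF that] False by (intro cInf_greatest) (auto simp: abs_le_iff, fastforce)
      ultimately have "\<psi> ` (A \<inter> B i) \<subseteq> {c..c + r}" by fastforce
      then show ?thesis using r r0 by (intro exI[of _ "{c..c+r}"]) auto
    qed
    then obtain J where J: "\<And>i. J i \<in> sets lborel" "\<And>i. \<psi> ` (A \<inter> B i) \<subseteq> J i"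
      "\<And>i. emeasure lborel (J i) \<le> ediameter Y (B i)" by metis
    have "ennreal (b - a) = emeasure lborel {a..b}" by (cases "a \<le> b") (auto simp: ennreal_neg)
    also have "\<dots> \<le> emeasure lborel (\<Union>i. J i)"
    proof (rule emeasure_mono)
      show "{a..b} \<subseteq> (\<Union>i. J i)"
      proof
        fix s assume "s \<in> {a..b}"
        then obtain x where x: "x \<in> A" "s = \<psi> x" using A by blast
        then obtain i where "x \<in> B i" using cov by blast
        then show "s \<in> (\<Union>i. J i)" using J(2)[of i] x by blast
      qed
    qed (use J in auto)
    also have "\<dots> \<le> suminf (\<lambda>i. emeasure lborel (J i))" using J by (intro emeasure_subadditive_countably) auto
    also have "\<dots> \<le> suminf (\<lambda>i. ediameter Y (B i))" by (intro suminf_le J(3)) auto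
    finally show "ennreal (b - a) \<le> suminf (\<lambda>i. ediameter Y (B i))" .
  qed
  also have "\<dots> \<le> hausdorff_outer Y A" unfolding hausdorff_outer_def by (rule SUP_upper) auto
  finally show ?thesis .
qed

lemma openin_subset_Pow: "{U. openin (mtopology_of Y) U} \<subseteq> Pow (mspace Y)"
  using openin_subset by fastforce

lemma space_hausdorff_measure [simp]: "space (hausdorff_measure Y) = mspace Y"
  by (simp add: hausdorff_measure_def space_measure_of openin_subset_Pow)

lemma sets_hausdorff_openin: "openin (mtopology_of Y) U \<Longrightarrow> U \<in> sets (hausdorff_measure Y)"
  by (simp add: hausdorff_measure_def openin_subset_Pow)

lemma sets_hausdorff_closedin: 
  assumes "closedin (mtopology_of Y) C" shows "C \<in> sets (hausdorff_measure Y)"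
proof -
  have "C \<subseteq> mspace Y" using closedin_subset[OF assms] by simp
  moreover have "mspace Y - C \<in> sets (hausdorff_measure Y)"
    using assms by (intro sets_hausdorff_openin) (simp add: closedin_def)
  ultimately show ?thesis using sets.compl_sets[of "mspace Y - C" "hausdorff_measure Y"] by (simp add: double_diff)
qed

lemma continuous_map_nonexpanding:
  "nonexpanding_on Y A \<gamma> \<Longrightarrow> continuous_map (top_of_set A) (mtopology_of Y) \<gamma>"
  using Lipschitz_continuous_imp_continuous_map[OF nonexpanding_on_Lipschitz]
  by (metis mtopology_of_euclidean mtopology_of_submetric)

lemma closedin_nonexpanding_image:
  assumes "nonexpanding_on Y A \<gamma>" "compact A"
  shows "closedin (mtopology_of Y) (\<gamma> ` A)"
proof -
  have "compactin (mtopology_of Y) (\<gamma> ` A)"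
    by (rule image_compactin[OF _ continuous_map_nonexpanding[OF assms(1)]]) (use assms(2) in \<open>simp add: compactin_subtopology\<close>)
  moreover have "Hausdorff_space (mtopology_of Y)"
    by (simp add: mtopology_of_def Metric_space.Hausdorff_space_mtopology)
  ultimately show ?thesis by (simp add: compactin_imp_closedin)
qed

lemma sets_nonexpanding_image:
  "nonexpanding_on Y A \<gamma> \<Longrightarrow> compact A \<Longrightarrow> \<gamma> ` A \<in> sets (hausdorff_measure Y)"
  by (rule sets_hausdorff_closedin[OF closedin_nonexpanding_image])

lemma emeasure_nonexpanding_image_le:
  assumes "nonexpanding_on Y {a..b} \<gamma>"
  shows "emeasure (hausdorff_measure Y) (\<gamma> ` {a..b}) \<le> ennreal (b - a)"
  using hausdorff_outer_image_interval_le[OF assms] assms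
  by (simp add: emeasure_hausdorff_measure sets_nonexpanding_image)

text \<open>
  The image of \<open>Z\<close> need not be a Borel set. Instead \<open>Z\<close> is covered by
  nonoverlapping compact intervals of small total length; the image of their union is a countable
  union of compact sets, and \<open>N\<close> is an intersection of such sets.
\<close>

lemma null_set_nonexpanding_image:
  assumes g: "nonexpanding_on Y {a..b} \<gamma>" and Z: "negligible Z" "Z \<subseteq> {a..b}"
  obtains N where "N \<in> null_sets (hausdorff_measure Y)" "\<gamma> ` Z \<subseteq> N"
proof -
  let ?M = "hausdorff_measure Y"
  have "\<exists>N. N \<in> sets ?M \<and> \<gamma> ` Z \<subseteq> N \<and> emeasure ?M N \<le> ennreal e" if e: "e > 0" for e
  proof -
    obtain G where G: "open G" "Z \<subseteq> G" "(G - Z) \<in> lmeasurable" "emeasure lebesgue (G - Z) < ennreal e"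
      using sets_lebesgue_outer_open[OF negligible_imp_sets[OF Z(1)] e] by blast
    have "emeasure lborel G = emeasure lebesgue (Z \<union> (G - Z))" using G by (simp add: Un_absorb1)
    also have "\<dots> \<le> emeasure lebesgue Z + emeasure lebesgue (G - Z)"
      using G negligible_imp_sets[OF Z(1)] by (intro emeasure_subadditive) auto
    also have "emeasure lebesgue Z = 0" using Z negligible_iff_emeasure0[OF negligible_imp_sets[OF Z(1)]] by blast
    finally have Ge: "emeasure lborel G \<le> ennreal e" using G(4) by simp
    have "\<forall>x\<in>G. \<exists>r>0. ball x r \<subseteq> G" using G(1) by (meson open_contains_ball)
    then obtain r where r: "\<And>x. x \<in> G \<Longrightarrow> 0 < r x" "\<And>x. x \<in> G \<Longrightarrow> ball x (r x) \<subseteq> G" by metis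
    define \<rho> where "\<rho> x = (if x \<in> G then ball x (r x) else ball x 1)" for x
    have gauge: "gauge \<rho>" unfolding gauge_def \<rho>_def using r(1) by auto
    show ?thesis
    proof (cases "a < b")
      case False
      then have "Z \<subseteq> {a}" using Z(2) by auto
      show ?thesis
      proof (cases "Z = {}")
        case True then show ?thesis by (intro exI[of _ "{}"]) auto
      next
        case F2: False
        then have "Z = {a}" "a = b" using \<open>Z \<subseteq> {a}\<close> False Z(2) by auto
        then show ?thesis using emeasure_nonexpanding_image_le[OF g] sets_nonexpanding_image[OF g]
          by (intro exI[of _ "\<gamma> ` {a..b}"]) auto
      qed
    next
      case True
      then have ne: "box a b \<noteq> {}" by simp
      obtain D where D: "countable D" "\<Union>D \<subseteq> cbox a b"
         "\<And>K. K \<in> D \<Longrightarrow> interior K \<noteq> {} \<and> (\<exists>c d. K = cbox c d)"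
         "pairwise (\<lambda>A B. interior A \<inter> interior B = {}) D"
         "\<And>K. K \<in> D \<Longrightarrow> \<exists>x \<in> Z \<inter> K. K \<subseteq> \<rho> x" "Z \<subseteq> \<Union>D"
        using covering_lemma[of Z a b \<rho>] Z(2) ne gauge by (metis cbox_interval)
      define I where "I n = (if n \<in> to_nat_on D ` D then from_nat_into D n else {})" for n
      have inD: "I n \<in> D" if "n \<in> to_nat_on D ` D" for n
        using that D(1) by (auto simp: I_def)
      have ID: "I n = {} \<or> I n \<in> D" for n using inD[of n] by (auto simp: I_def)
      have UI: "(\<Union>n. I n) = \<Union>D"
      proof
        show "(\<Union>n. I n) \<subseteq> \<Union>D" using ID by blast
        show "\<Union>D \<subseteq> (\<Union>n. I n)"
        proof
          fix x assume "x \<in> \<Union>D"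
          then obtain K where "K \<in> D" "x \<in> K" by blast
          then have "x \<in> I (to_nat_on D K)" using D(1) by (auto simp: I_def)
          then show "x \<in> (\<Union>n. I n)" by blast
        qed
      qed
      have cbI: "\<exists>c d. I n = {c..d} \<and> (c < d \<or> I n = {})" for n
      proof (cases "I n = {}")
        case True then show ?thesis by (intro exI[of _ 1] exI[of _ 0]) auto
      next
        case False
        then obtain c d where "I n = cbox c d" "interior (I n) \<noteq> {}" using ID D(3) by blast
        then show ?thesis by (intro exI[of _ c] exI[of _ d]) auto
      qed
      have IG: "I n \<subseteq> G" for n
      proof -
        have "K \<subseteq> G" if K: "K \<in> D" for K
        proof -
          obtain x where "x \<in> Z" "K \<subseteq> \<rho> x" using D(5)[OF K] by blast
          then show ?thesis using G(2) r(2)[of x] by (auto simp: \<rho>_def split: if_splits)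
        qed
        then show ?thesis using ID[of n] by blast
      qed
      have Iab: "I n \<subseteq> {a..b}" for n using ID[of n] D(2) by auto
      have disj: "disjoint_family (\<lambda>n. interior (I n))"
        unfolding disjoint_family_on_def
      proof (intro ballI impI)
        fix m n :: nat assume mn: "m \<noteq> n"
        show "interior (I m) \<inter> interior (I n) = {}"
        proof (cases "m \<in> to_nat_on D ` D \<and> n \<in> to_nat_on D ` D")
          case True
          then have "I m \<noteq> I n" using mn D(1) by (auto simp: I_def)
          then show ?thesis using True inD D(4) by (auto simp: pairwise_def)
        qed (auto simp: I_def)
      qed
      define N where "N = (\<Union>n. \<gamma> ` I n)"
      have Im: "\<gamma> ` I n \<in> sets ?M" for n
        using cbI[of n] nonexpanding_on_subset[OF g Iab] by (metis compact_Icc sets_nonexpanding_image)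
      have Ile: "emeasure ?M (\<gamma> ` I n) \<le> emeasure lborel (interior (I n))" for n
      proof -
        obtain c d where cd: "I n = {c..d}" "c < d \<or> I n = {}" using cbI by blast
        show ?thesis
        proof (cases "I n = {}")
          case False
          then show ?thesis using cd emeasure_nonexpanding_image_le[of Y c d \<gamma>] nonexpanding_on_subset[OF g Iab[of n]]
            by auto
        qed simp
      qed
      have "emeasure ?M N \<le> suminf (\<lambda>n. emeasure ?M (\<gamma> ` I n))"
        unfolding N_def using Im by (intro emeasure_subadditive_countably) auto
      also have "\<dots> \<le> suminf (\<lambda>n. emeasure lborel (interior (I n)))" by (intro suminf_le Ile) auto
      also have "\<dots> = emeasure lborel (\<Union>n. interior (I n))" using disj by (intro suminf_emeasure) auto
      also have "\<dots> \<le> emeasure lborel G" using IG interior_subset G(1) by (intro emeasure_mono) fastforce+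
      finally have "emeasure ?M N \<le> ennreal e" using Ge by simp
      moreover have "\<gamma> ` Z \<subseteq> N" using D(6) unfolding N_def UI[symmetric] image_UN[symmetric] by (rule image_mono)
      moreover have "N \<in> sets ?M" unfolding N_def using Im by auto
      ultimately show ?thesis by blast
    qed
  qed
  then have "\<forall>n. \<exists>N. N \<in> sets ?M \<and> \<gamma> ` Z \<subseteq> N \<and> emeasure ?M N \<le> ennreal (1 / real (Suc n))" by auto
  then obtain N where N: "\<And>n. N n \<in> sets ?M" "\<And>n. \<gamma> ` Z \<subseteq> N n" "\<And>n. emeasure ?M (N n) \<le> ennreal (1 / real (Suc n))"
    by metis
  define N' where "N' = (\<Inter>n. N n)"
  have "N' \<in> sets ?M" unfolding N'_def using N(1) by auto
  moreover have N'le: "emeasure ?M N' \<le> ennreal (1 / real (Suc n))" for n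
    by (rule order_trans[OF emeasure_mono N(3)]) (auto simp: N'_def N(1))
  then have "emeasure ?M N' \<le> 0 + ennreal e" if e: "e > 0" for e
  proof -
    obtain n where "1 / real (Suc n) < e" using nat_approx_posE[OF e] by blast
    then have "ennreal (1 / real (Suc n)) \<le> ennreal e" by (intro ennreal_leI) simp
    then show ?thesis unfolding add_0 by (rule order_trans[OF N'le])
  qed
  then have "emeasure ?M N' \<le> 0" by (rule ennreal_le_epsilon)
  then have "emeasure ?M N' = 0" by simp
  ultimately have "N' \<in> null_sets ?M" by (intro null_setsI)
  moreover have "\<gamma> ` Z \<subseteq> N'" unfolding N'_def using N(2) by blast
  ultimately show ?thesis by (rule that)
qed

lemma null_set_point:
  assumes "y \<in> mspace Y" shows "{y} \<in> null_sets (hausdorff_measure Y)"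
proof -
  have g: "nonexpanding_on Y {0..0} (\<lambda>_. y)" using assms mdist_zero[of y Y y] by (simp add: nonexpanding_on_def del: mdist_zero)
  have "{y} = (\<lambda>_. y) ` {0..0::real}" by auto
  then show ?thesis using emeasure_nonexpanding_image_le[OF g] sets_nonexpanding_image[OF g]
    by (auto simp: null_sets_def)
qed

section \<open>The circle as a geodesic space\<close>

text \<open>
  For \<open>s, t \<in> {0..<L}\<close> this is the length of the shorter of the two arcs between
  the points. The outer absolute value makes it nonnegative for all real arguments, as
  \<^const>\<open>Metric_space\<close> demands.
\<close>

definition circle_dist :: "real \<Rightarrow> real \<Rightarrow> real \<Rightarrow> real" where
  "circle_dist L s t = min \<bar>s - t\<bar> \<bar>L - \<bar>s - t\<bar>\<bar>"

lemma Metric_space_circle_dist: "Metric_space {0..<L} (circle_dist L)"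
  by unfold_locales (auto simp: circle_dist_def min_def abs_if split: if_splits)

lemma Metric_space_image:
  assumes "Metric_space A d" "inj e"
  shows "Metric_space (e ` A) (\<lambda>x y. d (inv e x) (inv e y))"
proof -
  interpret Metric_space A d by fact
  show ?thesis using assms(2) by unfold_locales (auto simp: commute triangle)
qed

locale circle_space =
  fixes n :: nat and e :: "real \<Rightarrow> 'x"
  assumes inj_e: "inj e" and n2: "2 \<le> n"
begin

definition X :: "'x metric" where
  "X = metric (e ` {0..<real n}, \<lambda>x y. circle_dist (real n) (inv e x) (inv e y))"

text \<open>
  Parameters up to one turn beyond either end are wrapped around, so that geodesics may pass through
  the point \<open>pt 0 = pt n\<close>.
\<close>

definition pt :: "real \<Rightarrow> 'x" where
  "pt t = e (if t < 0 then t + real n else if t < real n then t else t - real n)"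

lemma mspace_X: "mspace X = e ` {0..<real n}"
  unfolding X_def using Metric_space.mspace_metric[OF Metric_space_image[OF Metric_space_circle_dist inj_e]] .

lemma mdist_X: "mdist X (e s) (e t) = circle_dist (real n) s t"
  unfolding X_def Metric_space.mdist_metric[OF Metric_space_image[OF Metric_space_circle_dist inj_e]]
  using inj_e by simp

lemma real_n: "2 \<le> real n" using n2 by simp

lemma pt_in: "- real n \<le> t \<Longrightarrow> t < 2 * real n \<Longrightarrow> pt t \<in> mspace X"
  using real_n by (auto simp: pt_def mspace_X)

lemma pt_eq: "0 \<le> t \<Longrightarrow> t < real n \<Longrightarrow> pt t = e t"
  by (simp add: pt_def)

lemma ptE:
  assumes "x \<in> mspace X" obtains t where "0 \<le> t" "t < real n" "x = pt t" "x = e t"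
  using assms by (auto simp: mspace_X pt_def)

lemma mdist_pt_le: "- real n \<le> s \<Longrightarrow> s < 2 * real n \<Longrightarrow> - real n \<le> t \<Longrightarrow> t < 2 * real n \<Longrightarrow> mdist X (pt s) (pt t) \<le> \<bar>s - t\<bar>"
  unfolding pt_def mdist_X circle_dist_def min_def abs_if by (auto split: if_splits)

lemma mdist_pt: "- real n \<le> s \<Longrightarrow> s < 2 * real n \<Longrightarrow> - real n \<le> t \<Longrightarrow> t < 2 * real n \<Longrightarrow>
  \<bar>s - t\<bar> \<le> real n / 2 \<Longrightarrow> mdist X (pt s) (pt t) = \<bar>s - t\<bar>"
  unfolding pt_def mdist_X circle_dist_def min_def abs_if by (auto split: if_splits)

lemma geodesic_X: "geodesic_space X"
  unfolding geodesic_space_def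
proof (intro ballI)
  fix x y assume "x \<in> mspace X" "y \<in> mspace X"
  then obtain s t where s: "0 \<le> s" "s < real n" "x = pt s" "x = e s" and t: "0 \<le> t" "t < real n" "y = pt t" "y = e t"
    by (metis ptE)
  define D where "D = mdist X x y"
  have D: "D = min \<bar>s - t\<bar> (real n - \<bar>s - t\<bar>)" 
    using s(1,2) t(1,2) unfolding D_def s(4) t(4) mdist_X circle_dist_def by (auto simp: min_def)
  define \<sigma> :: real where "\<sigma> = (if (s \<le> t) = (\<bar>s - t\<bar> \<le> real n - \<bar>s - t\<bar>) then 1 else -1)"
  have sig: "\<sigma> = 1 \<or> \<sigma> = -1" by (simp add: \<sigma>_def)
  have D2: "0 \<le> D" "D \<le> real n / 2" using D s t by (auto simp: min_def)
  have end_eq: "pt (s + \<sigma> * D) = pt t"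
    using D s t unfolding pt_def \<sigma>_def by (auto simp: min_def split: if_splits intro!: arg_cong[of _ _ e])
  have rng: "- real n \<le> s + \<sigma> * u" "s + \<sigma> * u < 2 * real n" if "u \<in> {0..D}" for u
    using that sig D2 s by auto
  show "\<exists>\<gamma>::real \<Rightarrow> 'x. \<gamma> \<in> {0..mdist X x y} \<rightarrow> mspace X \<and> \<gamma> 0 = x \<and> \<gamma> (mdist X x y) = y \<and>
        (\<forall>s\<in>{0..mdist X x y}. \<forall>t\<in>{0..mdist X x y}. mdist X (\<gamma> s) (\<gamma> t) = \<bar>s - t\<bar>)"
    unfolding D_def[symmetric]
  proof (intro exI[of _ "\<lambda>u. pt (s + \<sigma> * u)"] conjI ballI)
    fix u v assume uv: "u \<in> {0..D}" "v \<in> {0..D}"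
    have "\<bar>(s + \<sigma> * u) - (s + \<sigma> * v)\<bar> = \<bar>u - v\<bar>" using sig by auto
    moreover have "\<bar>u - v\<bar> \<le> real n / 2" using uv D2 by (auto simp: abs_if)
    ultimately show "mdist X (pt (s + \<sigma> * u)) (pt (s + \<sigma> * v)) = \<bar>u - v\<bar>"
      using mdist_pt[OF rng[OF uv(1)] rng[OF uv(2)]] by simp
  qed (use rng pt_in end_eq s t in auto)
qed

lemma inj_pt_arc: "k < n \<Longrightarrow> inj_on pt {real k..real k + 1}"
proof (rule inj_onI)
  fix s t assume k: "k < n" and st: "s \<in> {real k..real k + 1}" "t \<in> {real k..real k + 1}" "pt s = pt t"
  have "real k + 1 \<le> real n" using k by linarith
  then have "mdist X (pt s) (pt t) = \<bar>s - t\<bar>" using st(1,2) real_n by (intro mdist_pt) (auto simp: abs_if)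
  moreover have "pt s \<in> mspace X" using st(1) \<open>real k + 1 \<le> real n\<close> real_n by (intro pt_in) auto
  ultimately show "s = t" using st(3) mdist_zero[of "pt t" X "pt t"] by simp
qed

lemma nonexpanding_pt: "nonexpanding_on X {0..real n} pt"
  unfolding nonexpanding_on_def using real_n by (auto intro!: pt_in mdist_pt_le)

definition arc_chart :: "nat \<Rightarrow> 'x chart" where
  "arc_chart k = ({real k..real k + 1}, pt)"

lemma chart_arc_chart: "k < n \<Longrightarrow> chart X (arc_chart k)"
  unfolding chart_def arc_chart_def
  using inj_pt_arc nonexpanding_on_Lipschitz[OF nonexpanding_on_subset[OF nonexpanding_pt]] by fastforce

text \<open>
  As a distance, the coordinate of the \<open>k\<close>-th arc is Lipschitz on the whole circle, so
  it can be composed with arbitrary Lipschitz paths.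
\<close>

definition coord :: "nat \<Rightarrow> 'x \<Rightarrow> real" where "coord k x = real k + mdist X (pt (real k)) x"

lemma coord_pt: "k < n \<Longrightarrow> t \<in> {real k..real k + 1} \<Longrightarrow> coord k (pt t) = t"
proof -
  assume k: "k < n" and t: "t \<in> {real k..real k + 1}"
  have "real k + 1 \<le> real n" using k by linarith
  then have "mdist X (pt (real k)) (pt t) = \<bar>real k - t\<bar>" using t real_n by (intro mdist_pt) (auto simp: abs_if)
  then show ?thesis using t by (simp add: coord_def)
qed

lemma coord_Lipschitz: "x \<in> mspace X \<Longrightarrow> y \<in> mspace X \<Longrightarrow> k < n \<Longrightarrow> \<bar>coord k x - coord k y\<bar> \<le> mdist X x y"
proof -
  assume x: "x \<in> mspace X" and y: "y \<in> mspace X" and "k < n"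
  then have p: "pt (real k) \<in> mspace X" by (intro pt_in) auto
  show ?thesis using mdist_triangle[OF p x y] mdist_triangle[OF p y x] mdist_commute[of X x y]
    by (simp add: coord_def abs_le_iff)
qed

lemma near_pt:
  assumes "k < n" "t \<in> {real k<..<real k + 1}" "x \<in> mspace X"
    and "mdist X (pt t) x < \<eta>" "\<eta> \<le> t - real k" "\<eta> \<le> real k + 1 - t"
  shows "coord k x \<in> {real k<..<real k + 1}" "x = e (coord k x)" "\<bar>coord k x - t\<bar> < \<eta>"
proof -
  have kn: "real k + 1 \<le> real n" using assms(1) by linarith
  obtain z where z: "0 \<le> z" "z < real n" "x = pt z" "x = e z" using ptE[OF assms(3)] by blast
  have "pt t = e t" using assms(2) kn by (intro pt_eq) auto
  then have "circle_dist (real n) t z < \<eta>" using assms(4) z(4) by (simp add: mdist_X)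
  then have zt: "\<bar>z - t\<bar> < \<eta>" using z assms(2,5,6) kn by (auto simp: circle_dist_def min_def abs_if split: if_splits)
  then have zk: "z \<in> {real k<..<real k + 1}" using assms(5,6) by auto
  then have "coord k x = z" using coord_pt[OF assms(1), of z] z(3) by auto
  then show "coord k x \<in> {real k<..<real k + 1}" "x = e (coord k x)" "\<bar>coord k x - t\<bar> < \<eta>"
    using zk zt z by auto
qed

end

section \<open>Coefficients and contents of chains\<close>

lemma normed_ab_groupD:
  assumes "normed_ab_group N"
  shows "0 \<le> N g" "N (g + h) \<le> N g + N h" "N (- g) = N g" "N 0 = 0"
  using assms by (auto simp: normed_ab_group_def)

text \<open>
  The images of the charts are disjoint and the charts are injective, so at most one preimage
  contributes to the coefficient at \<open>y\<close>.
\<close>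

lemma norm_oriented_chain_le:
  assumes N: "normed_ab_group N" and o: "oriented_set Y \<kappa>"
  shows "N (oriented_chain \<kappa> g c y) \<le> N (g y) * indicator (carrier_set \<kappa>) y"
proof (cases "y \<in> carrier_set \<kappa>")
  case False
  then have "{i. y \<in> chart_image (\<kappa> i)} = {}" by (auto simp: carrier_set_def)
  then have "oriented_chain \<kappa> g c y = 0" unfolding oriented_chain_def by (simp only: sum.empty)
  moreover have "N 0 = 0" using N by (simp add: normed_ab_group_def)
  ultimately show ?thesis using False by simp
next
  case True
  then obtain i where i: "y \<in> chart_image (\<kappa> i)" by (auto simp: carrier_set_def)
  then have one: "{i. y \<in> chart_image (\<kappa> i)} = {i}"
    using o by (auto simp: oriented_set_def disjoint_family_on_def)
  obtain s where s: "s \<in> fst (\<kappa> i)" "snd (\<kappa> i) s = y" using i by (auto simp: chart_image_def)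
  have "inj_on (snd (\<kappa> i)) (fst (\<kappa> i))" using o by (auto simp: oriented_set_def chart_def)
  then have pre: "{s \<in> fst (\<kappa> i). snd (\<kappa> i) s = y} = {s}" using s by (auto simp: inj_on_def)
  have "N (oriented_chain \<kappa> g c y) \<le> N (g y)"
  proof -
    have "oriented_chain \<kappa> g c y = push_forward (fst (\<kappa> i)) (snd (\<kappa> i)) (\<lambda>s. g (snd (\<kappa> i) s)) c y"
      unfolding oriented_chain_def one by simp
    also have "\<dots> \<in> {g y, - g y, 0}" unfolding push_forward_def pre by (auto simp: s(2))
    finally show ?thesis using normed_ab_groupD[OF N] by auto
  qed
  then show ?thesis using True by simp
qed

lemma borel_measurable_orientation_density:
  assumes N: "normed_ab_group N" and g: "group_orientation N Y \<kappa> g"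
  shows "(\<lambda>y. ennreal (N (g y)) * indicator (carrier_set \<kappa>) y) \<in> borel_measurable (hausdorff_measure Y)"
proof -
  let ?M = "hausdorff_measure Y"
  have S: "{y \<in> carrier_set \<kappa>. N (g y) < e} \<in> sets ?M" for e
  proof -
    have "{y \<in> carrier_set \<kappa>. N (g y - 0) < e} \<in> sets ?M" using g unfolding group_orientation_def by blast
    then show ?thesis by simp
  qed
  have "carrier_set \<kappa> = (\<Union>k::nat. {y \<in> carrier_set \<kappa>. N (g y) < real k})"
    using reals_Archimedean2 by auto
  also have "\<dots> \<in> sets ?M" using S by auto
  finally have C: "carrier_set \<kappa> \<in> sets ?M" .
  define f where "f y = (if y \<in> carrier_set \<kappa> then N (g y) else 0)" for y
  have "f \<in> borel_measurable ?M"
    unfolding borel_measurable_iff_less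
  proof
    fix a
    show "{w \<in> space ?M. f w < a} \<in> sets ?M"
    proof (cases "a > 0")
      case True
      then have "{w \<in> space ?M. f w < a} = {y \<in> carrier_set \<kappa>. N (g y) < a} \<union> (space ?M - carrier_set \<kappa>)"
        using sets.sets_into_space[OF C] by (auto simp: f_def)
      then show ?thesis using S[of a] C by (auto simp del: space_hausdorff_measure)
    next
      case False
      have "0 \<le> f w" for w using normed_ab_groupD(1)[OF N] by (simp add: f_def)
      then have "{w \<in> space ?M. f w < a} = {}" using False by (auto simp: not_less intro: order_trans)
      then show ?thesis by (simp only: sets.empty_sets)
    qed
  qed
  then have "(\<lambda>y. ennreal (f y)) \<in> borel_measurable ?M" by (rule measurable_compose[OF _ measurable_ennreal])
  moreover have "(\<lambda>y. ennreal (f y)) = (\<lambda>y. ennreal (N (g y)) * indicator (carrier_set \<kappa>) y)"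
    by (auto simp: f_def indicator_def)
  ultimately show ?thesis by simp
qed

text \<open>
  An orientation that represents \<open>S\<close> with almost minimal mass bounds the coefficients
  of \<open>S\<close> in all charts simultaneously. So lower bounds of the mass reduce to integrals
  of coefficients.
\<close>

lemma mass_less_dominated:
  assumes N: "normed_ab_group N" and m: "mass N Y S < a"
  obtains F where "F \<in> borel_measurable (hausdorff_measure Y)" "(\<integral>\<^sup>+y. F y \<partial>hausdorff_measure Y) < a"
    "\<forall>c. chart Y c \<longrightarrow> (AE y in hausdorff_measure Y. y \<in> chart_image c \<longrightarrow> ennreal (N (S c y)) \<le> F y)"
proof -
  obtain \<kappa> g where kg: "group_orientation N Y \<kappa> g" "chain_eq Y S (oriented_chain \<kappa> g)" "orientation_mass N Y \<kappa> g < a"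
    using m unfolding mass_def by (auto simp: INF_less_iff)
  let ?F = "\<lambda>y. ennreal (N (g y)) * indicator (carrier_set \<kappa>) y"
  have bound: "ennreal (N (oriented_chain \<kappa> g c y)) \<le> ?F y" for c y
  proof -
    have "oriented_set Y \<kappa>" using kg(1) by (simp add: group_orientation_def)
    from norm_oriented_chain_le[OF N this, of g c y]
    show ?thesis using normed_ab_groupD(1)[OF N] by (auto simp: indicator_def ennreal_leI ennreal_eq_0_iff split: if_splits)
  qed
  show ?thesis
  proof (rule that[of ?F])
    show "?F \<in> borel_measurable (hausdorff_measure Y)" by (rule borel_measurable_orientation_density[OF N kg(1)])
    show "(\<integral>\<^sup>+y. ?F y \<partial>hausdorff_measure Y) < a" using kg(3) by (simp add: orientation_mass_def)
    show "\<forall>c. chart Y c \<longrightarrow> (AE y in hausdorff_measure Y. y \<in> chart_image c \<longrightarrow> ennreal (N (S c y)) \<le> ?F y)"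
    proof (intro allI impI)
      fix c assume "chart Y c"
      then have "AE y in hausdorff_measure Y. y \<in> chart_image c \<longrightarrow> S c y = oriented_chain \<kappa> g c y"
        using kg(2) unfolding chain_eq_def by blast
      then show "AE y in hausdorff_measure Y. y \<in> chart_image c \<longrightarrow> ennreal (N (S c y)) \<le> ?F y"
        by (rule AE_mp) (use bound in auto)
    qed
  qed
qed

text \<open>
  Otherwise \<open>F\<close> would exceed its integral over \<open>A\<close> almost everywhere on a
  set of measure at least \<open>1\<close>.
\<close>

lemma AE_exists_le_integral:
  fixes F :: "'a \<Rightarrow> ennreal"
  assumes A: "A \<in> sets M" "1 \<le> emeasure M A" and F: "F \<in> borel_measurable M"
    and P: "AE y in M. y \<in> A \<longrightarrow> P y" and fin: "(\<integral>\<^sup>+y. F y * indicator A y \<partial>M) < top" and d: "\<delta> > 0"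
  obtains y where "y \<in> A" "P y" "F y \<le> (\<integral>\<^sup>+y. F y * indicator A y \<partial>M) + ennreal \<delta>"
proof -
  define I where "I = (\<integral>\<^sup>+y. F y * indicator A y \<partial>M)"
  have "\<exists>y\<in>A. P y \<and> F y \<le> I + ennreal \<delta>"
  proof (rule ccontr)
    assume no: "\<not> (\<exists>y\<in>A. P y \<and> F y \<le> I + ennreal \<delta>)"
    have "AE y in M. (I + ennreal \<delta>) * indicator A y \<le> F y * indicator A y"
      using P by (rule eventually_mono) (use no in \<open>force simp: indicator_def not_le intro: less_imp_le\<close>)
    then have "(\<integral>\<^sup>+y. (I + ennreal \<delta>) * indicator A y \<partial>M) \<le> I"
      unfolding I_def by (rule nn_integral_mono_AE)
    then have 1: "(I + ennreal \<delta>) * emeasure M A \<le> I" using A by (simp add: nn_integral_cmult_indicator)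
    have 2: "(I + ennreal \<delta>) * 1 \<le> (I + ennreal \<delta>) * emeasure M A" using A(2) by (rule mult_left_mono) simp
    have "I + ennreal \<delta> \<le> I" using order_trans[OF 2 1] unfolding mult_1_right .
    moreover have "I < I + ennreal \<delta>" using fin d by (simp add: I_def less_top[symmetric])
    ultimately show False by simp
  qed
  then show ?thesis using that unfolding I_def by blast
qed

definition chain_content :: "('y \<Rightarrow>\<^sub>0 'g::ab_group_add) \<Rightarrow> 'y set \<Rightarrow> 'g" where
  "chain_content Z I = (\<Sum>q\<in>Poly_Mapping.keys Z. if q \<in> I then Poly_Mapping.lookup Z q else 0)"

lemma chain_content_superset:
  assumes "finite A" "Poly_Mapping.keys Z \<subseteq> A"
  shows "chain_content Z I = (\<Sum>q\<in>A. if q \<in> I then Poly_Mapping.lookup Z q else 0)"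
  unfolding chain_content_def using assms by (intro sum.mono_neutral_left) (auto simp: in_keys_iff)

lemma chain_content_zero [simp]: "chain_content 0 I = 0"
  by (simp add: chain_content_def)

lemma chain_content_add: "chain_content (Z + W) I = chain_content Z I + chain_content W I"
proof -
  let ?A = "Poly_Mapping.keys Z \<union> Poly_Mapping.keys W"
  show ?thesis
    using keys_add[of Z W]
    by (subst (1 2 3) chain_content_superset[of ?A]) (auto simp: lookup_add sum.distrib[symmetric] intro!: sum.cong)
qed

lemma chain_content_uminus: "chain_content (- Z) I = - chain_content Z I"
  using chain_content_add[of Z "- Z" I] by (simp add: eq_neg_iff_add_eq_0 add.commute)

lemma chain_content_diff: "chain_content (Z - W) I = chain_content Z I - chain_content W I"
  using chain_content_add[of Z "- W" I] by (simp add: chain_content_uminus)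

lemma chain_content_single: "chain_content (Poly_Mapping.single p g) I = (if p \<in> I then g else 0)"
  by (simp add: chain_content_def)

lemma chain_content_sum: "chain_content (sum f A) I = (\<Sum>i\<in>A. chain_content (f i) I)"
  by (induction A rule: infinite_finite_induct) (auto simp: chain_content_add)

lemma norm_sum_le:
  assumes N: "normed_ab_group N" shows "N (sum f A) \<le> (\<Sum>i\<in>A. N (f i))"
proof (induction A rule: infinite_finite_induct)
  case (insert x A)
  have "N (f x + sum f A) \<le> N (f x) + N (sum f A)" using N by (simp add: normed_ab_group_def)
  then show ?case using insert by simp
qed (use normed_ab_groupD(4)[OF N] in auto)

lemma norm_chain_content_le:
  assumes N: "normed_ab_group N" shows "N (chain_content Z I) \<le> mass0 N Z"
proof -
  have "N (chain_content Z I) \<le> (\<Sum>q\<in>Poly_Mapping.keys Z. N (if q \<in> I then Poly_Mapping.lookup Z q else 0))"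
    unfolding chain_content_def by (rule norm_sum_le[OF N])
  also have "\<dots> \<le> mass0 N Z"
    unfolding mass0_def using normed_ab_groupD[OF N] by (intro sum_mono) auto
  finally show ?thesis .
qed

lemma chain_content_lipschitz_boundary:
  "chain_content (lipschitz_boundary P) I = (\<Sum>(g, \<gamma>)\<leftarrow>P. (if \<gamma> 1 \<in> I then g else 0) - (if \<gamma> 0 \<in> I then g else 0))"
  unfolding lipschitz_boundary_def
  by (induction P) (auto simp: chain_content_add chain_content_diff chain_content_single)

section \<open>Filling lengths on the circle\<close>

lemma lipschitz_pathE:
  assumes "lipschitz_path Y \<gamma>"
  obtains B where "0 < B" "\<And>s. s \<in> {0..1} \<Longrightarrow> \<gamma> s \<in> mspace Y"
    "\<And>s t. s \<in> {0..1} \<Longrightarrow> t \<in> {0..1} \<Longrightarrow> mdist Y (\<gamma> s) (\<gamma> t) \<le> B * \<bar>s - t\<bar>"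
proof -
  obtain B where B: "\<forall>s\<in>{0..1}. \<forall>t\<in>{0..1}. mdist Y (\<gamma> s) (\<gamma> t) \<le> B * dist s t" "\<gamma> \<in> {0..1} \<rightarrow> mspace Y"
    using assms unfolding lipschitz_path_def Lipschitz_continuous_map_def by auto
  have "mdist Y (\<gamma> s) (\<gamma> t) \<le> (\<bar>B\<bar> + 1) * \<bar>s - t\<bar>" if "s \<in> {0..1}" "t \<in> {0..1}" for s t
  proof -
    have "mdist Y (\<gamma> s) (\<gamma> t) \<le> B * \<bar>s - t\<bar>" using B that by (auto simp: dist_real_def)
    also have "\<dots> \<le> (\<bar>B\<bar> + 1) * \<bar>s - t\<bar>" by (intro mult_right_mono) auto
    finally show ?thesis .
  qed
  then show ?thesis using B(2) by (intro that[of "\<bar>B\<bar> + 1"]) auto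
qed

lemma lipschitz_path_near:
  assumes "lipschitz_path Y \<gamma>" "s \<in> {0<..<1}" "0 < \<delta>"
  shows "\<forall>\<^sub>F u in nhds s. u \<in> {0..1} \<and> mdist Y (\<gamma> s) (\<gamma> u) < \<delta>"
proof -
  obtain B where B: "0 < B" "\<And>s t. s \<in> {0..1} \<Longrightarrow> t \<in> {0..1} \<Longrightarrow> mdist Y (\<gamma> s) (\<gamma> t) \<le> B * \<bar>s - t\<bar>"
    using lipschitz_pathE[OF assms(1)] by metis
  have "\<forall>\<^sub>F u in nhds s. u \<in> {0<..<1} \<inter> ball s (\<delta> / B)"
    using assms B by (intro eventually_nhds_in_open) auto
  then show ?thesis
  proof (rule eventually_mono)
    fix u assume u: "u \<in> {0<..<1} \<inter> ball s (\<delta> / B)"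
    then have "B * \<bar>s - u\<bar> < \<delta>" using B(1) by (simp add: dist_real_def field_simps)
    moreover have "mdist Y (\<gamma> s) (\<gamma> u) \<le> B * \<bar>s - u\<bar>" using B(2)[of s u] u assms(2) by auto
    ultimately show "u \<in> {0..1} \<and> mdist Y (\<gamma> s) (\<gamma> u) < \<delta>" using u by auto
  qed
qed

lemma has_real_derivative_locally_eq:
  fixes f g :: "real \<Rightarrow> real"
  assumes "(f has_real_derivative r) (at s)" "\<forall>\<^sub>F u in nhds s. g u = f u"
  shows "(g has_real_derivative r) (at s)"
  using assms DERIV_cong_ev[of s s g f r r] by simp

context circle_space
begin

text \<open>
  The end points of \<open>\<gamma>\<close> are excluded from the level, so that
  \<open>\<gamma>\<close> starts and ends on a definite side of it.
\<close>

definition transversal_level :: "(real \<Rightarrow> 'x) \<Rightarrow> nat \<Rightarrow> real \<Rightarrow> bool" where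
  "transversal_level \<gamma> k t \<longleftrightarrow> t \<in> {real k<..<real k + 1} \<and> \<gamma> 0 \<noteq> pt t \<and> \<gamma> 1 \<noteq> pt t \<and>
     (\<forall>s\<in>{0..1}. \<gamma> s = pt t \<longrightarrow> (\<exists>r. r \<noteq> 0 \<and> ((\<lambda>u. coord k (\<gamma> u)) has_real_derivative r) (at s)))"

definition speed :: "(real \<Rightarrow> 'x) \<Rightarrow> nat \<Rightarrow> real \<Rightarrow> real" where
  "speed \<gamma> k s = deriv (\<lambda>u. coord k (\<gamma> u)) s"

lemma transversal_levelD:
  assumes "transversal_level \<gamma> k t" "s \<in> {0..1}" "\<gamma> s = pt t"
  shows "speed \<gamma> k s \<noteq> 0" "((\<lambda>u. coord k (\<gamma> u)) has_real_derivative speed \<gamma> k s) (at s)" "s \<in> {0<..<1}"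
proof -
  obtain r where r: "r \<noteq> 0" "((\<lambda>u. coord k (\<gamma> u)) has_real_derivative r) (at s)"
    using assms by (auto simp: transversal_level_def)
  then show "speed \<gamma> k s \<noteq> 0" "((\<lambda>u. coord k (\<gamma> u)) has_real_derivative speed \<gamma> k s) (at s)"
    using DERIV_imp_deriv[OF r(2)] by (auto simp: speed_def)
  have "s \<noteq> 0" "s \<noteq> 1" using assms by (auto simp: transversal_level_def)
  then show "s \<in> {0<..<1}" using assms(2) by auto
qed

text \<open>
  This is \<open>lipschitz_ae_level_transversal\<close> for the coordinate of
  \<open>\<gamma>\<close>, extended by constants beyond the ends of the unit interval.
\<close>

lemma negligible_not_transversal:
  assumes g: "lipschitz_path X \<gamma>" and k: "k < n"
  shows "negligible {t \<in> {real k..real k + 1}. \<not> transversal_level \<gamma> k t}"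
proof -
  obtain B where B: "0 < B" "\<And>s. s \<in> {0..1} \<Longrightarrow> \<gamma> s \<in> mspace X"
    "\<And>s t. s \<in> {0..1} \<Longrightarrow> t \<in> {0..1} \<Longrightarrow> mdist X (\<gamma> s) (\<gamma> t) \<le> B * \<bar>s - t\<bar>"
    using lipschitz_pathE[OF g] by metis
  define cl where "cl u = max 0 (min 1 u)" for u :: real
  have cl: "cl u \<in> {0..1}" "\<bar>cl u - cl w\<bar> \<le> \<bar>u - w\<bar>" for u w by (auto simp: cl_def)
  define v where "v u = coord k (\<gamma> (cl u))" for u
  have "\<bar>v u - v w\<bar> \<le> B * \<bar>u - w\<bar>" for u w
  proof -
    have "\<bar>v u - v w\<bar> \<le> mdist X (\<gamma> (cl u)) (\<gamma> (cl w))"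
      unfolding v_def using B(2) cl k by (intro coord_Lipschitz) auto
    also have "\<dots> \<le> B * \<bar>cl u - cl w\<bar>" using B(3) cl by blast
    also have "\<dots> \<le> B * \<bar>u - w\<bar>" using B(1) cl(2) by (intro mult_left_mono) auto
    finally show ?thesis .
  qed
  then have "B-lipschitz_on UNIV v" using B(1) by (auto simp: lipschitz_on_def dist_real_def)
  then have neg: "negligible {t. \<exists>s. v s = t \<and> \<not> (\<exists>r. r \<noteq> 0 \<and> (v has_real_derivative r) (at s))}"
    by (rule lipschitz_ae_level_transversal)
  let ?F = "{real k, real k + 1, coord k (\<gamma> 0), coord k (\<gamma> 1)}"
  have "negligible (?F \<union> {t. \<exists>s. v s = t \<and> \<not> (\<exists>r. r \<noteq> 0 \<and> (v has_real_derivative r) (at s))})"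
    by (rule negligible_Un[OF _ neg], rule negligible_finite) simp
  then show ?thesis
  proof (rule negligible_subset, intro subsetI)
    fix t assume t: "t \<in> {t \<in> {real k..real k + 1}. \<not> transversal_level \<gamma> k t}"
    show "t \<in> ?F \<union> {t. \<exists>s. v s = t \<and> \<not> (\<exists>r. r \<noteq> 0 \<and> (v has_real_derivative r) (at s))}"
    proof (rule ccontr)
      assume no: "\<not> ?thesis"
      have tk: "t \<in> {real k<..<real k + 1}" using t no by auto
      then have ct: "coord k (pt t) = t" using coord_pt[OF k] by auto
      have "transversal_level \<gamma> k t"
        unfolding transversal_level_def
      proof (intro conjI ballI impI tk)
        show ends: "\<gamma> 0 \<noteq> pt t" "\<gamma> 1 \<noteq> pt t" using ct no by auto
        fix s assume s: "s \<in> {0..1}" "\<gamma> s = pt t"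
        then have s01: "s \<in> {0<..<1}" using ends by (auto simp: less_le)
        have "v s = t" using s ct by (simp add: v_def cl_def)
        then obtain r where r: "r \<noteq> 0" "(v has_real_derivative r) (at s)" using no by blast
        have ev: "\<forall>\<^sub>F u in nhds s. coord k (\<gamma> u) = v u"
          using eventually_nhds_in_open[OF open_greaterThanLessThan s01]
          by (rule eventually_mono) (auto simp: v_def cl_def)
        have "((\<lambda>u. coord k (\<gamma> u)) has_real_derivative r) (at s)"
          by (rule has_real_derivative_locally_eq[OF r(2) ev])
        then show "\<exists>r. r \<noteq> 0 \<and> ((\<lambda>u. coord k (\<gamma> u)) has_real_derivative r) (at s)" using r(1) by blast
      qed
      then show False using t by simp
    qed
  qed
qed

text \<open>
  Close to a preimage of an interior point of the arc, \<open>\<gamma>\<close> stays inside the arc,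
  where the inverse of the chart is the coordinate.
\<close>

lemma push_forward_level:
  fixes g :: "'g::ab_group_add"
  assumes g: "lipschitz_path X \<gamma>" and k: "k < n" and t: "transversal_level \<gamma> k t"
  shows "push_forward {0..1} \<gamma> (\<lambda>_. g) (arc_chart k) (pt t)
       = (\<Sum>s\<in>{s \<in> {0..1}. \<gamma> s = pt t}. if 0 < speed \<gamma> k s then g else - g)"
  unfolding push_forward_def
proof (rule sum.cong[OF refl])
  fix s assume "s \<in> {s \<in> {0..1}. \<gamma> s = pt t}"
  then have s: "s \<in> {0..1}" "\<gamma> s = pt t" by auto
  note D = transversal_levelD[OF t s]
  have tk: "t \<in> {real k<..<real k + 1}" using t by (simp add: transversal_level_def)
  obtain B where B: "\<And>s. s \<in> {0..1} \<Longrightarrow> \<gamma> s \<in> mspace X" using lipschitz_pathE[OF g] by metis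
  let ?W = "{u \<in> {0..1}. \<gamma> u \<in> chart_image (arc_chart k)}"
  let ?i = "\<lambda>u. inv_into (fst (arc_chart k)) (snd (arc_chart k)) (\<gamma> u)"
  define \<eta> where "\<eta> = min (t - real k) (real k + 1 - t)"
  have eta: "0 < \<eta>" using tk by (auto simp: \<eta>_def)
  have ev: "\<forall>\<^sub>F u in nhds s. u \<in> ?W \<and> ?i u = coord k (\<gamma> u)"
    using lipschitz_path_near[OF g D(3) eta]
  proof (rule eventually_mono)
    fix u assume u: "u \<in> {0..1} \<and> mdist X (\<gamma> s) (\<gamma> u) < \<eta>"
    have near: "coord k (\<gamma> u) \<in> {real k<..<real k + 1}" "\<gamma> u = e (coord k (\<gamma> u))"
      using near_pt[OF k tk B, of u \<eta>] u s(2) by (auto simp: \<eta>_def)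
    have "real k + 1 \<le> real n" using k by linarith
    then have eq: "\<gamma> u = pt (coord k (\<gamma> u))" using near by (subst pt_eq) auto
    have "?i (u) = inv_into {real k..real k + 1} pt (pt (coord k (\<gamma> u)))"
      using eq by (simp add: arc_chart_def)
    also have "\<dots> = coord k (\<gamma> u)"
      using near(1) by (intro inv_into_f_f inj_pt_arc k) auto
    finally have "?i u = coord k (\<gamma> u)" .
    moreover have "\<gamma> u \<in> chart_image (arc_chart k)"
      using near(1) eq by (auto simp: chart_image_def arc_chart_def intro!: rev_image_eqI[of "coord k (\<gamma> u)"])
    ultimately show "u \<in> ?W \<and> ?i u = coord k (\<gamma> u)" using u by auto
  qed
  have "s \<in> interior ?W"
    using ev unfolding eventually_nhds interior_def by blast
  then have at: "at s within ?W = at s" by (rule at_within_interior)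
  have "transition_deriv (arc_chart k) {0..1} \<gamma> s r \<longleftrightarrow> ((\<lambda>u. coord k (\<gamma> u)) has_real_derivative r) (at s)" for r
    unfolding transition_deriv_def at
    by (rule DERIV_cong_ev[OF refl _ refl]) (use ev in \<open>auto elim: eventually_mono\<close>)
  then have "transition_deriv (arc_chart k) {0..1} \<gamma> s r \<longleftrightarrow> r = speed \<gamma> k s" for r
    using D(2) DERIV_unique by blast
  then show "(if \<exists>r>0. transition_deriv (arc_chart k) {0..1} \<gamma> s r then g
      else if \<exists>r<0. transition_deriv (arc_chart k) {0..1} \<gamma> s r then - g else 0)
      = (if 0 < speed \<gamma> k s then g else - g)"
    using D(1) by auto
qed

text \<open>
  There is a Lipschitz function \<open>H\<close> on the circle that is positive exactly on the open
  arc from \<open>t\<close> to \<open>t'\<close> and vanishes only at its two ends, with slopes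
  \<open>1\<close> and \<open>-1\<close>. The zeros of \<open>H \<circ> \<gamma>\<close> are the
  preimages of the two ends, with opposite signs, and \<open>sum_signed_crossings\<close> counts
  them.
\<close>

lemma push_forward_jump:
  fixes g :: "'g::ab_group_add"
  assumes \<gamma>: "lipschitz_path X \<gamma>" and jk: "j < n" "k < n"
    and t: "transversal_level \<gamma> j t" and t': "transversal_level \<gamma> k t'" and tt': "t < t'"
  shows "push_forward {0..1} \<gamma> (\<lambda>_. g) (arc_chart j) (pt t)
       - push_forward {0..1} \<gamma> (\<lambda>_. g) (arc_chart k) (pt t')
       = (if \<gamma> 1 \<in> pt ` {t<..<t'} then g else 0) - (if \<gamma> 0 \<in> pt ` {t<..<t'} then g else 0)"
proof -
  obtain B where B: "0 < B" "\<And>s. s \<in> {0..1} \<Longrightarrow> \<gamma> s \<in> mspace X"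
    "\<And>s t. s \<in> {0..1} \<Longrightarrow> t \<in> {0..1} \<Longrightarrow> mdist X (\<gamma> s) (\<gamma> t) \<le> B * \<bar>s - t\<bar>"
    using lipschitz_pathE[OF \<gamma>] by metis
  have tj: "t \<in> {real j<..<real j + 1}" and tk: "t' \<in> {real k<..<real k + 1}"
    using t t' by (auto simp: transversal_level_def)
  have "real k + 1 \<le> real n" "0 \<le> real j" using jk by linarith+
  then have rng: "0 < t" "t' < real n" using tj tk by auto
  define \<eta> where "\<eta> = min t (real n - t')"
  have eta: "0 < \<eta>" "\<eta> \<le> t" "\<eta> \<le> real n - t'" using rng by (auto simp: \<eta>_def)
  \<comment> \<open>the truncation at \<open>- \<eta>\<close> makes the function continuous where the circle closes up\<close>
  define h where "h z = max (min (z - t) (t' - z)) (- \<eta>)" for z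
  define H where "H x = h (inv e x)" for x
  have He: "H (e z) = h z" for z using inj_e by (simp add: H_def)
  have hle: "\<bar>h z - h w\<bar> \<le> \<bar>z - w\<bar>" for z w unfolding h_def by linarith
  have hwrap: "\<bar>h z - h w\<bar> \<le> real n - \<bar>z - w\<bar>" if "0 \<le> z" "z < real n" "0 \<le> w" "w < real n" "z \<le> w" for z w
  proof -
    have "0 \<le> h z + \<eta>" "h z + \<eta> \<le> z" using that eta tt' unfolding h_def by linarith+
    moreover have "0 \<le> h w + \<eta>" "h w + \<eta> \<le> real n - w" using that eta tt' unfolding h_def by linarith+
    ultimately show ?thesis using that by (auto simp: abs_if)
  qed
  have HL: "\<bar>H x - H y\<bar> \<le> mdist X x y" if xy: "x \<in> mspace X" "y \<in> mspace X" for x y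
  proof -
    obtain z w where z: "0 \<le> z" "z < real n" "x = e z" and w: "0 \<le> w" "w < real n" "y = e w"
      using ptE[OF xy(1)] ptE[OF xy(2)] by metis
    have "\<bar>h z - h w\<bar> \<le> \<bar>real n - \<bar>z - w\<bar>\<bar>"
    proof (cases "z \<le> w")
      case True
      show ?thesis using hwrap[OF z(1,2) w(1,2) True] by linarith
    next
      case False
      then have "w \<le> z" by simp
      from hwrap[OF w(1,2) z(1,2) this] show ?thesis by linarith
    qed
    then show ?thesis using hle[of z w] by (simp add: z(3) w(3) He mdist_X circle_dist_def)
  qed
  define u where "u s = H (\<gamma> s)" for s
  have "B-lipschitz_on {0..1} u"
    unfolding lipschitz_on_def dist_real_def u_def
    using B HL by (meson less_imp_le order_trans)
  then have cont: "continuous_on {0..1} u" by (rule lipschitz_on_continuous_on)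
  have ptt: "pt t = e t" "pt t' = e t'" using rng tt' by (auto intro: pt_eq)
  have zeros: "u s = 0 \<longleftrightarrow> \<gamma> s = pt t \<or> \<gamma> s = pt t'" if s: "s \<in> {0..1}" for s
  proof -
    obtain z where z: "0 \<le> z" "z < real n" "\<gamma> s = e z" using ptE[OF B(2)[OF s]] by metis
    have "u s = 0 \<longleftrightarrow> z = t \<or> z = t'" using eta tt' unfolding u_def z(3) He h_def by linarith
    then show ?thesis using inj_e z(3) by (simp add: ptt inj_eq)
  qed
  have pos: "0 < u s \<longleftrightarrow> \<gamma> s \<in> pt ` {t<..<t'}" if s: "s \<in> {0..1}" for s
  proof -
    obtain z where z: "0 \<le> z" "z < real n" "\<gamma> s = e z" using ptE[OF B(2)[OF s]] by metis
    have "0 < u s \<longleftrightarrow> z \<in> {t<..<t'}" using eta tt' unfolding u_def z(3) He h_def greaterThanLessThan_iff by linarith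
    also have "\<dots> \<longleftrightarrow> e z \<in> e ` {t<..<t'}" using inj_e by (simp add: inj_image_mem_iff)
    also have "e ` {t<..<t'} = pt ` {t<..<t'}" using rng by (intro image_cong) (auto simp: pt_eq)
    finally show ?thesis using z by simp
  qed
  define u' where "u' s = (if \<gamma> s = pt t then speed \<gamma> j s else - speed \<gamma> k s)" for s
  have ne: "pt t \<noteq> pt t'" using ptt inj_e tt' by (simp add: inj_eq)
  have ders: "u' s \<noteq> 0 \<and> (u has_real_derivative u' s) (at s)" if s: "s \<in> {0..1}" "u s = 0" for s
  proof (cases "\<gamma> s = pt t")
    case True
    note D = transversal_levelD[OF t s(1) True]
    define \<epsilon> where "\<epsilon> = min (min (t - real j) (real j + 1 - t)) (min \<eta> ((t' - t) / 2))"
    have "\<epsilon> \<le> (t' - t) / 2" unfolding \<epsilon>_def by (rule min.coboundedI2, rule min.cobounded2)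
    moreover have "0 < \<epsilon>" "\<epsilon> \<le> t - real j" "\<epsilon> \<le> real j + 1 - t" "\<epsilon> \<le> \<eta>"
      using eta tj tt' by (auto simp: \<epsilon>_def)
    ultimately have eps: "0 < \<epsilon>" "\<epsilon> \<le> t - real j" "\<epsilon> \<le> real j + 1 - t" "\<epsilon> \<le> \<eta>" "\<epsilon> \<le> (t' - t) / 2"
      by blast+
    have "\<forall>\<^sub>F w in nhds s. u w = coord j (\<gamma> w) - t"
      using lipschitz_path_near[OF \<gamma> D(3) eps(1)]
    proof (rule eventually_mono)
      fix w assume w: "w \<in> {0..1} \<and> mdist X (\<gamma> s) (\<gamma> w) < \<epsilon>"
      have near: "\<gamma> w = e (coord j (\<gamma> w))" "\<bar>coord j (\<gamma> w) - t\<bar> < \<epsilon>"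
        using near_pt[OF jk(1) tj B(2), of w \<epsilon>] w True eps by auto
      have "u w = h (coord j (\<gamma> w))" unfolding u_def by (subst near(1)) (rule He)
      also have "\<dots> = coord j (\<gamma> w) - t"
      proof -
        have "coord j (\<gamma> w) - t \<le> t' - coord j (\<gamma> w)" "- \<eta> \<le> coord j (\<gamma> w) - t"
          using near(2) eps(4,5) by (auto simp: abs_less_iff field_simps)
        then show ?thesis by (simp add: h_def)
      qed
      finally show "u w = coord j (\<gamma> w) - t" .
    qed
    moreover have "((\<lambda>w. coord j (\<gamma> w) - t) has_real_derivative speed \<gamma> j s) (at s)"
      using D(2) by (auto intro!: derivative_eq_intros)
    ultimately have "(u has_real_derivative speed \<gamma> j s) (at s)" by (rule has_real_derivative_locally_eq[rotated])
    then show ?thesis using True D(1) by (simp add: u'_def)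
  next
    case False
    then have s': "\<gamma> s = pt t'" using zeros s by blast
    note D = transversal_levelD[OF t' s(1) s']
    define \<epsilon> where "\<epsilon> = min (min (t' - real k) (real k + 1 - t')) (min \<eta> ((t' - t) / 2))"
    have "\<epsilon> \<le> (t' - t) / 2" unfolding \<epsilon>_def by (rule min.coboundedI2, rule min.cobounded2)
    moreover have "0 < \<epsilon>" "\<epsilon> \<le> t' - real k" "\<epsilon> \<le> real k + 1 - t'" "\<epsilon> \<le> \<eta>"
      using eta tk tt' by (auto simp: \<epsilon>_def)
    ultimately have eps: "0 < \<epsilon>" "\<epsilon> \<le> t' - real k" "\<epsilon> \<le> real k + 1 - t'" "\<epsilon> \<le> \<eta>" "\<epsilon> \<le> (t' - t) / 2"
      by blast+
    have "\<forall>\<^sub>F w in nhds s. u w = t' - coord k (\<gamma> w)"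
      using lipschitz_path_near[OF \<gamma> D(3) eps(1)]
    proof (rule eventually_mono)
      fix w assume w: "w \<in> {0..1} \<and> mdist X (\<gamma> s) (\<gamma> w) < \<epsilon>"
      have near: "\<gamma> w = e (coord k (\<gamma> w))" "\<bar>coord k (\<gamma> w) - t'\<bar> < \<epsilon>"
        using near_pt[OF jk(2) tk B(2), of w \<epsilon>] w s' eps by auto
      have "u w = h (coord k (\<gamma> w))" unfolding u_def by (subst near(1)) (rule He)
      also have "\<dots> = t' - coord k (\<gamma> w)"
      proof -
        have "t' - coord k (\<gamma> w) \<le> coord k (\<gamma> w) - t" "- \<eta> \<le> t' - coord k (\<gamma> w)"
          using near(2) eps(4,5) by (auto simp: abs_less_iff field_simps)
        then show ?thesis by (simp add: h_def)
      qed
      finally show "u w = t' - coord k (\<gamma> w)" .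
    qed
    moreover have "((\<lambda>w. t' - coord k (\<gamma> w)) has_real_derivative - speed \<gamma> k s) (at s)"
      using D(2) by (auto intro!: derivative_eq_intros)
    ultimately have "(u has_real_derivative - speed \<gamma> k s) (at s)" by (rule has_real_derivative_locally_eq[rotated])
    then show ?thesis using False D(1) by (simp add: u'_def)
  qed
  have ends: "u 0 \<noteq> 0" "u 1 \<noteq> 0" using zeros[of 0] zeros[of 1] t t' by (auto simp: transversal_level_def)
  let ?A = "{s \<in> {0..1}. \<gamma> s = pt t}" and ?B = "{s \<in> {0..1}. \<gamma> s = pt t'}"
  have Z: "{s \<in> {0..1}. u s = 0} = ?A \<union> ?B" using zeros by blast
  have fin: "finite (?A \<union> ?B)" unfolding Z[symmetric]
    by (rule finite_transversal_zeros[OF cont]) (use ders in blast)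
  have "(\<Sum>s\<in>?A \<union> ?B. if 0 < u' s then g else - g) = (if 0 < u 1 then g else 0) - (if 0 < u 0 then g else 0)"
    unfolding Z[symmetric] by (rule sum_signed_crossings[OF cont _ ends ders]) auto
  moreover have "(\<Sum>s\<in>?A \<union> ?B. if 0 < u' s then g else - g)
      = (\<Sum>s\<in>?A. if 0 < u' s then g else - g) + (\<Sum>s\<in>?B. if 0 < u' s then g else - g)"
    using fin ne by (intro sum.union_disjoint) auto
  moreover have "(\<Sum>s\<in>?A. if 0 < u' s then g else - g) = push_forward {0..1} \<gamma> (\<lambda>_. g) (arc_chart j) (pt t)"
    unfolding push_forward_level[OF \<gamma> jk(1) t] by (rule sum.cong) (auto simp: u'_def)
  moreover have "(\<Sum>s\<in>?B. if 0 < u' s then g else - g) = - push_forward {0..1} \<gamma> (\<lambda>_. g) (arc_chart k) (pt t')"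
    unfolding push_forward_level[OF \<gamma> jk(2) t'] sum_negf[symmetric]
  proof (rule sum.cong[OF refl])
    fix s assume "s \<in> ?B"
    then show "(if 0 < u' s then g else - g) = - (if 0 < speed \<gamma> k s then g else - g)"
      using ne transversal_levelD(1)[OF t', of s] by (auto simp: u'_def)
  qed
  ultimately show ?thesis using pos[of 0] pos[of 1] by simp
qed

lemma chain_of_jump:
  assumes P: "lipschitz_chain X P" and jk: "j < n" "k < n" and tt': "t < t'"
    and t: "\<And>g \<gamma>. (g, \<gamma>) \<in> set P \<Longrightarrow> transversal_level \<gamma> j t"
    and t': "\<And>g \<gamma>. (g, \<gamma>) \<in> set P \<Longrightarrow> transversal_level \<gamma> k t'"
  shows "chain_of P (arc_chart j) (pt t) - chain_of P (arc_chart k) (pt t')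
       = chain_content (lipschitz_boundary P) (pt ` {t<..<t'})"
  using P t t'
proof (induction P)
  case Nil
  then show ?case by (simp add: chain_of_def lipschitz_boundary_def)
next
  case (Cons a P)
  obtain g \<gamma> where a: "a = (g, \<gamma>)" by (cases a)
  have IH: "chain_of P (arc_chart j) (pt t) - chain_of P (arc_chart k) (pt t')
       = chain_content (lipschitz_boundary P) (pt ` {t<..<t'})"
    using Cons by (intro Cons.IH) (auto simp: lipschitz_chain_def)
  have "lipschitz_path X \<gamma>" using Cons.prems(1) a by (auto simp: lipschitz_chain_def)
  then have "push_forward {0..1} \<gamma> (\<lambda>_. g) (arc_chart j) (pt t) - push_forward {0..1} \<gamma> (\<lambda>_. g) (arc_chart k) (pt t')
       = (if \<gamma> 1 \<in> pt ` {t<..<t'} then g else 0) - (if \<gamma> 0 \<in> pt ` {t<..<t'} then g else 0)"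
    using Cons.prems(2,3)[of g \<gamma>] a by (intro push_forward_jump jk tt') auto
  then show ?case using IH unfolding a chain_content_lipschitz_boundary
    by (simp add: chain_of_def algebra_simps)
qed

end

context circle_space
begin

definition open_arc :: "nat \<Rightarrow> 'x set" where "open_arc k = pt ` {real k<..<real k + 1}"

lemma arc_subset_circle: "k < n \<Longrightarrow> {real k..real k + 1} \<subseteq> {0..real n}"
proof
  fix t assume "k < n" "t \<in> {real k..real k + 1}"
  moreover have "real k + 1 \<le> real n" using \<open>k < n\<close> by linarith
  ultimately show "t \<in> {0..real n}" by auto
qed

lemma open_arc_measure:
  assumes k: "k < n"
  shows "open_arc k \<in> sets (hausdorff_measure X)" "1 \<le> emeasure (hausdorff_measure X) (open_arc k)"
proof -
  let ?M = "hausdorff_measure X" and ?C = "pt ` {real k..real k + 1}" and ?E = "{pt (real k)} \<union> {pt (real k + 1)}"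
  have ne: "nonexpanding_on X {real k..real k + 1} pt"
    by (rule nonexpanding_on_subset[OF nonexpanding_pt arc_subset_circle[OF k]])
  have C: "?C \<in> sets ?M" by (rule sets_nonexpanding_image[OF ne]) simp
  have CX: "?C \<subseteq> mspace X" by (rule nonexpanding_on_image[OF ne])
  have "{pt (real k)} \<in> null_sets ?M" "{pt (real k + 1)} \<in> null_sets ?M"
    using CX by (force intro!: null_set_point)+
  then have E: "?E \<in> null_sets ?M" by (rule null_sets.Un)
  have "{real k<..<real k + 1} = {real k..real k + 1} - {real k, real k + 1}" by auto
  then have "open_arc k = ?C - pt ` {real k, real k + 1}"
    unfolding open_arc_def by (simp only:) (rule inj_on_image_set_diff[OF inj_pt_arc[OF k]], auto)
  then have eq: "open_arc k = ?C - ?E" by auto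
  then show "open_arc k \<in> sets ?M" using C E by auto
  have "ennreal ((real k + 1) - real k) \<le> hausdorff_outer X ?C"
  proof (rule interval_length_le_hausdorff_outer[of _ _ "coord k"])
    show "{real k..real k + 1} \<subseteq> coord k ` ?C" using coord_pt[OF k] by force
    show "\<bar>coord k x - coord k y\<bar> \<le> mdist X x y" if "x \<in> ?C" "y \<in> ?C" for x y
      using that CX k by (intro coord_Lipschitz) auto
  qed
  then have "1 \<le> emeasure ?M ?C" using C by (simp add: emeasure_hausdorff_measure)
  also have "emeasure ?M ?C = emeasure ?M (open_arc k)"
    unfolding eq using C E by (simp add: emeasure_Diff_null_set)
  finally show "1 \<le> emeasure ?M (open_arc k)" .
qed

lemma AE_transversal_level:
  assumes g: "lipschitz_path X \<gamma>" and k: "k < n"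
  shows "AE y in hausdorff_measure X. \<forall>t\<in>{real k<..<real k + 1}. y = pt t \<longrightarrow> transversal_level \<gamma> k t"
proof -
  obtain Z where Z: "Z \<in> null_sets (hausdorff_measure X)"
    "pt ` {t \<in> {real k..real k + 1}. \<not> transversal_level \<gamma> k t} \<subseteq> Z"
    using null_set_nonexpanding_image[OF nonexpanding_on_subset[OF nonexpanding_pt arc_subset_circle[OF k]]
      negligible_not_transversal[OF g k]] by blast
  have "AE y in hausdorff_measure X. y \<notin> Z" using Z(1) by (rule AE_not_in)
  then show ?thesis
  proof (rule eventually_mono, intro ballI impI)
    fix y t assume y: "y \<notin> Z" "t \<in> {real k<..<real k + 1}" "y = pt t"
    show "transversal_level \<gamma> k t"
    proof (rule ccontr)
      assume "\<not> transversal_level \<gamma> k t"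
      then have "pt t \<in> pt ` {t \<in> {real k..real k + 1}. \<not> transversal_level \<gamma> k t}"
        using y(2) by (intro imageI) auto
      then have "y \<in> Z" using Z(2) y(3) by blast
      then show False using y by simp
    qed
  qed
qed

lemma AE_transversal_level_chain:
  assumes P: "lipschitz_chain X P" and k: "k < n"
  shows "AE y in hausdorff_measure X. \<forall>t\<in>{real k<..<real k + 1}. y = pt t \<longrightarrow>
    (\<forall>(g, \<gamma>)\<in>set P. transversal_level \<gamma> k t)"
proof -
  have "AE y in hausdorff_measure X. \<forall>p\<in>set P. \<forall>t\<in>{real k<..<real k + 1}. y = pt t \<longrightarrow> transversal_level (snd p) k t"
  proof (rule AE_finite_allI)
    fix p assume "p \<in> set P"
    then have "lipschitz_path X (snd p)" using P by (auto simp: lipschitz_chain_def)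
    then show "AE y in hausdorff_measure X. \<forall>t\<in>{real k<..<real k + 1}. y = pt t \<longrightarrow> transversal_level (snd p) k t"
      using k by (rule AE_transversal_level)
  qed simp
  then show ?thesis by (rule eventually_mono) auto
qed

lemma chain_content_circle_points:
  assumes "k < n" "t \<in> {0<..<1}" "t' \<in> {real k<..<real k + 1}"
  shows "chain_content (\<Sum>i=1..n. Poly_Mapping.single (pt (real i)) (g i)) (pt ` {t<..<t'}) = (\<Sum>i=1..k. g i)"
proof -
  have kn: "real k + 1 \<le> real n" using assms(1) by linarith
  have img: "pt ` {t<..<t'} = e ` {t<..<t'}" using assms kn by (intro image_cong) (auto simp: pt_eq)
  have iff: "pt (real i) \<in> pt ` {t<..<t'} \<longleftrightarrow> i \<in> {1..k}" if i: "i \<in> {1..n}" for i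
  proof (cases "i = n")
    case True
    then have "pt (real i) = e 0" using real_n by (simp add: pt_def)
    then show ?thesis using True assms img inj_e by (auto simp: inj_eq)
  next
    case False
    then have "pt (real i) = e (real i)" using i by (intro pt_eq) auto
    then have "pt (real i) \<in> pt ` {t<..<t'} \<longleftrightarrow> real i \<in> {t<..<t'}" using inj_e by (simp add: img inj_image_mem_iff)
    also have "\<dots> \<longleftrightarrow> i \<in> {1..k}"
    proof
      assume "real i \<in> {t<..<t'}"
      then have "real i < real k + 1" using assms by auto
      then have "i \<le> k" by linarith
      then show "i \<in> {1..k}" using i by auto
    next
      assume "i \<in> {1..k}"
      then have "1 \<le> real i" "real i \<le> real k" by auto
      then show "real i \<in> {t<..<t'}" using assms by auto
    qed
    finally show ?thesis .
  qed
  have "chain_content (\<Sum>i=1..n. Poly_Mapping.single (pt (real i)) (g i)) (pt ` {t<..<t'})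
      = (\<Sum>i=1..n. if i \<in> {1..k} then g i else 0)"
    unfolding chain_content_sum chain_content_single using iff by (intro sum.cong) auto
  also have "\<dots> = (\<Sum>i\<in>{1..n} \<inter> {1..k}. g i)" by (rule sum.inter_restrict[symmetric]) simp
  also have "{1..n} \<inter> {1..k} = {1..k}" using assms(1) by auto
  finally show ?thesis .
qed

text \<open>
  By the definition of the boundary, a chain of almost minimal mass differs by chains of small mass
  from a Lipschitz chain with boundary \<open>R + W\<close>, where \<open>W\<close> has small mass.
  In every arc there is a transversal point at which the norm of the coefficient does not much
  exceed the mass on that arc. Between two such points the coefficient changes by the boundary in
  between, which is a sum of \<open>g i\<close> up to a part of \<open>W\<close>.
\<close>

theorem filling_length_circle:
  fixes N :: "'g::ab_group_add \<Rightarrow> real"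
  assumes N: "normed_ab_group N"
    and fill: "filling_length N X (\<Sum>i=1..n. Poly_Mapping.single (pt (real i)) (g i)) < ennreal m"
  obtains c where "(\<Sum>k<n. N (c - (\<Sum>i=1..k. g i))) < m"
proof -
  let ?M = "hausdorff_measure X"
  define R where "R = (\<Sum>i=1..n. Poly_Mapping.single (pt (real i)) (g i))"
  obtain S where S: "has_boundary N X S R" "mass N X S < ennreal m"
    using fill unfolding filling_length_def R_def[symmetric] by (auto simp: INF_less_iff)
  obtain F1 where F1: "F1 \<in> borel_measurable ?M" "(\<integral>\<^sup>+y. F1 y \<partial>?M) < ennreal m"
    "\<forall>c. chart X c \<longrightarrow> (AE y in ?M. y \<in> chart_image c \<longrightarrow> ennreal (N (S c y)) \<le> F1 y)"
    by (rule mass_less_dominated[OF N S(2)])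
  define m' where "m' = enn2real (\<integral>\<^sup>+y. F1 y \<partial>?M)"
  have m': "(\<integral>\<^sup>+y. F1 y \<partial>?M) = ennreal m'" "0 \<le> m'" "m' < m"
  proof -
    show 1: "(\<integral>\<^sup>+y. F1 y \<partial>?M) = ennreal m'" unfolding m'_def using F1(2) by (metis ennreal_enn2real ennreal_less_top less_trans)
    show "0 \<le> m'" by (simp add: m'_def)
    then show "m' < m" using F1(2) unfolding 1 by (simp add: ennreal_less_iff)
  qed
  \<comment> \<open>the slack \<open>m - m'\<close> pays \<open>\<delta>\<close> for each of the two corrections of the chain, and twice \<open>\<delta>\<close> per arc:
    for the choice of a point and for the error \<open>W\<close> of the boundary\<close>
  define \<delta> where "\<delta> = (m - m') / (2 * real n + 3)"
  have del: "0 < \<delta>" "m' + 2 * \<delta> + 2 * real n * \<delta> < m"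
  proof -
    show d: "0 < \<delta>" using m' by (simp add: \<delta>_def)
    have "(2 * real n + 3) * \<delta> = m - m'" by (simp add: \<delta>_def)
    then show "m' + 2 * \<delta> + 2 * real n * \<delta> < m" using d by (simp add: algebra_simps)
  qed
  obtain Pq where Pq: "\<And>q. lipschitz_chain X (Pq q)"
    "(\<lambda>q. mass N X (\<lambda>c y. S c y - chain_of (Pq q) c y)) \<longlonglongrightarrow> 0"
    "(\<lambda>q. flat_norm N X (lipschitz_boundary (Pq q) - R)) \<longlonglongrightarrow> 0"
    using S(1) unfolding has_boundary_def by blast
  have "\<forall>\<^sub>F q in sequentially. mass N X (\<lambda>c y. S c y - chain_of (Pq q) c y) < ennreal \<delta>
      \<and> flat_norm N X (lipschitz_boundary (Pq q) - R) < ennreal \<delta>"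
    using order_tendstoD(2)[OF Pq(2), of "ennreal \<delta>"] order_tendstoD(2)[OF Pq(3), of "ennreal \<delta>"] del(1)
    by (intro eventually_conj) auto
  then obtain q where q: "mass N X (\<lambda>c y. S c y - chain_of (Pq q) c y) < ennreal \<delta>"
    "flat_norm N X (lipschitz_boundary (Pq q) - R) < ennreal \<delta>"
    using eventually_happens'[OF sequentially_bot] by blast
  define P where "P = Pq q"
  have LP: "lipschitz_chain X P" using Pq(1) by (simp add: P_def)
  obtain Q where Q: "lipschitz_chain X Q"
    "ennreal (mass0 N (lipschitz_boundary P - R - lipschitz_boundary Q)) + mass N X (chain_of Q) < ennreal \<delta>"
    using q(2) unfolding flat_norm_def P_def by (auto simp: INF_less_iff)
  define W where "W = lipschitz_boundary P - R - lipschitz_boundary Q"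
  have "ennreal (mass0 N W) \<le> ennreal (mass0 N W) + mass N X (chain_of Q)" by simp
  then have "ennreal (mass0 N W) < ennreal \<delta>" using Q(2) unfolding W_def by (rule le_less_trans)
  moreover have "0 \<le> mass0 N W" unfolding mass0_def using normed_ab_groupD(1)[OF N] by (intro sum_nonneg)
  ultimately have Wd: "mass0 N W < \<delta>" by (simp add: ennreal_less_iff)
  have "mass N X (chain_of Q) \<le> ennreal (mass0 N W) + mass N X (chain_of Q)" by simp
  then have massQ: "mass N X (chain_of Q) < ennreal \<delta>" using Q(2) unfolding W_def by (rule le_less_trans)
  obtain F2 where F2: "F2 \<in> borel_measurable ?M" "(\<integral>\<^sup>+y. F2 y \<partial>?M) < ennreal \<delta>"
    "\<forall>c. chart X c \<longrightarrow> (AE y in ?M. y \<in> chart_image c \<longrightarrow> ennreal (N (S c y - chain_of P c y)) \<le> F2 y)"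
    by (rule mass_less_dominated[OF N q(1)[folded P_def]])
  obtain F3 where F3: "F3 \<in> borel_measurable ?M" "(\<integral>\<^sup>+y. F3 y \<partial>?M) < ennreal \<delta>"
    "\<forall>c. chart X c \<longrightarrow> (AE y in ?M. y \<in> chart_image c \<longrightarrow> ennreal (N (chain_of Q c y)) \<le> F3 y)"
    by (rule mass_less_dominated[OF N massQ])
  define F where "F y = F1 y + F2 y + F3 y" for y
  have Fm: "F \<in> borel_measurable ?M" unfolding F_def using F1(1) F2(1) F3(1) by measurable
  have "(\<integral>\<^sup>+y. F y \<partial>?M) = (\<integral>\<^sup>+y. F1 y \<partial>?M) + (\<integral>\<^sup>+y. F2 y \<partial>?M) + (\<integral>\<^sup>+y. F3 y \<partial>?M)"
    unfolding F_def using F1(1) F2(1) F3(1) by (simp add: nn_integral_add)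
  also have "\<dots> \<le> ennreal m' + ennreal \<delta> + ennreal \<delta>"
    using m'(1) F2(2) F3(2) by (intro add_mono) auto
  also have "\<dots> = ennreal (m' + 2 * \<delta>)" using m'(2) del(1) by (simp add: ennreal_plus[symmetric] del: ennreal_plus)
  finally have FI: "(\<integral>\<^sup>+y. F y \<partial>?M) \<le> ennreal (m' + 2 * \<delta>)" .
  define \<theta> where "\<theta> k y = chain_of P (arc_chart k) y - chain_of Q (arc_chart k) y" for k y
  have tri: "N (a - b - c) \<le> N a + N b + N c" for a b c
    using normed_ab_groupD(2)[OF N, of "a - b" "- c"] normed_ab_groupD(2)[OF N, of a "- b"] normed_ab_groupD(3)[OF N] by auto
  have bound: "AE y in ?M. y \<in> open_arc k \<longrightarrow> ennreal (N (\<theta> k y)) \<le> F y" if k: "k < n" for k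
    using F1(3)[rule_format, OF chart_arc_chart[OF k]] F2(3)[rule_format, OF chart_arc_chart[OF k]] F3(3)[rule_format, OF chart_arc_chart[OF k]]
  proof eventually_elim
    case (elim y)
    show ?case
    proof
      assume "y \<in> open_arc k"
      then have "y \<in> chart_image (arc_chart k)" by (auto simp: open_arc_def chart_image_def arc_chart_def)
      then have le: "ennreal (N (S (arc_chart k) y)) \<le> F1 y" "ennreal (N (S (arc_chart k) y - chain_of P (arc_chart k) y)) \<le> F2 y"
        "ennreal (N (chain_of Q (arc_chart k) y)) \<le> F3 y" using elim by auto
      have "N (\<theta> k y) \<le> N (S (arc_chart k) y) + N (S (arc_chart k) y - chain_of P (arc_chart k) y) + N (chain_of Q (arc_chart k) y)"
        using tri[of "S (arc_chart k) y" "S (arc_chart k) y - chain_of P (arc_chart k) y" "chain_of Q (arc_chart k) y"]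
        by (simp add: \<theta>_def)
      then have "ennreal (N (\<theta> k y)) \<le> ennreal (N (S (arc_chart k) y)) + ennreal (N (S (arc_chart k) y - chain_of P (arc_chart k) y)) + ennreal (N (chain_of Q (arc_chart k) y))"
        using normed_ab_groupD(1)[OF N] by (simp add: ennreal_plus[symmetric] ennreal_leI del: ennreal_plus)
      also have "\<dots> \<le> F y" unfolding F_def using le by (intro add_mono)
      finally show "ennreal (N (\<theta> k y)) \<le> F y" .
    qed
  qed
  have "\<exists>t. t \<in> {real k<..<real k + 1} \<and> (\<forall>(g, \<gamma>)\<in>set P \<union> set Q. transversal_level \<gamma> k t)
      \<and> ennreal (N (\<theta> k (pt t))) \<le> (\<integral>\<^sup>+y. F y * indicator (open_arc k) y \<partial>?M) + ennreal \<delta>" if k: "k < n" for k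
  proof -
    have ae: "AE y in ?M. y \<in> open_arc k \<longrightarrow> (ennreal (N (\<theta> k y)) \<le> F y \<and>
        (\<forall>t\<in>{real k<..<real k + 1}. y = pt t \<longrightarrow> (\<forall>(g, \<gamma>)\<in>set P \<union> set Q. transversal_level \<gamma> k t)))"
      using bound[OF k] AE_transversal_level_chain[OF LP k] AE_transversal_level_chain[OF Q(1) k]
      by eventually_elim auto
    have fin: "(\<integral>\<^sup>+y. F y * indicator (open_arc k) y \<partial>?M) < top"
    proof -
      have "(\<integral>\<^sup>+y. F y * indicator (open_arc k) y \<partial>?M) \<le> (\<integral>\<^sup>+y. F y \<partial>?M)"
        by (intro nn_integral_mono) (auto simp: indicator_def)
      then show ?thesis using FI by (meson ennreal_less_top le_less_trans order_trans)
    qed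
    obtain y where y: "y \<in> open_arc k"
        "ennreal (N (\<theta> k y)) \<le> F y \<and>
          (\<forall>t\<in>{real k<..<real k + 1}. y = pt t \<longrightarrow> (\<forall>(g, \<gamma>)\<in>set P \<union> set Q. transversal_level \<gamma> k t))"
        "F y \<le> (\<integral>\<^sup>+y. F y * indicator (open_arc k) y \<partial>?M) + ennreal \<delta>"
      by (rule AE_exists_le_integral[OF open_arc_measure[OF k] Fm ae fin del(1)])
    obtain t where t: "t \<in> {real k<..<real k + 1}" "y = pt t" using y(1) by (auto simp: open_arc_def)
    show ?thesis
    proof (intro exI conjI)
      show "t \<in> {real k<..<real k + 1}" by (rule t(1))
      show "\<forall>(g, \<gamma>)\<in>set P \<union> set Q. transversal_level \<gamma> k t" using y(2) t by blast
      have "ennreal (N (\<theta> k y)) \<le> F y" using y(2) by blast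
      then show "ennreal (N (\<theta> k (pt t))) \<le> (\<integral>\<^sup>+y. F y * indicator (open_arc k) y \<partial>?M) + ennreal \<delta>"
        using y(3) unfolding t(2) by (rule order_trans)
    qed
  qed
  then have "\<forall>k\<in>{..<n}. \<exists>t. t \<in> {real k<..<real k + 1} \<and> (\<forall>(g, \<gamma>)\<in>set P \<union> set Q. transversal_level \<gamma> k t)
      \<and> ennreal (N (\<theta> k (pt t))) \<le> (\<integral>\<^sup>+y. F y * indicator (open_arc k) y \<partial>?M) + ennreal \<delta>"
    by (intro ballI) simp
  from bchoice[OF this] obtain t where
    T: "\<forall>k\<in>{..<n}. t k \<in> {real k<..<real k + 1} \<and> (\<forall>(g, \<gamma>)\<in>set P \<union> set Q. transversal_level \<gamma> k (t k))
      \<and> ennreal (N (\<theta> k (pt (t k)))) \<le> (\<integral>\<^sup>+y. F y * indicator (open_arc k) y \<partial>?M) + ennreal \<delta>"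
    by blast
  have t: "t k \<in> {real k<..<real k + 1}"
    "\<And>g \<gamma>. (g, \<gamma>) \<in> set P \<union> set Q \<Longrightarrow> transversal_level \<gamma> k (t k)"
    "ennreal (N (\<theta> k (pt (t k)))) \<le> (\<integral>\<^sup>+y. F y * indicator (open_arc k) y \<partial>?M) + ennreal \<delta>"
    if "k < n" for k
    using T that by auto
  have tP: "(g, \<gamma>) \<in> set P \<Longrightarrow> transversal_level \<gamma> k (t k)" and tQ: "(g, \<gamma>) \<in> set Q \<Longrightarrow> transversal_level \<gamma> k (t k)"
    if "k < n" for k g \<gamma>
    using t(2)[OF that] by auto
  define c where "c = \<theta> 0 (pt (t 0))"
  have n0: "0 < n" using n2 by simp
  have near: "N (c - (\<Sum>i=1..k. g i)) \<le> N (\<theta> k (pt (t k))) + \<delta>" if k: "k < n" for k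
  proof (cases "k = 0")
    case True
    then show ?thesis using del by (simp add: c_def)
  next
    case False
    then have tt: "t 0 < t k" using t(1)[OF n0] t(1)[OF k] by auto
    let ?I = "pt ` {t 0<..<t k}"
    have "c - \<theta> k (pt (t k)) = chain_content (lipschitz_boundary P) ?I - chain_content (lipschitz_boundary Q) ?I"
      using chain_of_jump[OF LP n0 k tt tP[OF n0] tP[OF k]] chain_of_jump[OF Q(1) n0 k tt tQ[OF n0] tQ[OF k]]
      by (simp add: c_def \<theta>_def algebra_simps)
    also have "\<dots> = chain_content R ?I + chain_content W ?I"
      by (simp add: W_def chain_content_diff)
    also have "chain_content R ?I = (\<Sum>i=1..k. g i)"
      unfolding R_def using t(1)[OF n0] t(1)[OF k] by (intro chain_content_circle_points k) auto
    finally have eq: "c - (\<Sum>i=1..k. g i) = \<theta> k (pt (t k)) + chain_content W ?I" by (simp add: algebra_simps)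
    have "N (\<theta> k (pt (t k)) + chain_content W ?I) \<le> N (\<theta> k (pt (t k))) + N (chain_content W ?I)"
      by (rule normed_ab_groupD(2)[OF N])
    also have "\<dots> \<le> N (\<theta> k (pt (t k))) + \<delta>" using norm_chain_content_le[OF N, of W ?I] Wd by simp
    finally show ?thesis unfolding eq .
  qed
  have disj: "open_arc j \<inter> open_arc k = {}" if jk: "j < n" "k < n" "j \<noteq> k" for j k
  proof (rule ccontr)
    assume "open_arc j \<inter> open_arc k \<noteq> {}"
    then obtain y where "y \<in> open_arc j" "y \<in> open_arc k" by blast
    obtain s where s: "s \<in> {real j<..<real j + 1}" "y = pt s"
      using \<open>y \<in> open_arc j\<close> unfolding open_arc_def by blast
    obtain u where u: "u \<in> {real k<..<real k + 1}" "y = pt u"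
      using \<open>y \<in> open_arc k\<close> unfolding open_arc_def by blast
    have su: "s \<in> {real j<..<real j + 1}" "u \<in> {real k<..<real k + 1}" "pt s = pt u" using s u by auto
    have "real j + 1 \<le> real n" "real k + 1 \<le> real n" using jk by linarith+
    then have "pt s = e s" "pt u = e u" using su(1,2) by (auto intro!: pt_eq)
    then have "e s = e u" using su(3) by (simp only:)
    then have "s = u" by (rule injD[OF inj_e])
    then have "real j < real k + 1" "real k < real j + 1" using su(1,2) by auto
    then show False using jk(3) by linarith
  qed
  have "ennreal (\<Sum>k<n. N (\<theta> k (pt (t k)))) = (\<Sum>k<n. ennreal (N (\<theta> k (pt (t k)))))"
    using normed_ab_groupD(1)[OF N] by (simp add: sum_ennreal)
  also have "\<dots> \<le> (\<Sum>k<n. (\<integral>\<^sup>+y. F y * indicator (open_arc k) y \<partial>?M) + ennreal \<delta>)"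
    using t(3) by (intro sum_mono) auto
  also have "\<dots> = (\<Sum>k<n. (\<integral>\<^sup>+y. F y * indicator (open_arc k) y \<partial>?M)) + ennreal (real n * \<delta>)"
    using del(1) by (simp add: sum.distrib ennreal_mult ennreal_of_nat_eq_real_of_nat)
  also have "(\<Sum>k<n. (\<integral>\<^sup>+y. F y * indicator (open_arc k) y \<partial>?M)) = (\<integral>\<^sup>+y. (\<Sum>k<n. F y * indicator (open_arc k) y) \<partial>?M)"
    using Fm open_arc_measure(1) by (intro nn_integral_sum[symmetric]) (auto intro!: borel_measurable_times_ennreal)
  also have "\<dots> \<le> (\<integral>\<^sup>+y. F y \<partial>?M)"
  proof (rule nn_integral_mono)
    fix y
    show "(\<Sum>k<n. F y * indicator (open_arc k) y) \<le> F y"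
    proof (cases "\<exists>k<n. y \<in> open_arc k")
      case True
      then obtain k where k: "k < n" "y \<in> open_arc k" by blast
      have "(\<Sum>i<n. F y * indicator (open_arc i) y) = (\<Sum>i<n. if i = k then F y else 0)"
        using disj k by (intro sum.cong) (auto simp: indicator_def)
      then show ?thesis using k(1) by simp
    qed (auto simp: indicator_def)
  qed
  also have "\<dots> \<le> ennreal (m' + 2 * \<delta>)" by (rule FI)
  finally have "ennreal (\<Sum>k<n. N (\<theta> k (pt (t k)))) \<le> ennreal (m' + 2 * \<delta>) + ennreal (real n * \<delta>)"
    by (simp add: add_right_mono)
  also have "\<dots> = ennreal (m' + 2 * \<delta> + real n * \<delta>)"
    using m'(2) del(1) by (subst ennreal_plus) auto
  finally have "(\<Sum>k<n. N (\<theta> k (pt (t k)))) \<le> m' + 2 * \<delta> + real n * \<delta>"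
    using m'(2) del(1) by (subst (asm) ennreal_le_iff) auto
  moreover have "(\<Sum>k<n. N (c - (\<Sum>i=1..k. g i))) \<le> (\<Sum>k<n. N (\<theta> k (pt (t k))) + \<delta>)"
    using near by (intro sum_mono) auto
  moreover have "(\<Sum>k<n. N (\<theta> k (pt (t k))) + \<delta>) = (\<Sum>k<n. N (\<theta> k (pt (t k)))) + real n * \<delta>"
    by (simp add: sum.distrib)
  ultimately have "(\<Sum>k<n. N (c - (\<Sum>i=1..k. g i))) < m" using del(2) by linarith
  then show ?thesis by (rule that)
qed

end

section \<open>Arcs and arc length in spaces with unique arcs\<close>

abbreviation H1 :: "'b::metric_space measure" where "H1 \<equiv> hausdorff_measure euclidean_metric"

lemma nonexpanding_on_euclidean:
  "nonexpanding_on (euclidean_metric :: 'b::metric_space metric) A \<gamma> \<longleftrightarrow> (\<forall>s\<in>A. \<forall>t\<in>A. dist (\<gamma> s) (\<gamma> t) \<le> \<bar>s - t\<bar>)"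
  by (simp add: nonexpanding_on_def)

lemma sets_H1_closed: "closed C \<Longrightarrow> C \<in> sets (H1 :: 'b::metric_space measure)"
  by (rule sets_hausdorff_closedin) (simp add: mtopology_of_euclidean)

lemma H1_point [simp]: "{x} \<in> null_sets (H1 :: 'b::metric_space measure)"
  by (rule null_set_point) simp

text \<open>
  The distance from \<open>a\<close> maps \<open>A\<close> onto a set that contains \<open>{0..dist
  a b}\<close>.
\<close>

lemma dist_le_H1_connected:
  fixes A :: "'b::metric_space set"
  assumes A: "connected A" "closed A" and ab: "a \<in> A" "b \<in> A"
  shows "ennreal (dist a b) \<le> emeasure H1 A"
proof -
  have "connected (dist a ` A)"
    by (intro connected_continuous_image A(1) continuous_intros)
  then have "{0..dist a b} \<subseteq> dist a ` A"
    using ab by (intro connected_contains_Icc) (auto intro: rev_image_eqI[of a] rev_image_eqI[of b])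
  then have "ennreal (dist a b - 0) \<le> hausdorff_outer euclidean_metric A"
  proof (rule interval_length_le_hausdorff_outer)
    fix x y show "\<bar>dist a x - dist a y\<bar> \<le> mdist euclidean_metric x y"
      using abs_dist_diff_le[of x a y] by (simp add: dist_commute)
  qed
  then show ?thesis using sets_H1_closed[OF A(2)] by (simp add: emeasure_hausdorff_measure)
qed

lemma image_reversed_interval: "(\<lambda>v. q (1 - v)) ` {0..u} = q ` {1 - u..1::real}"
proof -
  have "{1 - u..1} = (\<lambda>v. 1 - v) ` {0..u}" by simp
  then show ?thesis by (simp only: image_image)
qed

text \<open>
  The model is the image of a circle in a tree, placed in a Banach space by an isometry. In a Banach
  space every path contains an arc with the same end points (\<open>path_contains_arc\<close>), so
  the unique arc between two points lies on every path between them.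
\<close>

locale unique_arc_set =
  fixes K :: "'b::{complete_space, real_normed_vector} set"
  assumes ex_curve: "\<And>a b. a \<in> K \<Longrightarrow> b \<in> K \<Longrightarrow>
      \<exists>D c. 0 \<le> D \<and> nonexpanding_on euclidean_metric {0..D} c \<and> c ` {0..D} \<subseteq> K \<and> c 0 = a \<and> c D = b"
    and unique_arc: "\<And>p q. arc p \<Longrightarrow> arc q \<Longrightarrow> path_image p \<subseteq> K \<Longrightarrow> path_image q \<subseteq> K \<Longrightarrow>
      pathstart p = pathstart q \<Longrightarrow> pathfinish p = pathfinish q \<Longrightarrow> path_image p = path_image q"
begin

definition joins :: "(real \<Rightarrow> 'b) \<Rightarrow> 'b \<Rightarrow> 'b \<Rightarrow> bool" where
  "joins q a b \<longleftrightarrow> arc q \<and> path_image q \<subseteq> K \<and> pathstart q = a \<and> pathfinish q = b"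

definition seg :: "'b \<Rightarrow> 'b \<Rightarrow> 'b set" where
  "seg a b = (if a = b then {a} else path_image (SOME q. joins q a b))"

lemma path_contains_joining_arc:
  assumes "path c" "path_image c \<subseteq> K" "pathstart c \<noteq> pathfinish c"
  obtains q where "joins q (pathstart c) (pathfinish c)" "path_image q \<subseteq> path_image c"
proof -
  obtain q where "arc q" "path_image q \<subseteq> path_image c" "pathstart q = pathstart c" "pathfinish q = pathfinish c"
    by (rule path_contains_arc[OF assms(1) refl refl assms(3)])
  then show ?thesis using assms(2) by (intro that[of q]) (auto simp: joins_def)
qed

lemma nonexpanding_path:
  assumes "nonexpanding_on (euclidean_metric :: 'b metric) {0..D} c" "0 \<le> D"
  shows "path (\<lambda>t. c (D * t))" "path_image (\<lambda>t. c (D * t)) = c ` {0..D}"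
proof -
  have "1-lipschitz_on {0..D} c" using assms(1) by (auto simp: nonexpanding_on_euclidean lipschitz_on_def dist_real_def)
  then have c: "continuous_on {0..D} c" by (rule lipschitz_on_continuous_on)
  have img: "(\<lambda>t. D * t) ` {0..1} = {0..D}"
    using image_mult_atLeastAtMost[of D 0 1] assms(2) by (cases "D = 0") (auto simp: image_constant_conv)
  have "continuous_on {0..1} (\<lambda>t. c (D * t))"
    by (rule continuous_on_compose2[OF c]) (auto intro!: continuous_intros simp: img assms(2) mult_left_le)
  then show "path (\<lambda>t. c (D * t))" by (simp add: path_def)
  show "path_image (\<lambda>t. c (D * t)) = c ` {0..D}"
    unfolding path_image_def using img by (metis image_image)
qed

lemma seg_eq: "joins q a b \<Longrightarrow> seg a b = path_image q"
proof -
  assume q: "joins q a b"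
  then have "a \<noteq> b" using arc_distinct_ends[of q] by (auto simp: joins_def)
  have "joins (SOME q. joins q a b) a b" using q by (rule someI[of "\<lambda>q. joins q a b" q])
  then show ?thesis using q \<open>a \<noteq> b\<close> unique_arc[of "SOME q. joins q a b" q] by (auto simp: seg_def joins_def)
qed

lemma ex_joins:
  assumes "a \<in> K" "b \<in> K" "a \<noteq> b" obtains q where "joins q a b"
proof -
  obtain D c where c: "0 \<le> D" "nonexpanding_on euclidean_metric {0..D} c" "c ` {0..D} \<subseteq> K" "c 0 = a" "c D = b"
    using ex_curve[OF assms(1,2)] by blast
  note p = nonexpanding_path[OF c(2,1)]
  have "pathstart (\<lambda>t. c (D * t)) = a" "pathfinish (\<lambda>t. c (D * t)) = b" using c by (auto simp: pathstart_def pathfinish_def)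
  then show ?thesis using path_contains_joining_arc[OF p(1)] p(2) c(3) assms(3) that by metis
qed

lemma seg_subset_path:
  assumes c: "path c" "path_image c \<subseteq> K"
  shows "seg (pathstart c) (pathfinish c) \<subseteq> path_image c"
proof (cases "pathstart c = pathfinish c")
  case True
  then show ?thesis using pathfinish_in_path_image[of c] by (simp add: seg_def)
next
  case False
  obtain q where "joins q (pathstart c) (pathfinish c)" "path_image q \<subseteq> path_image c"
    by (rule path_contains_joining_arc[OF c False])
  then show ?thesis using seg_eq by simp
qed

lemma seg_refl [simp]: "seg a a = {a}" by (simp add: seg_def)

lemma seg_path:
  assumes "a \<in> K" "b \<in> K"
  obtains q where "path q" "path_image q = seg a b" "pathstart q = a" "pathfinish q = b"
proof (cases "a = b")
  case True
  then show ?thesis using that[of "\<lambda>_. a"] by (auto simp: pathstart_def pathfinish_def path_image_def path_def)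
next
  case False
  obtain q where "joins q a b" using ex_joins[OF assms False] .
  then show ?thesis using that[of q] seg_eq by (auto simp: joins_def arc_imp_path)
qed

lemma seg_props:
  assumes "a \<in> K" "b \<in> K"
  shows "a \<in> seg a b" "b \<in> seg a b" "seg a b \<subseteq> K" "compact (seg a b)" "connected (seg a b)"
proof -
  obtain q where q: "path q" "path_image q = seg a b" "pathstart q = a" "pathfinish q = b"
    using seg_path[OF assms] .
  show "a \<in> seg a b" "b \<in> seg a b" using q pathstart_in_path_image[of q] pathfinish_in_path_image[of q] by auto
  show "compact (seg a b)" "connected (seg a b)" using q(1) compact_path_image connected_path_image unfolding q(2)[symmetric] by auto
  show "seg a b \<subseteq> K"
  proof (cases "a = b")
    case False
    obtain q where "joins q a b" using ex_joins[OF assms False] .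
    then show ?thesis using seg_eq by (auto simp: joins_def)
  qed (use assms in simp)
qed

text \<open>
  The arcs from \<open>a\<close> to \<open>z\<close> and from \<open>z\<close> to \<open>b\<close>
  form a path, and a path contains the arc between its ends.
\<close>

lemma seg_triangle:
  assumes "a \<in> K" "b \<in> K" "z \<in> K"
  shows "seg a b \<subseteq> seg a z \<union> seg z b"
proof -
  obtain p where p: "path p" "path_image p = seg a z" "pathstart p = a" "pathfinish p = z"
    using seg_path[OF assms(1,3)] .
  obtain q where q: "path q" "path_image q = seg z b" "pathstart q = z" "pathfinish q = b"
    using seg_path[OF assms(3,2)] .
  have img: "path_image (p +++ q) = seg a z \<union> seg z b" using p q by (simp add: path_image_join)
  have "path (p +++ q)" using p q by simp
  moreover have "path_image (p +++ q) \<subseteq> K" unfolding img using seg_props(3) assms by auto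
  ultimately show ?thesis using seg_subset_path[of "p +++ q"] p q img by simp
qed

lemma seg_sym: "a \<in> K \<Longrightarrow> b \<in> K \<Longrightarrow> seg a b = seg b a"
proof (cases "a = b")
  case False
  assume ab: "a \<in> K" "b \<in> K"
  obtain q where q: "joins q a b" using ex_joins[OF ab False] .
  then have "joins (reversepath q) b a" by (simp add: joins_def arc_reversepath)
  then show ?thesis using seg_eq[OF q] seg_eq by simp
qed simp

lemma seg_param:
  assumes "a \<in> K" "b \<in> K" "a \<noteq> b"
  obtains q :: "real \<Rightarrow> 'b" where "continuous_on {0..1} q" "inj_on q {0..1}" "q 0 = a" "q 1 = b" "seg a b = q ` {0..1}"
    "\<And>s t. 0 \<le> s \<Longrightarrow> s \<le> t \<Longrightarrow> t \<le> 1 \<Longrightarrow> seg (q s) (q t) = q ` {s..t}"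
proof -
  obtain q where q: "joins q a b" using ex_joins[OF assms] .
  then have arc: "arc q" "path_image q \<subseteq> K" "q 0 = a" "q 1 = b" by (auto simp: joins_def pathstart_def pathfinish_def)
  have sub: "seg (q s) (q t) = q ` {s..t}" if st: "0 \<le> s" "s \<le> t" "t \<le> 1" for s t :: real
  proof (cases "s = t")
    case False
    then have "arc (subpath s t q)" using arc(1) st by (intro arc_subpath_arc) auto
    moreover have "path_image (subpath s t q) = q ` {s..t}" using st by (simp add: path_image_subpath)
    moreover have "q ` {s..t} \<subseteq> K" using arc(2) st by (auto simp: path_image_def)
    ultimately have "joins (subpath s t q) (q s) (q t)" by (simp add: joins_def)
    then show ?thesis using seg_eq \<open>path_image (subpath s t q) = q ` {s..t}\<close> by simp
  qed simp
  show ?thesis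
    by (rule that[of q]) (use arc sub seg_eq[OF q] in \<open>auto simp: arc_def path_def path_image_def\<close>)
qed

lemma seg_split:
  assumes ab: "a \<in> K" "b \<in> K" and z: "z \<in> seg a b"
  shows "seg a z \<union> seg z b = seg a b" "seg a z \<inter> seg z b = {z}" "z \<in> K"
proof -
  show "z \<in> K" using seg_props(3)[OF ab] z by auto
  have "seg a z \<union> seg z b = seg a b \<and> seg a z \<inter> seg z b = {z}"
  proof (cases "a = b")
    case False
    obtain q :: "real \<Rightarrow> 'b" where q: "continuous_on {0..1} q" "inj_on q {0..1}" "q 0 = a" "q 1 = b" "seg a b = q ` {0..1}"
      "\<And>s t. 0 \<le> s \<Longrightarrow> s \<le> t \<Longrightarrow> t \<le> 1 \<Longrightarrow> seg (q s) (q t) = q ` {s..t}"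
      using seg_param[OF ab False] by metis
    obtain t where t: "t \<in> {0..1}" "z = q t" using z q(5) by auto
    have "0 \<le> t" "t \<le> 1" using t(1) by auto
    then have 1: "seg a z = q ` {0..t}" "seg z b = q ` {t..1}"
      using q(6)[of 0 t] q(6)[of t 1] unfolding q(3,4) t(2) by auto
    have "q ` {0..t} \<inter> q ` {t..1} = q ` ({0..t} \<inter> {t..1})"
      using t by (intro inj_on_image_Int[OF q(2), symmetric]) auto
    also have "{0..t} \<inter> {t..1} = {t}" using t by auto
    finally have "seg a z \<inter> seg z b = {z}" unfolding 1 by (simp add: t(2))
    moreover have "{0..t} \<union> {t..1} = {0..1}" using t by auto
    then have "seg a z \<union> seg z b = seg a b" unfolding 1 q(5) by (simp only: image_Un[symmetric])
    ultimately show ?thesis by blast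
  qed (use z in simp)
  then show "seg a z \<union> seg z b = seg a b" "seg a z \<inter> seg z b = {z}" by auto
qed

definition len :: "'b \<Rightarrow> 'b \<Rightarrow> real" where "len a b = measure H1 (seg a b)"

lemma seg_sets: "a \<in> K \<Longrightarrow> b \<in> K \<Longrightarrow> seg a b \<in> sets H1"
  using seg_props(4) by (intro sets_H1_closed compact_imp_closed)

lemma emeasure_seg_le:
  assumes c: "0 \<le> D" "nonexpanding_on euclidean_metric {0..D} c" "c ` {0..D} \<subseteq> K"
  shows "emeasure H1 (seg (c 0) (c D)) \<le> ennreal D"
proof -
  note p = nonexpanding_path[OF c(2,1)]
  have "seg (c 0) (c D) \<subseteq> c ` {0..D}"
    using seg_subset_path[OF p(1)] p(2) c(3) by (simp add: pathstart_def pathfinish_def)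
  then have "emeasure H1 (seg (c 0) (c D)) \<le> emeasure H1 (c ` {0..D})"
    using c(2) by (intro emeasure_mono sets_nonexpanding_image) auto
  also have "\<dots> \<le> ennreal (D - 0)" using emeasure_nonexpanding_image_le[OF c(2)] .
  finally show ?thesis by simp
qed

lemma emeasure_seg: "a \<in> K \<Longrightarrow> b \<in> K \<Longrightarrow> emeasure H1 (seg a b) = ennreal (len a b)"
proof -
  assume ab: "a \<in> K" "b \<in> K"
  obtain D c where c: "0 \<le> D" "nonexpanding_on euclidean_metric {0..D} c" "c ` {0..D} \<subseteq> K" "c 0 = a" "c D = b"
    using ex_curve[OF ab] by blast
  have "emeasure H1 (seg a b) \<le> ennreal D" using emeasure_seg_le[OF c(1,2,3)] c(4,5) by simp
  then have "emeasure H1 (seg a b) < top" by (rule le_less_trans) simp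
  then show ?thesis unfolding len_def by (intro emeasure_eq_ennreal_measure) auto
qed

lemma len_le:
  assumes c: "0 \<le> D" "nonexpanding_on euclidean_metric {0..D} c" "c ` {0..D} \<subseteq> K"
  shows "len (c 0) (c D) \<le> D"
proof -
  have "c 0 \<in> K" "c D \<in> K" using c by auto
  then show ?thesis using emeasure_seg_le[OF c] c(1) by (simp add: emeasure_seg)
qed

lemma len_nonneg: "0 \<le> len a b" by (simp add: len_def)

lemma len_refl [simp]: "len a a = 0"
  using H1_point[of a] by (simp add: len_def measure_def null_setsD1 del: H1_point)

lemma len_sym: "a \<in> K \<Longrightarrow> b \<in> K \<Longrightarrow> len a b = len b a" using seg_sym by (simp add: len_def)

lemma dist_le_len: "a \<in> K \<Longrightarrow> b \<in> K \<Longrightarrow> dist a b \<le> len a b"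
  using dist_le_H1_connected[OF seg_props(5) compact_imp_closed[OF seg_props(4)] seg_props(1) seg_props(2), of a b]
  by (simp add: emeasure_seg len_nonneg ennreal_le_iff)

lemma len_eq_0: "a \<in> K \<Longrightarrow> b \<in> K \<Longrightarrow> len a b = 0 \<Longrightarrow> a = b"
  using dist_le_len[of a b] by simp

lemma emeasure_Un_common_point:
  fixes A B :: "'b set"
  assumes "A \<in> sets H1" "B \<in> sets H1" "A \<inter> B = {z}"
  shows "emeasure H1 (A \<union> B) = emeasure H1 A + emeasure H1 B"
proof -
  have "emeasure H1 (A \<union> B) = emeasure H1 (A \<union> (B - {z}))"
    using assms(3) by (intro arg_cong[of _ _ "emeasure H1"]) auto
  also have "\<dots> = emeasure H1 A + emeasure H1 (B - {z})"
    using assms(3) by (intro plus_emeasure[symmetric] assms(1) sets.Diff[OF assms(2) sets_H1_closed]) auto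
  also have "emeasure H1 (B - {z}) = emeasure H1 B"
    using assms by (intro emeasure_Diff_null_set H1_point)
  finally show ?thesis .
qed

lemma len_add:
  assumes ab: "a \<in> K" "b \<in> K" and z: "z \<in> seg a b"
  shows "len a b = len a z + len z b"
proof -
  note s = seg_split[OF ab z]
  have "emeasure H1 (seg a b) = emeasure H1 (seg a z) + emeasure H1 (seg z b)"
    unfolding s(1)[symmetric] by (rule emeasure_Un_common_point[OF seg_sets seg_sets s(2)]) (use ab s in auto)
  then have "ennreal (len a b) = ennreal (len a z + len z b)"
    using ab s(3) by (simp add: emeasure_seg len_nonneg)
  then show ?thesis using len_nonneg by (subst (asm) ennreal_inj) (auto intro: add_nonneg_nonneg)
qed

text \<open>
  The distance from \<open>a\<close> along the arc orders its points, since both pieces into which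
  \<open>w\<close> cuts the arc have nonnegative length.
\<close>

lemma seg_unique_len:
  assumes ab: "a \<in> K" "b \<in> K" and zw: "z \<in> seg a b" "w \<in> seg a b" and len: "len a z \<le> len a w"
  shows "z \<in> seg a w" "len a w = len a z + len z w"
proof -
  have K: "z \<in> K" "w \<in> K" using seg_split(3)[OF ab] zw by auto
  have "z \<in> seg a w"
  proof (rule ccontr)
    assume no: "z \<notin> seg a w"
    then have "z \<in> seg w b" using seg_split(1)[OF ab zw(2)] zw(1) by auto
    then have 1: "len w b = len w z + len z b" by (rule len_add[OF K(2) ab(2)])
    have "len a b = len a w + len w b" "len a b = len a z + len z b" using len_add[OF ab zw(2)] len_add[OF ab zw(1)] by auto
    then have "len w z \<le> 0" using 1 len by linarith
    then have "w = z" using len_eq_0[OF K(2,1)] len_nonneg[of w z] by simp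
    then show False using no seg_props(2)[OF ab(1) K(2)] by simp
  qed
  then show "z \<in> seg a w" "len a w = len a z + len z w" using len_add[OF ab(1) K(2)] by auto
qed

text \<open>
  The Hausdorff measure is continuous along increasing sets and the end point is a null set.
\<close>

lemma emeasure_arc_left_limit:
  fixes q :: "real \<Rightarrow> 'b"
  assumes q: "continuous_on {0..1} q" and b: "0 \<le> b" "b \<le> 1" and r: "\<And>s. 0 \<le> s \<Longrightarrow> s < b \<Longrightarrow> emeasure H1 (q ` {0..s}) \<le> r"
  shows "emeasure H1 (q ` {0..b}) \<le> r"
proof (cases "b = 0")
  case True
  then show ?thesis using H1_point[of "q 0"] by (simp add: null_setsD1 del: H1_point)
next
  case False
  define s where "s i = b * (1 - 1 / real (Suc i))" for i
  have s: "0 \<le> s i" "s i < b" for i using b False by (auto simp: s_def field_simps)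
  have sm: "s i \<le> s j" if "i \<le> j" for i j
    unfolding s_def using b that by (intro mult_left_mono diff_left_mono divide_left_mono) auto
  define A where "A i = q ` {0..s i}" for i
  have cl: "closed (A i)" for i unfolding A_def
    using s[of i] b by (intro compact_imp_closed compact_continuous_image continuous_on_subset[OF q]) auto
  have "(\<lambda>i. emeasure H1 (A i)) \<longlonglongrightarrow> emeasure H1 (\<Union>i. A i)"
  proof (rule Lim_emeasure_incseq)
    show "range A \<subseteq> sets H1" using cl sets_H1_closed by auto
    show "incseq A"
    proof (rule incseq_SucI)
      fix i
      show "A i \<subseteq> A (Suc i)" unfolding A_def using sm[of i "Suc i"] by (intro image_mono) auto
    qed
  qed
  then have 1: "emeasure H1 (\<Union>i. A i) \<le> r"
    by (rule LIMSEQ_le_const2) (use r s in \<open>auto simp: A_def\<close>)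
  have U: "q ` {0..b} \<subseteq> (\<Union>i. A i) \<union> {q b}"
  proof
    fix y assume "y \<in> q ` {0..b}"
    then obtain u where u: "0 \<le> u" "u \<le> b" "y = q u" by auto
    show "y \<in> (\<Union>i. A i) \<union> {q b}"
    proof (cases "u = b")
      case F: False
      then have "0 < 1 - u / b" using u b by (simp add: field_simps)
      then obtain i where "1 / real (Suc i) < 1 - u / b" using nat_approx_posE by blast
      then have "u / b \<le> 1 - 1 / real (Suc i)" by simp
      then have "u \<le> s i" using b \<open>b \<noteq> 0\<close> by (simp add: s_def field_simps)
      then have "y \<in> A i" using u by (auto simp: A_def)
      then show ?thesis by blast
    qed (use u in simp)
  qed
  have "emeasure H1 (q ` {0..b}) \<le> emeasure H1 ((\<Union>i. A i) \<union> {q b})"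
    using cl by (intro emeasure_mono U sets.Un sets.countable_UN) (auto intro: sets_H1_closed)
  also have "\<dots> \<le> emeasure H1 (\<Union>i. A i) + emeasure H1 {q b}"
    using cl by (intro emeasure_subadditive sets.countable_UN) (auto intro: sets_H1_closed)
  also have "emeasure H1 {q b} = 0" using H1_point[of "q b"] by (simp add: null_setsD1 del: H1_point)
  finally show ?thesis using 1 by simp
qed

text \<open>
  Take the last parameter up to which the length is at most \<open>r\<close>. Left continuity of the
  length measured from \<open>a\<close> gives one inequality, left continuity of the length measured
  from \<open>b\<close> along the reversed arc gives the other.
\<close>

lemma seg_point_at:
  assumes ab: "a \<in> K" "b \<in> K" and r: "0 \<le> r" "r \<le> len a b"
  obtains z where "z \<in> seg a b" "len a z = r"
proof (cases "a = b")
  case True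
  then show ?thesis using that[of a] r by auto
next
  case False
  obtain q :: "real \<Rightarrow> 'b" where q: "continuous_on {0..1} q" "inj_on q {0..1}" "q 0 = a" "q 1 = b" "seg a b = q ` {0..1}"
      "\<And>s t. 0 \<le> s \<Longrightarrow> s \<le> t \<Longrightarrow> t \<le> 1 \<Longrightarrow> seg (q s) (q t) = q ` {s..t}"
    using seg_param[OF ab False] by metis
  have qK: "q s \<in> K" if "s \<in> {0..1}" for s using that seg_props(3)[OF ab] q(5) by auto
  have em: "emeasure H1 (q ` {0..s}) = ennreal (len a (q s))" if "s \<in> {0..1}" for s
    using emeasure_seg[OF ab(1) qK[OF that]] q(6)[of 0 s] that unfolding q(3) by auto
  define S where "S = {s \<in> {0..1}. len a (q s) \<le> r}"
  have S0: "0 \<in> S" using r q(3) by (simp add: S_def)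
  have bdd: "bdd_above S" by (rule bdd_aboveI[of _ 1]) (auto simp: S_def)
  define s where "s = Sup S"
  have s: "s \<in> {0..1}"
  proof -
    have "S \<noteq> {}" using S0 by blast
    then have "s \<le> 1" unfolding s_def by (rule cSup_least) (simp add: S_def)
    moreover have "0 \<le> s" unfolding s_def by (rule cSup_upper[OF S0 bdd])
    ultimately show ?thesis by simp
  qed
  have mono: "len a (q u) \<le> len a (q v)" if "0 \<le> u" "u \<le> v" "v \<le> 1" for u v
  proof -
    have "q u \<in> seg a (q v)" using q(6)[of 0 v] q(3) that by auto
    then show ?thesis using len_add[OF ab(1) qK[of v]] len_nonneg[of "q u" "q v"] that by auto
  qed
  have "emeasure H1 (q ` {0..s}) \<le> ennreal r"
  proof (rule emeasure_arc_left_limit[OF q(1)])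
    fix u assume u: "0 \<le> u" "u < s"
    have "S \<noteq> {}" using S0 by blast
    from less_cSupD[OF this u(2)[unfolded s_def]] obtain v where v: "v \<in> S" "u < v" by blast
    then have "len a (q u) \<le> r" using mono[of u v] u by (auto simp: S_def)
    then show "emeasure H1 (q ` {0..u}) \<le> ennreal r" using em[of u] u s by (auto intro: ennreal_leI)
  qed (use s in auto)
  then have le: "len a (q s) \<le> r" using em[OF s] r by simp
  have "emeasure H1 ((\<lambda>u. q (1 - u)) ` {0..1 - s}) \<le> ennreal (len a b - r)"
  proof (rule emeasure_arc_left_limit)
    show "continuous_on {0..1} (\<lambda>u. q (1 - u))"
      by (rule continuous_on_compose2[OF q(1)]) (auto intro!: continuous_intros)
    fix u assume u: "0 \<le> u" "u < 1 - s"
    have "(\<lambda>u. q (1 - u)) ` {0..u} = q ` {1 - u..1}" by (rule image_reversed_interval)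
    also have "q ` {1 - u..1} = seg (q (1 - u)) b"
      using q(6)[of "1 - u" 1] u s unfolding q(4) by auto
    finally have img: "(\<lambda>u. q (1 - u)) ` {0..u} = seg (q (1 - u)) b" .
    have "1 - u \<notin> S"
    proof
      assume "1 - u \<in> S"
      then have "1 - u \<le> s" unfolding s_def using bdd by (rule cSup_upper)
      then show False using u by simp
    qed
    then have "r < len a (q (1 - u))" using u s by (auto simp: S_def)
    moreover have "len a b = len a (q (1 - u)) + len (q (1 - u)) b"
      using u s q(5) by (intro len_add ab) auto
    ultimately have "len (q (1 - u)) b \<le> len a b - r" by linarith
    then show "emeasure H1 ((\<lambda>u. q (1 - u)) ` {0..u}) \<le> ennreal (len a b - r)"
      unfolding img using emeasure_seg[OF qK ab(2), of "1 - u"] u s by (auto intro: ennreal_leI)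
  qed (use s in auto)
  moreover have "(\<lambda>u. q (1 - u)) ` {0..1 - s} = seg (q s) b"
  proof -
    have "(\<lambda>u. q (1 - u)) ` {0..1 - s} = q ` {s..1}" using image_reversed_interval[of q "1 - s"] by simp
    also have "q ` {s..1} = seg (q s) b"
      using q(6)[of s 1] s unfolding q(4) by auto
    finally show ?thesis .
  qed
  ultimately have "len (q s) b \<le> len a b - r" using emeasure_seg[OF qK[OF s] ab(2)] r by simp
  moreover have "len a b = len a (q s) + len (q s) b" using s q(5) by (intro len_add ab) auto
  ultimately have "len a (q s) = r" using le by linarith
  then show ?thesis using that[of "q s"] s q(5) by auto
qed

definition arclength :: "'b \<Rightarrow> 'b \<Rightarrow> real \<Rightarrow> 'b" where
  "arclength a b r = (SOME z. z \<in> seg a b \<and> len a z = r)"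

lemma arclength:
  assumes ab: "a \<in> K" "b \<in> K" and r: "r \<in> {0..len a b}"
  shows "arclength a b r \<in> seg a b" "len a (arclength a b r) = r" "arclength a b r \<in> K"
proof -
  have "\<exists>z. z \<in> seg a b \<and> len a z = r" using seg_point_at[OF ab, of r] r by auto
  then have "arclength a b r \<in> seg a b \<and> len a (arclength a b r) = r" unfolding arclength_def by (rule someI_ex)
  then show "arclength a b r \<in> seg a b" "len a (arclength a b r) = r" "arclength a b r \<in> K"
    using seg_props(3)[OF ab] by auto
qed

lemma arclength_eqI:
  assumes ab: "a \<in> K" "b \<in> K" and z: "z \<in> seg a b"
  shows "arclength a b (len a z) = z"
proof -
  have "len a z \<in> {0..len a b}" using len_add[OF ab z] len_nonneg[of z b] len_nonneg[of a z] by auto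
  note l = arclength[OF ab this]
  have "len a z = len a z + len z (arclength a b (len a z))"
    using seg_unique_len(2)[OF ab z l(1)] l(2) by simp
  then show ?thesis using len_eq_0[OF seg_split(3)[OF ab z] l(3)] by simp
qed

lemma nonexpanding_arclength:
  assumes ab: "a \<in> K" "b \<in> K"
  shows "nonexpanding_on euclidean_metric {0..len a b} (arclength a b)"
proof -
  have *: "dist (arclength a b s) (arclength a b t) \<le> t - s" if st: "s \<in> {0..len a b}" "t \<in> {0..len a b}" "s \<le> t" for s t
  proof -
    note s = arclength[OF ab st(1)] and t = arclength[OF ab st(2)]
    have "t = s + len (arclength a b s) (arclength a b t)"
      using seg_unique_len(2)[OF ab s(1) t(1)] s(2) t(2) st(3) by simp
    then show ?thesis using dist_le_len[OF s(3) t(3)] by linarith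
  qed
  show ?thesis unfolding nonexpanding_on_euclidean
  proof (intro ballI)
    fix s t assume st: "s \<in> {0..len a b}" "t \<in> {0..len a b}"
    show "dist (arclength a b s) (arclength a b t) \<le> \<bar>s - t\<bar>"
      using *[OF st] *[OF st(2,1)] by (cases "s \<le> t") (auto simp: dist_commute)
  qed
qed

text \<open>
  The parameter of a point is its distance from \<open>p\<close> along the arc and so does not
  depend on how the arc continues. Arcs that start at \<open>p\<close> therefore agree up to their
  last common point, including parameter and orientation.
\<close>

lemma arclength_coherent:
  assumes K: "p \<in> K" "a \<in> K" "b \<in> K" and st: "s \<in> {0..len p a}" "t \<in> {0..len p b}"
    and eq: "arclength p a s = arclength p b t"
  shows "s = t" "\<And>r. 0 \<le> r \<Longrightarrow> r \<le> s \<Longrightarrow> arclength p a r = arclength p b r"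
proof -
  note s = arclength[OF K(1,2) st(1)] and t = arclength[OF K(1,3) st(2)]
  show "s = t" using s(2) t(2) eq by simp
  fix r assume r: "0 \<le> r" "r \<le> s"
  have ra: "r \<in> {0..len p a}" using r st by auto
  note ra' = arclength[OF K(1,2) ra]
  have "arclength p a r \<in> seg p (arclength p a s)"
    using seg_unique_len(1)[OF K(1,2) ra'(1) s(1)] s(2) ra'(2) r by simp
  also have "\<dots> \<subseteq> seg p b" unfolding eq using seg_split(1)[OF K(1,3) t(1)] by blast
  finally have "arclength p b (len p (arclength p a r)) = arclength p a r" by (rule arclength_eqI[OF K(1,3)])
  then show "arclength p a r = arclength p b r" using ra'(2) by simp
qed

lemma arclength_ends:
  assumes "a \<in> K" "b \<in> K" shows "arclength a b 0 = a" "arclength a b (len a b) = b"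
  using arclength_eqI[OF assms seg_props(1)[OF assms]] arclength_eqI[OF assms seg_props(2)[OF assms]] by auto

text \<open>
  The arc from \<open>a\<close> to \<open>b\<close> is covered by the arcs from \<open>z\<close> to
  \<open>a\<close> and to \<open>b\<close>, so \<open>p\<close> lies on one of these two.
\<close>

lemma midpoint:
  assumes ab: "a \<in> K" "b \<in> K"
  obtains p where "p \<in> K" "len p a = len a b / 2" "len p b = len a b / 2"
    "\<And>z. z \<in> K \<Longrightarrow> len p z = len a z - len a b / 2 \<or> len p z = len b z - len a b / 2"
proof -
  obtain p where p: "p \<in> seg a b" "len a p = len a b / 2"
    using seg_point_at[OF ab, of "len a b / 2"] len_nonneg[of a b] by auto
  have pK: "p \<in> K" using seg_split(3)[OF ab p(1)] .
  have "len a b = len a p + len p b" by (rule len_add[OF ab p(1)])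
  then have pb: "len p b = len a b / 2" using p(2) by simp
  have pa: "len p a = len a b / 2" using p(2) len_sym[OF ab(1) pK] by simp
  have "len p z = len a z - len a b / 2 \<or> len p z = len b z - len a b / 2" if z: "z \<in> K" for z
  proof -
    have "p \<in> seg a z \<or> p \<in> seg z b" using seg_triangle[OF ab z] p(1) by blast
    then show ?thesis
    proof
      assume "p \<in> seg a z"
      then show ?thesis using len_add[OF ab(1) z, of p] p(2) by simp
    next
      assume "p \<in> seg z b"
      then have "p \<in> seg b z" using seg_sym[OF ab(2) z] by simp
      then show ?thesis using len_add[OF ab(2) z, of p] pb len_sym[OF ab(2) pK] by simp
    qed
  qed
  then show ?thesis using that pK pa pb by blast
qed

end

section \<open>Filling a star of arcs\<close>

text \<open>
  An arc without the part covered by other arcs is open, while charts are compact with disjoint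
  images. By Vitali's theorem countably many disjoint compact intervals exhaust an open set up to a
  null set.
\<close>

lemma open_almost_disjoint_intervals:
  fixes U :: "real set"
  assumes U: "open U"
  obtains I :: "nat \<Rightarrow> real set"
  where "\<And>k. compact (I k)" "\<And>k. I k \<subseteq> U" "disjoint_family I" "negligible (U - (\<Union>k. interior (I k)))"
proof -
  define K where "K = {(x, r::real). 0 < r \<and> cball x r \<subseteq> U}"
  have cov: "\<exists>i. i \<in> K \<and> x \<in> cball (fst i) (snd i) \<and> snd i < d" if x: "x \<in> U" "0 < d" for x d
  proof -
    obtain r where r: "r > 0" "cball x r \<subseteq> U" using U x open_contains_cball by blast
    have "cball x (min r (d/2)) \<subseteq> cball x r" by (intro subset_cball) simp
    then have "(x, min r (d/2)) \<in> K" using r x(2) by (auto simp: K_def)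
    moreover have "x \<in> cball x (min r (d/2))" "min r (d/2) < d" using r x(2) by auto
    ultimately show ?thesis by (intro exI[of _ "(x, min r (d/2))"]) auto
  qed
  have pos: "0 < snd i" if "i \<in> K" for i using that by (auto simp: K_def)
  obtain C where C: "countable C" "C \<subseteq> K"
     "pairwise (\<lambda>i j. disjnt (cball (fst i) (snd i)) (cball (fst j) (snd j))) C"
     "negligible (U - (\<Union>i \<in> C. cball (fst i) (snd i)))"
    by (rule Vitali_covering_theorem_cballs[of K snd U fst, OF pos cov])
  define I where "I k = (if k \<in> to_nat_on C ` C then cball (fst (from_nat_into C k)) (snd (from_nat_into C k)) else {})" for k
  have IC: "I (to_nat_on C i) = cball (fst i) (snd i)" if "i \<in> C" for i
    using that C(1) by (simp add: I_def)
  have IE: "I k = {} \<or> (\<exists>i\<in>C. k = to_nat_on C i \<and> I k = cball (fst i) (snd i))" for k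
    using IC by (auto simp: I_def)
  have neg: "negligible (\<Union>i\<in>C. sphere (fst i) (snd i))"
    using C(1) by (auto intro!: negligible_countable_Union negligible_sphere)
  show ?thesis
  proof (rule that[of I])
    show "compact (I k)" for k by (auto simp: I_def)
    show "I k \<subseteq> U" for k
    proof -
      have "cball (fst i) (snd i) \<subseteq> U" if "i \<in> C" for i
        using subsetD[OF C(2) that] unfolding K_def by (cases i) simp
      then show ?thesis using IE[of k] by blast
    qed
    show "disjoint_family I"
      unfolding disjoint_family_on_def
    proof (intro ballI impI)
      fix k l :: nat assume kl: "k \<noteq> l"
      show "I k \<inter> I l = {}"
      proof (cases "I k = {} \<or> I l = {}")
        case False
        then obtain i j where ij: "i \<in> C" "j \<in> C" "k = to_nat_on C i" "l = to_nat_on C j"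
          "I k = cball (fst i) (snd i)" "I l = cball (fst j) (snd j)" using IE by meson
        then have "i \<noteq> j" using kl by auto
        then show ?thesis using C(3) ij unfolding pairwise_def disjnt_def by simp
      qed auto
    qed
    show "negligible (U - (\<Union>k. interior (I k)))"
    proof (rule negligible_subset[OF negligible_Un[OF C(4) neg]], rule subsetI)
      fix x assume x: "x \<in> U - (\<Union>k. interior (I k))"
      show "x \<in> (U - (\<Union>i\<in>C. cball (fst i) (snd i))) \<union> (\<Union>i\<in>C. sphere (fst i) (snd i))"
      proof (cases "x \<in> (\<Union>i\<in>C. cball (fst i) (snd i))")
        case True
        then obtain i where i: "i \<in> C" "x \<in> cball (fst i) (snd i)" by blast
        have "interior (I (to_nat_on C i)) = ball (fst i) (snd i)" unfolding IC[OF i(1)] by (rule interior_cball)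
        moreover have "x \<notin> interior (I (to_nat_on C i))" using x by simp
        ultimately have "x \<notin> ball (fst i) (snd i)" by simp
        then have "x \<in> sphere (fst i) (snd i)" using i(2) by auto
        then show ?thesis using i(1) by blast
      qed (use x in blast)
    qed
  qed
qed

text \<open>
  The difference quotients involve only points close to \<open>u\<close>.
\<close>

lemma transition_deriv_local:
  assumes S: "open S" "u \<in> S" and u: "u \<in> L" "\<gamma> u \<in> chart_image c"
    and eq: "\<And>w. w \<in> S \<Longrightarrow> w \<in> L \<longleftrightarrow> w \<in> L'" "\<And>w. w \<in> S \<Longrightarrow> \<gamma> w = \<gamma>' w"
  shows "transition_deriv c L \<gamma> u r \<longleftrightarrow> transition_deriv c L' \<gamma>' u r"
proof -
  let ?f = "\<lambda>w. inv_into (fst c) (snd c) (\<gamma> w)" and ?g = "\<lambda>w. inv_into (fst c) (snd c) (\<gamma>' w)"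
  let ?A = "{w \<in> L. \<gamma> w \<in> chart_image c}" and ?B = "{w \<in> L'. \<gamma>' w \<in> chart_image c}"
  have at: "at u within ?A = at u within ?B"
    by (rule at_within_nhd[OF S(2,1)]) (use eq in auto)
  obtain d where d: "0 < d" "ball u d \<subseteq> S" using S open_contains_ball by blast
  have u': "u \<in> ?B" using u eq S(2) by auto
  have "w \<in> S" if "dist w u < d" for w using d(2) that by (auto simp: dist_commute)
  then have fg: "?f w = ?g w" if "dist w u < d" for w using eq(2) that by simp
  show ?thesis
    unfolding transition_deriv_def at
  proof
    assume "(?f has_real_derivative r) (at u within ?B)"
    then show "(?g has_real_derivative r) (at u within ?B)"
      by (rule has_field_derivative_transform_within[OF _ d(1) u']) (rule fg)
  next
    assume "(?g has_real_derivative r) (at u within ?B)"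
    then show "(?f has_real_derivative r) (at u within ?B)"
      by (rule has_field_derivative_transform_within[OF _ d(1) u']) (rule fg[symmetric])
  qed
qed

lemma mass_zero_chain:
  fixes Y :: "'y metric"
  assumes N: "normed_ab_group N" shows "mass N Y (\<lambda>c y. 0) = 0"
proof -
  define \<kappa> :: "nat \<Rightarrow> 'y chart" where "\<kappa> i = ({}, \<lambda>_. undefined)" for i
  have im: "chart_image (\<kappa> i) = {}" for i by (simp add: chart_image_def \<kappa>_def)
  have car: "carrier_set \<kappa> = {}" by (simp add: carrier_set_def im)
  have ch: "chart Y (\<kappa> i)" for i
    by (simp add: chart_def \<kappa>_def Lipschitz_continuous_map_def)
  have "oriented_set Y \<kappa>" using ch im by (simp add: oriented_set_def disjoint_family_on_def)
  moreover have m0: "orientation_mass N Y \<kappa> (\<lambda>_. 0) = 0" by (simp add: orientation_mass_def car)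
  ultimately have "group_orientation N Y \<kappa> (\<lambda>_. 0)"
    unfolding group_orientation_def by (auto simp: car intro: exI[of _ "{}"])
  moreover have "chain_eq Y (\<lambda>c y. 0) (oriented_chain \<kappa> (\<lambda>_. 0))"
    by (simp add: chain_eq_def oriented_chain_def im)
  ultimately have "mass N Y (\<lambda>c y. 0) \<le> orientation_mass N Y \<kappa> (\<lambda>_. 0)"
    unfolding mass_def by (intro INF_lower2[of "(\<kappa>, \<lambda>_. 0)"]) auto
  then show ?thesis using m0 by simp
qed

lemma has_boundary_lipschitz_chain:
  fixes Y :: "'y metric" and N :: "'g::ab_group_add \<Rightarrow> real"
  assumes N: "normed_ab_group N" and P: "lipschitz_chain Y P"
  shows "has_boundary N Y (chain_of P) (lipschitz_boundary P)"
proof -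
  have "flat_norm N Y 0 \<le> ennreal (mass0 N (0 - lipschitz_boundary ([] :: ('y, 'g) lipschitz_sum))) + mass N Y (chain_of [])"
    unfolding flat_norm_def by (rule INF_lower2[of "[]"], simp add: lipschitz_chain_def, rule order_refl)
  also have "\<dots> = 0"
    using mass_zero_chain[OF N, of Y] by (simp add: lipschitz_boundary_def mass0_def chain_of_def[abs_def])
  finally have "flat_norm N Y 0 = 0" by simp
  then show ?thesis unfolding has_boundary_def
    using P mass_zero_chain[OF N, of Y] by (intro exI[of _ "\<lambda>_. P"]) simp
qed

text \<open>
  Orient all the arcs away from \<open>p\<close>. At a point that lies on several arcs these have
  the same parameter and the same direction, so the coefficient of the sum is, up to sign, the sum
  of the \<open>g j\<close> over the arcs through the point. The charts follow the first of these
  arcs. The sum of all the \<open>g i\<close> is the boundary at \<open>p\<close>, up to sign, which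
  is why it has to vanish.
\<close>

theorem filling_length_star:
  fixes \<beta> :: "'i::linorder \<Rightarrow> real \<Rightarrow> 't" and N :: "'g::ab_group_add \<Rightarrow> real"
  assumes N: "normed_ab_group N" and J: "finite J"
    and l: "\<And>i. i \<in> J \<Longrightarrow> 0 \<le> l i \<and> l i \<le> 1"
    and ne: "\<And>i. i \<in> J \<Longrightarrow> nonexpanding_on T {0..l i} (\<beta> i)"
    and p: "\<And>i. i \<in> J \<Longrightarrow> \<beta> i 0 = p"
    and coh: "\<And>i j s t. i \<in> J \<Longrightarrow> j \<in> J \<Longrightarrow> s \<in> {0..l i} \<Longrightarrow> t \<in> {0..l j} \<Longrightarrow> \<beta> i s = \<beta> j t \<Longrightarrow>
        s = t \<and> (\<forall>r\<in>{0..s}. \<beta> i r = \<beta> j r)"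
    and g0: "(\<Sum>i\<in>J. g i) = 0"
  shows "filling_length N T (\<Sum>i\<in>J. Poly_Mapping.single (\<beta> i (l i)) (g i)) \<le> ennreal (\<Sum>i\<in>J. N (g i) * l i)"
proof (cases "J = {}")
  case True
  have "lipschitz_chain T []" by (simp add: lipschitz_chain_def)
  from has_boundary_lipschitz_chain[OF N this] have hb: "has_boundary N T (\<lambda>c y. 0) 0"
    by (simp add: chain_of_def[abs_def] lipschitz_boundary_def)
  have "mass N T (\<lambda>c y. 0) < top" using mass_zero_chain[OF N, of T] by simp
  then have "rectifiable_chain N T (\<lambda>c y. 0)"
    unfolding mass_def rectifiable_chain_def by (auto simp: INF_less_iff)
  then have "filling_length N T 0 \<le> mass N T (\<lambda>c y. 0)"
    unfolding filling_length_def using hb by (intro INF_lower) auto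
  then show ?thesis using mass_zero_chain[OF N, of T] True by simp
next
  case Jne: False
  let ?M = "hausdorff_measure T"
  have inj: "s = t" if "i \<in> J" "s \<in> {0..l i}" "t \<in> {0..l i}" "\<beta> i s = \<beta> i t" for i s t
    using coh[OF that(1,1,2,3,4)] by blast
  define A where "A i = \<beta> i ` {0..l i}" for i
  have Ac: "closedin (mtopology_of T) (A i)" if "i \<in> J" for i
    unfolding A_def by (rule closedin_nonexpanding_image[OF ne[OF that]]) simp
  have Am: "A i \<in> sets ?M" if "i \<in> J" for i by (rule sets_hausdorff_closedin[OF Ac[OF that]])
  have AT: "A i \<subseteq> mspace T" if "i \<in> J" for i
    unfolding A_def by (rule nonexpanding_on_image[OF ne[OF that]])
  have Al: "emeasure ?M (A i) \<le> ennreal (l i)" if "i \<in> J" for i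
    using emeasure_nonexpanding_image_le[OF ne[OF that]] by (simp add: A_def)
  \<comment> \<open>the part of the \<open>i\<close>-th arc that is not covered by earlier arcs\<close>
  define U where "U i = {t \<in> {0<..<l i}. \<forall>j\<in>J. j < i \<longrightarrow> \<beta> i t \<notin> A j}" for i
  have Uo: "open (U i)" if i: "i \<in> J" for i
  proof -
    define B where "B = (\<Union>j\<in>{j \<in> J. j < i}. A j)"
    have "closedin (mtopology_of T) B"
      unfolding B_def using J Ac by (intro closedin_Union) auto
    then have "openin (mtopology_of T) (topspace (mtopology_of T) - B)" by (simp add: closedin_def)
    moreover have "nonexpanding_on T {0<..<l i} (\<beta> i)" by (rule nonexpanding_on_subset[OF ne[OF i]]) auto
    ultimately have "openin (top_of_set {0<..<l i}) {t \<in> topspace (top_of_set {0<..<l i}). \<beta> i t \<in> topspace (mtopology_of T) - B}"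
      by (intro openin_continuous_map_preimage[OF continuous_map_nonexpanding])
    then have "open {t \<in> topspace (top_of_set {0<..<l i}). \<beta> i t \<in> topspace (mtopology_of T) - B}"
      by (subst (asm) openin_open_eq) auto
    moreover have "{t \<in> topspace (top_of_set {0<..<l i}). \<beta> i t \<in> topspace (mtopology_of T) - B} = U i"
      using AT[OF i] by (auto simp: U_def B_def A_def)
    ultimately show ?thesis by simp
  qed
  have "\<exists>I :: nat \<Rightarrow> real set. (\<forall>k. compact (I k)) \<and> (\<forall>k. I k \<subseteq> U i) \<and> disjoint_family I
      \<and> negligible (U i - (\<Union>k. interior (I k)))" if "i \<in> J" for i
    by (rule open_almost_disjoint_intervals[OF Uo[OF that]]) blast
  then obtain I0 :: "'i \<Rightarrow> nat \<Rightarrow> real set" where I0: "\<forall>i\<in>J. (\<forall>k. compact (I0 i k)) \<and> (\<forall>k. I0 i k \<subseteq> U i) \<and> disjoint_family (I0 i)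
      \<and> negligible (U i - (\<Union>k. interior (I0 i k)))"
    using bchoice[of J "\<lambda>i I. (\<forall>k. compact (I k)) \<and> (\<forall>k. I k \<subseteq> U i) \<and> disjoint_family I
      \<and> negligible (U i - (\<Union>k. interior (I k)))"] by blast
  define js where "js = sorted_list_of_set J"
  have js: "set js = J" "distinct js" using J by (auto simp: js_def)
  \<comment> \<open>charts: the \<open>k\<close>-th interval of the \<open>m\<close>-th arc, and empty charts for superfluous indices\<close>
  define \<kappa> where "\<kappa> z = (let (m, k) = prod_decode z in
      if m < length js then (I0 (js ! m) k, \<beta> (js ! m)) else ({}, \<lambda>_. undefined))" for z
  have \<kappa>E: "fst (\<kappa> z) = {} \<or> (\<exists>m k. z = prod_encode (m, k) \<and> m < length js \<and> \<kappa> z = (I0 (js ! m) k, \<beta> (js ! m)))" for z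
  proof -
    obtain m k where mk: "prod_decode z = (m, k)" by (cases "prod_decode z")
    then have "z = prod_encode (m, k)" by (metis prod_decode_inverse)
    then show ?thesis unfolding \<kappa>_def mk by auto
  qed
  have jsJ: "js ! m \<in> J" if "m < length js" for m using that js(1) nth_mem by blast
  have II: "compact (I0 i k)" "I0 i k \<subseteq> U i" "I0 i k \<subseteq> {0..l i}" if "i \<in> J" for i k
  proof -
    have "U i \<subseteq> {0..l i}" by (auto simp: U_def)
    then show "compact (I0 i k)" "I0 i k \<subseteq> U i" "I0 i k \<subseteq> {0..l i}" using I0 that by blast+
  qed
  have ch: "chart T (\<kappa> z)" for z
  proof -
    from \<kappa>E[of z] show ?thesis
    proof
      assume "fst (\<kappa> z) = {}"
      then show ?thesis by (simp add: chart_def Lipschitz_continuous_map_def)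
    next
      assume "\<exists>m k. z = prod_encode (m, k) \<and> m < length js \<and> \<kappa> z = (I0 (js ! m) k, \<beta> (js ! m))"
      then obtain m k where mk: "m < length js" "\<kappa> z = (I0 (js ! m) k, \<beta> (js ! m))" by blast
      note i = jsJ[OF mk(1)]
      have "inj_on (\<beta> (js ! m)) (I0 (js ! m) k)" using inj[OF i] II(3)[OF i, of k] by (meson inj_onI subsetD)
      then show ?thesis
        using II(1)[OF i] nonexpanding_on_Lipschitz[OF nonexpanding_on_subset[OF ne[OF i] II(3)[OF i]]]
        by (simp add: chart_def mk(2))
    qed
  qed
  have disj_arc: "\<beta> i s \<noteq> \<beta> j t" if ij: "i \<in> J" "j \<in> J" "i \<noteq> j" "s \<in> U i" "t \<in> U j" for i j s t
  proof -
    have "\<beta> i s \<in> A i" "\<beta> j t \<in> A j" using ij(4,5) by (auto simp: A_def U_def)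
    then show ?thesis using ij by (cases "i < j") (auto simp: U_def)
  qed
  have disj: "disjoint_family (\<lambda>z. chart_image (\<kappa> z))"
    unfolding disjoint_family_on_def
  proof (intro ballI impI)
    fix z z' :: nat assume zz: "z \<noteq> z'"
    show "chart_image (\<kappa> z) \<inter> chart_image (\<kappa> z') = {}"
    proof (cases "fst (\<kappa> z) = {} \<or> fst (\<kappa> z') = {}")
      case False
      then obtain m k m' k' where mk: "z = prod_encode (m, k)" "m < length js" "\<kappa> z = (I0 (js ! m) k, \<beta> (js ! m))"
        "z' = prod_encode (m', k')" "m' < length js" "\<kappa> z' = (I0 (js ! m') k', \<beta> (js ! m'))" using \<kappa>E by meson
      have mk': "(m, k) \<noteq> (m', k')" using zz mk by auto
      show ?thesis
      proof (rule ccontr)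
        assume "\<not> ?thesis"
        then obtain y where y: "y \<in> chart_image (\<kappa> z)" "y \<in> chart_image (\<kappa> z')" by blast
        obtain s where s: "s \<in> I0 (js ! m) k" "y = \<beta> (js ! m) s"
          using y(1) unfolding chart_image_def mk(3) by auto
        obtain t where t: "t \<in> I0 (js ! m') k'" "y = \<beta> (js ! m') t"
          using y(2) unfolding chart_image_def mk(6) by auto
        have st: "s \<in> I0 (js ! m) k" "t \<in> I0 (js ! m') k'" "\<beta> (js ! m) s = \<beta> (js ! m') t"
          using s t by auto
        have sU: "s \<in> U (js ! m)" "t \<in> U (js ! m')"
          using st(1,2) II(2)[OF jsJ[OF mk(2)]] II(2)[OF jsJ[OF mk(5)]] by blast+
        have eq: "js ! m = js ! m'" using disj_arc[OF jsJ[OF mk(2)] jsJ[OF mk(5)] _ sU] st(3) by blast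
        then have "m = m'" using js(2) mk by (simp add: nth_eq_iff_index_eq)
        then have "k \<noteq> k'" using mk' by simp
        have "s \<in> {0..l (js ! m)}" "t \<in> {0..l (js ! m)}"
          using st(1) st(2)[folded eq] II(3)[OF jsJ[OF mk(2)]] by blast+
        then have "s = t" using st(3)[folded eq] by (rule inj[OF jsJ[OF mk(2)]])
        then have "s \<in> I0 (js ! m) k \<inter> I0 (js ! m) k'" using st(1) st(2)[folded eq] by simp
        moreover have "disjoint_family (I0 (js ! m))" using I0 jsJ[OF mk(2)] by blast
        ultimately show False using \<open>k \<noteq> k'\<close> by (auto simp: disjoint_family_on_def)
      qed
    qed (auto simp: chart_image_def)
  qed
  have ori: "oriented_set T \<kappa>" using ch disj by (simp add: oriented_set_def)
  define G where "G y = (\<Sum>j\<in>{j \<in> J. y \<in> A j}. g j)" for y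
  have chm: "chart_image (\<kappa> z) \<in> sets ?M" for z
  proof (cases "fst (\<kappa> z) = {}")
    case False
    then obtain m k where mk: "m < length js" "\<kappa> z = (I0 (js ! m) k, \<beta> (js ! m))" using \<kappa>E by meson
    note i = jsJ[OF mk(1)]
    show ?thesis unfolding chart_image_def mk(2) fst_conv snd_conv
      by (rule sets_nonexpanding_image[OF nonexpanding_on_subset[OF ne[OF i] II(3)[OF i]] II(1)[OF i]])
  qed (simp add: chart_image_def)
  have carm: "carrier_set \<kappa> \<in> sets ?M" unfolding carrier_set_def using chm by auto
  have pat: "{y \<in> carrier_set \<kappa>. {j \<in> J. y \<in> A j} = B} \<in> sets ?M" if B: "B \<subseteq> J" for B
  proof -
    have "{y \<in> carrier_set \<kappa>. {j \<in> J. y \<in> A j} = B}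
        = carrier_set \<kappa> \<inter> (\<Inter>j\<in>J. if j \<in> B then A j else space ?M - A j)"
    proof (rule set_eqI)
      fix y
      show "y \<in> {y \<in> carrier_set \<kappa>. {j \<in> J. y \<in> A j} = B}
        \<longleftrightarrow> y \<in> carrier_set \<kappa> \<inter> (\<Inter>j\<in>J. if j \<in> B then A j else space ?M - A j)"
      proof (cases "y \<in> carrier_set \<kappa>")
        case True
        then have "y \<in> space ?M" using sets.sets_into_space[OF carm] by blast
        then have iff: "y \<in> (if j \<in> B then A j else space ?M - A j) \<longleftrightarrow> (j \<in> B \<longleftrightarrow> y \<in> A j)" for j by simp
        have "{j \<in> J. y \<in> A j} = B \<longleftrightarrow> (\<forall>j\<in>J. j \<in> B \<longleftrightarrow> y \<in> A j)" using B by blast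
        then show ?thesis using True unfolding Int_iff INT_iff mem_Collect_eq iff by blast
      qed blast
    qed
    moreover have "(\<Inter>j\<in>J. if j \<in> B then A j else space ?M - A j) \<in> sets ?M"
    proof (rule sets.finite_INT[OF J Jne])
      fix j assume "j \<in> J"
      from sets.compl_sets[OF Am[OF this]] Am[OF this]
      show "(if j \<in> B then A j else space ?M - A j) \<in> sets ?M"
        by (cases "j \<in> B") (simp_all del: space_hausdorff_measure)
    qed
    ultimately show ?thesis using carm by auto
  qed
  have Gm: "{y \<in> carrier_set \<kappa>. N (G y - h) < e} \<in> sets ?M" for h e
  proof -
    have "{y \<in> carrier_set \<kappa>. N (G y - h) < e}
        = (\<Union>B\<in>{B \<in> Pow J. N ((\<Sum>j\<in>B. g j) - h) < e}. {y \<in> carrier_set \<kappa>. {j \<in> J. y \<in> A j} = B})"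
      by (auto simp: G_def)
    also have "\<dots> \<in> sets ?M" using J pat by (intro sets.finite_UN) auto
    finally show ?thesis .
  qed
  have NG: "N (G y) \<le> (\<Sum>j\<in>J. N (g j) * indicator (A j) y)" for y
  proof -
    have "N (G y) \<le> (\<Sum>j\<in>{j \<in> J. y \<in> A j}. N (g j))" unfolding G_def by (rule norm_sum_le[OF N])
    also have "\<dots> = (\<Sum>j\<in>J. if y \<in> A j then N (g j) else 0)" using J by (rule sum.inter_filter)
    also have "\<dots> = (\<Sum>j\<in>J. N (g j) * indicator (A j) y)" by (intro sum.cong) auto
    finally show ?thesis .
  qed
  have mass_le: "orientation_mass N T \<kappa> G \<le> ennreal (\<Sum>i\<in>J. N (g i) * l i)"
  proof -
    have "orientation_mass N T \<kappa> G \<le> (\<integral>\<^sup>+y. (\<Sum>j\<in>J. ennreal (N (g j)) * indicator (A j) y) \<partial>?M)"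
      unfolding orientation_mass_def
    proof (rule nn_integral_mono)
      fix y
      have "ennreal (N (G y)) * indicator (carrier_set \<kappa>) y \<le> ennreal (N (G y))"
        by (auto simp: indicator_def)
      also have "\<dots> \<le> ennreal (\<Sum>j\<in>J. N (g j) * indicator (A j) y)" using NG by (rule ennreal_leI)
      also have "\<dots> = (\<Sum>j\<in>J. ennreal (N (g j) * indicator (A j) y))"
        using normed_ab_groupD(1)[OF N] by (intro sum_ennreal[symmetric]) auto
      also have "\<dots> = (\<Sum>j\<in>J. ennreal (N (g j)) * indicator (A j) y)" by (intro sum.cong) (auto simp: indicator_def)
      finally show "ennreal (N (G y)) * indicator (carrier_set \<kappa>) y \<le> (\<Sum>j\<in>J. ennreal (N (g j)) * indicator (A j) y)" .
    qed
    also have "\<dots> = (\<Sum>j\<in>J. (\<integral>\<^sup>+y. ennreal (N (g j)) * indicator (A j) y \<partial>?M))"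
      using Am by (intro nn_integral_sum) auto
    also have "\<dots> = (\<Sum>j\<in>J. ennreal (N (g j)) * emeasure ?M (A j))"
      using Am by (intro sum.cong nn_integral_cmult_indicator) auto
    also have "\<dots> \<le> (\<Sum>j\<in>J. ennreal (N (g j)) * ennreal (l j))"
      using Al by (intro sum_mono mult_left_mono) auto
    also have "\<dots> = (\<Sum>j\<in>J. ennreal (N (g j) * l j))"
      using l normed_ab_groupD(1)[OF N] by (intro sum.cong) (auto simp: ennreal_mult)
    also have "\<dots> = ennreal (\<Sum>j\<in>J. N (g j) * l j)"
      using l normed_ab_groupD(1)[OF N] by (intro sum_ennreal) auto
    finally show ?thesis .
  qed
  have go: "group_orientation N T \<kappa> G"
    unfolding group_orientation_def
  proof (intro conjI allI ori Gm)
    show "\<exists>D. countable D \<and> (\<forall>y\<in>carrier_set \<kappa>. \<forall>e>0. \<exists>h\<in>D. N (G y - h) < e)"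
    proof (intro exI[of _ "(\<lambda>B. \<Sum>j\<in>B. g j) ` Pow J"] conjI ballI allI impI)
      show "countable ((\<lambda>B. \<Sum>j\<in>B. g j) ` Pow J)" using J by (intro countable_finite) auto
      fix y and e :: real assume "0 < e"
      then have "N (G y - G y) < e" using normed_ab_groupD(4)[OF N] by simp
      moreover have "G y \<in> (\<lambda>B. \<Sum>j\<in>B. g j) ` Pow J" unfolding G_def by (intro imageI) auto
      ultimately show "\<exists>h\<in>(\<lambda>B. \<Sum>j\<in>B. g j) ` Pow J. N (G y - h) < e" by (rule bexI)
    qed
    show "orientation_mass N T \<kappa> G < \<infinity>" using mass_le by (rule le_less_trans) simp
  qed
  \<comment> \<open>the arcs are prolonged by constants to the unit interval; only their end points get more preimages\<close>
  define \<gamma> where "\<gamma> i u = \<beta> i (min u (l i))" for i u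
  have \<gamma>ne: "nonexpanding_on T {0..1} (\<gamma> i)" if i: "i \<in> J" for i
    unfolding nonexpanding_on_def
  proof (intro conjI ballI Pi_I)
    have mm: "min u (l i) \<in> {0..l i}" if "u \<in> {0..1}" for u using that l[OF i] by auto
    show "\<gamma> i u \<in> mspace T" if "u \<in> {0..1}" for u
      using ne[OF i] mm[OF that] unfolding \<gamma>_def nonexpanding_on_def by blast
    fix u w :: real assume uw: "u \<in> {0..1}" "w \<in> {0..1}"
    have "mdist T (\<gamma> i u) (\<gamma> i w) \<le> \<bar>min u (l i) - min w (l i)\<bar>"
      using ne[OF i] mm[OF uw(1)] mm[OF uw(2)] unfolding \<gamma>_def nonexpanding_on_def by blast
    also have "\<dots> \<le> \<bar>u - w\<bar>" by linarith
    finally show "mdist T (\<gamma> i u) (\<gamma> i w) \<le> \<bar>u - w\<bar>" .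
  qed
  define P where "P = map (\<lambda>j. (g j, \<gamma> j)) js"
  have LP: "lipschitz_chain T P"
    using nonexpanding_on_Lipschitz[OF \<gamma>ne] js(1) by (auto simp: lipschitz_chain_def P_def lipschitz_path_def)
  have bd: "lipschitz_boundary P = (\<Sum>i\<in>J. Poly_Mapping.single (\<beta> i (l i)) (g i))"
  proof -
    have "lipschitz_boundary P = (\<Sum>j\<leftarrow>js. Poly_Mapping.single (\<gamma> j 1) (g j) - Poly_Mapping.single (\<gamma> j 0) (g j))"
      by (simp add: lipschitz_boundary_def P_def o_def)
    also have "\<dots> = (\<Sum>j\<in>J. Poly_Mapping.single (\<gamma> j 1) (g j) - Poly_Mapping.single (\<gamma> j 0) (g j))"
      using js by (simp add: sum_list_distinct_conv_sum_set)
    also have "\<dots> = (\<Sum>j\<in>J. Poly_Mapping.single (\<beta> j (l j)) (g j) - Poly_Mapping.single p (g j))"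
      using l p by (intro sum.cong) (auto simp: \<gamma>_def)
    also have "\<dots> = (\<Sum>j\<in>J. Poly_Mapping.single (\<beta> j (l j)) (g j)) - (\<Sum>j\<in>J. Poly_Mapping.single p (g j))"
      by (rule sum_subtractf)
    also have "(\<Sum>j\<in>J. Poly_Mapping.single p (g j)) = Poly_Mapping.single p (\<Sum>j\<in>J. g j)"
      using J by (induction J rule: finite_induct) (auto simp: single_add)
    also have "\<dots> = 0" by (simp add: g0)
    finally show ?thesis by simp
  qed
  have cP: "chain_of P c y = (\<Sum>j\<in>J. push_forward {0..1} (\<gamma> j) (\<lambda>_. g j) c y)" for c y
    using js by (simp add: chain_of_def P_def o_def sum_list_distinct_conv_sum_set)
  \<comment> \<open>the exceptional null set: end points, branch points, and what the charts miss\<close>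
  define br where "br i j = {u. u \<in> {0..l i} \<and> u \<le> l j \<and> \<beta> i u = \<beta> j u \<and> (\<forall>w. w \<in> {0..l i} \<and> w \<le> l j \<and> \<beta> i w = \<beta> j w \<longrightarrow> w \<le> u)}" for i j
  have brn: "negligible (br i j)" for i j
  proof -
    have "u = w" if "u \<in> br i j" "w \<in> br i j" for u w using that by (auto simp: br_def intro: antisym)
    then have "br i j \<subseteq> {SOME u. u \<in> br i j}" by (metis singletonI someI subsetI)
    then show ?thesis by (rule negligible_subset[rotated]) simp
  qed
  define Zs where "Zs i = {0, l i} \<union> (\<Union>j\<in>J. br i j) \<union> (U i - (\<Union>k. interior (I0 i k)))" for i
  have "\<exists>E. E \<in> null_sets ?M \<and> \<beta> i ` Zs i \<subseteq> E" if i: "i \<in> J" for i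
  proof -
    have b: "negligible (\<Union>j\<in>J. br i j)" using J brn by (intro negligible_Union) auto
    have c: "negligible (U i - (\<Union>k. interior (I0 i k)))" using I0 i by blast
    have "negligible {0, l i}" by simp
    from negligible_Un[OF negligible_Un[OF this b] c] have "negligible (Zs i)" unfolding Zs_def .
    moreover have "Zs i \<subseteq> {0..l i}" using l[OF i] by (auto simp: Zs_def br_def U_def)
    ultimately show ?thesis by (rule null_set_nonexpanding_image[OF ne[OF i]]) blast
  qed
  then obtain E where E: "\<forall>i\<in>J. E i \<in> null_sets ?M \<and> \<beta> i ` Zs i \<subseteq> E i"
    using bchoice[of J "\<lambda>i E. E \<in> null_sets ?M \<and> \<beta> i ` Zs i \<subseteq> E"] by blast
  have EN: "(\<Union>i\<in>J. E i) \<in> null_sets ?M" using E J by (intro null_sets.finite_UN) auto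
  have main: "chain_of P c y = oriented_chain \<kappa> G c y"
    if y: "y \<notin> (\<Union>i\<in>J. E i)" "y \<in> chart_image c" for c y
  proof (cases "\<exists>j\<in>J. y \<in> A j")
    case False
    have "push_forward {0..1} (\<gamma> j) (\<lambda>_. g j) c y = 0" if "j \<in> J" for j
    proof -
      have none: "{s \<in> {0..1}. \<gamma> j s = y} = {}"
        using False l[OF that] that by (auto simp: \<gamma>_def A_def)
      show ?thesis unfolding push_forward_def none by (rule sum.empty)
    qed
    then have "chain_of P c y = 0" unfolding cP by (intro sum.neutral ballI)
    moreover have "{z. y \<in> chart_image (\<kappa> z)} = {}"
    proof (rule ccontr)
      assume "{z. y \<in> chart_image (\<kappa> z)} \<noteq> {}"
      then obtain z where z: "y \<in> chart_image (\<kappa> z)" by blast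
      then have "fst (\<kappa> z) \<noteq> {}" by (auto simp: chart_image_def)
      then obtain m k where mk: "m < length js" "\<kappa> z = (I0 (js ! m) k, \<beta> (js ! m))" using \<kappa>E by meson
      then have "y \<in> A (js ! m)" using z II(3)[OF jsJ[OF mk(1)], of k] by (auto simp: chart_image_def A_def)
      then show False using False jsJ[OF mk(1)] by blast
    qed
    then have "oriented_chain \<kappa> G c y = 0" unfolding oriented_chain_def by (simp only: sum.empty)
    ultimately show ?thesis by simp
  next
    case True
    define i where "i = Min {j \<in> J. y \<in> A j}"
    have "i \<in> {j \<in> J. y \<in> A j}" unfolding i_def using True J by (intro Min_in) auto
    then have i: "i \<in> J" "y \<in> A i" by auto
    have imin: "y \<notin> A j" if "j \<in> J" "j < i" for j
    proof
      assume "y \<in> A j"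
      then have "i \<le> j" unfolding i_def using J that(1) by (intro Min_le) auto
      then show False using that(2) by simp
    qed
    obtain u where u: "u \<in> {0..l i}" "y = \<beta> i u" using i(2) by (auto simp: A_def)
    have uZ: "u \<notin> Zs i"
    proof
      assume "u \<in> Zs i"
      then have "y \<in> E i" using E i(1) u(2) by blast
      then show False using y(1) i(1) by blast
    qed
    have uU: "u \<in> U i" using uZ u imin by (auto simp: U_def Zs_def)
    then obtain k where k: "u \<in> interior (I0 i k)" using uZ by (auto simp: Zs_def)
    obtain m where m: "m < length js" "js ! m = i" using i(1) js(1) by (metis in_set_conv_nth)
    define z where "z = prod_encode (m, k)"
    have kz: "\<kappa> z = (I0 i k, \<beta> i)" using m by (simp add: \<kappa>_def z_def)
    have uI: "u \<in> I0 i k" using k interior_subset by blast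
    have "y \<in> chart_image (\<kappa> z)" using uI u(2) by (auto simp: kz chart_image_def)
    then have one: "{z. y \<in> chart_image (\<kappa> z)} = {z}"
      using disj unfolding disjoint_family_on_def by blast
    have pre: "{s \<in> I0 i k. \<beta> i s = y} = {u}"
      using uI u inj[OF i(1)] II(3)[OF i(1), of k] by blast
    have rhs: "oriented_chain \<kappa> G c y = (if \<exists>r>0. transition_deriv c (I0 i k) (\<beta> i) u r then G y
        else if \<exists>r<0. transition_deriv c (I0 i k) (\<beta> i) u r then - G y else 0)"
    proof -
      have "oriented_chain \<kappa> G c y = push_forward (I0 i k) (\<beta> i) (\<lambda>s. G (\<beta> i s)) c y"
        unfolding oriented_chain_def one by (simp add: kz)
      also have "\<dots> = (if \<exists>r>0. transition_deriv c (I0 i k) (\<beta> i) u r then G (\<beta> i u)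
        else if \<exists>r<0. transition_deriv c (I0 i k) (\<beta> i) u r then - G (\<beta> i u) else 0)"
        unfolding push_forward_def pre by simp
      finally show ?thesis unfolding u(2)[symmetric] .
    qed
    have contrib: "push_forward {0..1} (\<gamma> j) (\<lambda>_. g j) c y =
       (if y \<in> A j then (if \<exists>r>0. transition_deriv c (I0 i k) (\<beta> i) u r then g j
        else if \<exists>r<0. transition_deriv c (I0 i k) (\<beta> i) u r then - g j else 0) else 0)" if j: "j \<in> J" for j
    proof (cases "y \<in> A j")
      case False
      then have none: "{s \<in> {0..1}. \<gamma> j s = y} = {}" using l[OF j] by (auto simp: \<gamma>_def A_def)
      show ?thesis using False unfolding push_forward_def none by (simp only: sum.empty if_False)
    next
      case yA: True
      then obtain t where t: "t \<in> {0..l j}" "y = \<beta> j t" by (auto simp: A_def)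
      have "\<beta> i u = \<beta> j t" unfolding u(2)[symmetric] by (rule t(2))
      then have ut: "u = t" using coh[OF i(1) j u(1) t(1)] by blast
      have uj: "u \<in> {0..l j}" "y = \<beta> j u" using t unfolding ut by blast+
      have "u \<notin> br i j" using uZ j by (auto simp: Zs_def)
      then obtain w where w: "w \<in> {0..l i}" "w \<le> l j" "\<beta> i w = \<beta> j w" "u < w"
      proof -
        have "\<beta> i u = \<beta> j u" unfolding u(2)[symmetric] by (rule uj(2))
        moreover have "u \<le> l j" using uj(1) by simp
        ultimately have "\<not> (\<forall>w. w \<in> {0..l i} \<and> w \<le> l j \<and> \<beta> i w = \<beta> j w \<longrightarrow> w \<le> u)"
          using \<open>u \<notin> br i j\<close> u(1) unfolding br_def by blast
        then obtain w where "w \<in> {0..l i} \<and> w \<le> l j \<and> \<beta> i w = \<beta> j w" "\<not> w \<le> u" by blast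
        then show thesis by (intro that[of w]) auto
      qed
      have "w \<in> {0..l j}" using w(1,2) by simp
      from coh[OF i(1) j w(1) this w(3)] have agree: "\<beta> i r = \<beta> j r" if "r \<in> {0..w}" for r
        using that by blast
      have pre': "{s \<in> {0..1}. \<gamma> j s = y} = {u}"
      proof (intro set_eqI iffI)
        fix s assume "s \<in> {s \<in> {0..1}. \<gamma> j s = y}"
        then have s: "s \<in> {0..1}" "\<beta> j (min s (l j)) = \<beta> j u" using uj by (auto simp: \<gamma>_def)
        have "min s (l j) = u" by (rule inj[OF j _ uj(1) s(2)]) (use s(1) l[OF j] in auto)
        then show "s \<in> {u}" using w(2,4) by (auto simp: min_def split: if_splits)
      next
        fix s assume "s \<in> {u}"
        then show "s \<in> {s \<in> {0..1}. \<gamma> j s = y}" using u uj w l[OF i(1)] by (auto simp: \<gamma>_def)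
      qed
      have td: "transition_deriv c (I0 i k) (\<beta> i) u r \<longleftrightarrow> transition_deriv c {0..1} (\<gamma> j) u r" for r
      proof (rule transition_deriv_local)
        show "open (interior (I0 i k) \<inter> {0<..<w})" by auto
        have "0 < u" using uU by (auto simp: U_def)
        then show "u \<in> interior (I0 i k) \<inter> {0<..<w}" using k w by auto
        show "u \<in> I0 i k" by (rule uI)
        show "\<beta> i u \<in> chart_image c" using y(2) u(2) by simp
        fix v assume v: "v \<in> interior (I0 i k) \<inter> {0<..<w}"
        then show "v \<in> I0 i k \<longleftrightarrow> v \<in> {0..1}" using w(1) l[OF i(1)] interior_subset[of "I0 i k"] by auto
        show "\<beta> i v = \<gamma> j v" using agree[of v] v w(2) by (auto simp: \<gamma>_def min_def)
      qed
      show ?thesis unfolding push_forward_def pre' td using yA by simp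
    qed
    have "chain_of P c y = (\<Sum>j\<in>J. if y \<in> A j then (if \<exists>r>0. transition_deriv c (I0 i k) (\<beta> i) u r then g j
        else if \<exists>r<0. transition_deriv c (I0 i k) (\<beta> i) u r then - g j else 0) else 0)"
      unfolding cP using contrib by (intro sum.cong) auto
    also have "\<dots> = (\<Sum>j\<in>{j \<in> J. y \<in> A j}. if \<exists>r>0. transition_deriv c (I0 i k) (\<beta> i) u r then g j
        else if \<exists>r<0. transition_deriv c (I0 i k) (\<beta> i) u r then - g j else 0)"
      using J by (rule sum.inter_filter[symmetric])
    also have "\<dots> = oriented_chain \<kappa> G c y"
    proof -
      have "(\<Sum>j\<in>S. if a then g j else if b then - g j else 0)
          = (if a then sum g S else if b then - sum g S else 0)" for a b S
        by (cases a; cases b) (simp_all add: sum_negf)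
      then show ?thesis unfolding rhs G_def .
    qed
    finally show ?thesis .
  qed
  have ce: "chain_eq T (chain_of P) (oriented_chain \<kappa> G)"
    unfolding chain_eq_def
  proof (intro allI impI)
    fix c
    have "AE y in ?M. y \<notin> (\<Union>i\<in>J. E i)" using EN by (rule AE_not_in)
    then show "AE y in ?M. y \<in> chart_image c \<longrightarrow> chain_of P c y = oriented_chain \<kappa> G c y"
      by (rule eventually_mono) (use main in blast)
  qed
  have "filling_length N T (lipschitz_boundary P) \<le> mass N T (chain_of P)"
    unfolding filling_length_def
  proof (rule INF_lower, intro CollectI conjI)
    show "rectifiable_chain N T (chain_of P)" unfolding rectifiable_chain_def using go ce by blast
    show "has_boundary N T (chain_of P) (lipschitz_boundary P)" by (rule has_boundary_lipschitz_chain[OF N LP])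
  qed
  also have "\<dots> \<le> orientation_mass N T \<kappa> G"
    unfolding mass_def using go ce by (intro INF_lower2[of "(\<kappa>, G)"]) auto
  also have "\<dots> \<le> ennreal (\<Sum>i\<in>J. N (g i) * l i)" by (rule mass_le)
  finally show ?thesis unfolding bd .
qed

section \<open>Images of the circle in trees\<close>

lemma mdist_refl: "x \<in> mspace m \<Longrightarrow> mdist m x x = 0"
  by simp

lemma continuous_map_isometric:
  fixes K :: "'b::metric_space set"
  assumes "h \<in> K \<rightarrow> mspace T" "\<And>a b. a \<in> K \<Longrightarrow> b \<in> K \<Longrightarrow> mdist T (h a) (h b) = dist a b"
  shows "continuous_map (top_of_set K) (mtopology_of T) h"
proof -
  have "Lipschitz_continuous_map (submetric euclidean_metric K) T h"
    unfolding Lipschitz_continuous_map_def using assms by (auto intro!: exI[of _ 1])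
  from Lipschitz_continuous_imp_continuous_map[OF this]
  show ?thesis by (simp add: mtopology_of_submetric mtopology_of_euclidean)
qed

text \<open>
  An isometry maps arcs to arcs, so uniqueness of arcs is inherited from \<open>T\<close>.
\<close>

lemma unique_arc_set_isometric_image:
  fixes K :: "'b::{complete_space, real_normed_vector} set"
  assumes T: "tree T" and h: "h \<in> K \<rightarrow> mspace T" "\<And>a b. a \<in> K \<Longrightarrow> b \<in> K \<Longrightarrow> mdist T (h a) (h b) = dist a b"
    and curve: "\<And>a b. a \<in> K \<Longrightarrow> b \<in> K \<Longrightarrow>
      \<exists>D c. 0 \<le> D \<and> nonexpanding_on euclidean_metric {0..D} c \<and> c ` {0..D} \<subseteq> K \<and> c 0 = a \<and> c D = b"
  shows "unique_arc_set K"
proof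
  show "\<exists>D c. 0 \<le> D \<and> nonexpanding_on euclidean_metric {0..D} c \<and> c ` {0..D} \<subseteq> K \<and> c 0 = a \<and> c D = b"
    if "a \<in> K" "b \<in> K" for a b by (rule curve[OF that])
  fix p q :: "real \<Rightarrow> 'b"
  assume pq: "arc p" "arc q" "path_image p \<subseteq> K" "path_image q \<subseteq> K"
    "pathstart p = pathstart q" "pathfinish p = pathfinish q"
  have inj: "inj_on h K"
  proof (rule inj_onI)
    fix a b assume ab: "a \<in> K" "b \<in> K" "h a = h b"
    then have "h b \<in> mspace T" using h(1) by blast
    then have "mdist T (h a) (h b) = 0" unfolding ab(3) by (rule mdist_refl)
    then show "a = b" using h(2)[OF ab(1,2)] by simp
  qed
  have arcT: "arc_between (mtopology_of T) (h (pathstart r)) (h (pathfinish r)) (h ` path_image r)"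
    if r: "arc r" "path_image r \<subseteq> K" for r
  proof -
    have "continuous_map (top_of_set {0..1}) (top_of_set K) r"
      using r by (auto simp: arc_def path_def path_image_def continuous_map_in_subtopology)
    then have "pathin (mtopology_of T) (h \<circ> r)"
      unfolding pathin_def by (rule continuous_map_compose[OF _ continuous_map_isometric[OF h]])
    moreover have "inj_on (h \<circ> r) {0..1}"
      using r inj by (intro comp_inj_on) (auto simp: arc_def path_image_def intro: inj_on_subset)
    ultimately show ?thesis
      unfolding arc_between_def by (intro exI[of _ "h \<circ> r"]) (auto simp: pathstart_def pathfinish_def path_image_def)
  qed
  have "pathstart p \<in> K" "pathfinish p \<in> K" using pq(3) by auto
  moreover have "pathstart p \<noteq> pathfinish p" using pq(1) arc_distinct_ends by metis
  ultimately have ne: "h (pathstart p) \<noteq> h (pathfinish p)" using inj by (auto simp: inj_on_def)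
  have "h (pathstart p) \<in> mspace T" "h (pathfinish p) \<in> mspace T" using pq(3) h(1) by auto
  then have "\<exists>!A. arc_between (mtopology_of T) (h (pathstart p)) (h (pathfinish p)) A"
    using T ne unfolding tree_def by blast
  moreover have "arc_between (mtopology_of T) (h (pathstart p)) (h (pathfinish p)) (h ` path_image q)"
    using arcT[OF pq(2,4)] pq(5,6) by simp
  ultimately have "h ` path_image p = h ` path_image q" using arcT[OF pq(1,3)] by blast
  then show "path_image p = path_image q" using inj pq(3,4) by (simp add: inj_on_image_eq_iff)
qed

context unique_arc_set
begin

lemma filling_length_from_center:
  fixes N :: "'g::ab_group_add \<Rightarrow> real" and y :: "'i::linorder \<Rightarrow> 'b"
  assumes N: "normed_ab_group N" and J: "finite J"
    and h: "h \<in> K \<rightarrow> mspace T" "\<And>a b. a \<in> K \<Longrightarrow> b \<in> K \<Longrightarrow> mdist T (h a) (h b) = dist a b"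
    and p: "p \<in> K" and y: "\<And>i. i \<in> J \<Longrightarrow> y i \<in> K \<and> len p (y i) \<le> 1" and g0: "(\<Sum>i\<in>J. g i) = 0"
  shows "filling_length N T (\<Sum>i\<in>J. Poly_Mapping.single (h (y i)) (g i)) \<le> ennreal (\<Sum>i\<in>J. N (g i) * len p (y i))"
proof -
  define \<beta> where "\<beta> i t = h (arclength p (y i) t)" for i t
  have inj: "a = b" if "a \<in> K" "b \<in> K" "h a = h b" for a b
  proof -
    have "h b \<in> mspace T" using h(1) that(2) by blast
    then have "mdist T (h a) (h b) = 0" unfolding that(3) by (rule mdist_refl)
    then show ?thesis using h(2)[OF that(1,2)] by simp
  qed
  have "filling_length N T (\<Sum>i\<in>J. Poly_Mapping.single (\<beta> i (len p (y i))) (g i)) \<le> ennreal (\<Sum>i\<in>J. N (g i) * len p (y i))"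
  proof (rule filling_length_star[OF N J])
    fix i assume i: "i \<in> J"
    then have yi: "y i \<in> K" using y by blast
    show "0 \<le> len p (y i) \<and> len p (y i) \<le> 1" using y[OF i] len_nonneg by blast
    show "\<beta> i 0 = h p" using arclength_ends[OF p yi] by (simp add: \<beta>_def)
    show "nonexpanding_on T {0..len p (y i)} (\<beta> i)"
      unfolding nonexpanding_on_def
    proof (intro conjI ballI Pi_I)
      show "\<beta> i t \<in> mspace T" if "t \<in> {0..len p (y i)}" for t
        unfolding \<beta>_def using arclength(3)[OF p yi that] h(1) by blast
      fix s t assume st: "s \<in> {0..len p (y i)}" "t \<in> {0..len p (y i)}"
      have "mdist T (\<beta> i s) (\<beta> i t) = dist (arclength p (y i) s) (arclength p (y i) t)"
        unfolding \<beta>_def by (rule h(2)[OF arclength(3)[OF p yi st(1)] arclength(3)[OF p yi st(2)]])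
      also have "\<dots> \<le> \<bar>s - t\<bar>" using nonexpanding_arclength[OF p yi] st unfolding nonexpanding_on_euclidean by blast
      finally show "mdist T (\<beta> i s) (\<beta> i t) \<le> \<bar>s - t\<bar>" .
    qed
  next
    fix i j s t assume ij: "i \<in> J" "j \<in> J" and st: "s \<in> {0..len p (y i)}" "t \<in> {0..len p (y j)}" "\<beta> i s = \<beta> j t"
    have yij: "y i \<in> K" "y j \<in> K" using y ij by auto
    have eq: "arclength p (y i) s = arclength p (y j) t"
      using inj[OF arclength(3)[OF p yij(1) st(1)] arclength(3)[OF p yij(2) st(2)]] st(3) by (simp add: \<beta>_def)
    note c = arclength_coherent[OF p yij st(1,2) eq]
    show "s = t \<and> (\<forall>r\<in>{0..s}. \<beta> i r = \<beta> j r)" using c by (auto simp: \<beta>_def)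
  qed (rule g0)
  moreover have "\<beta> i (len p (y i)) = h (y i)" if "i \<in> J" for i
    using arclength_ends(2)[OF p, of "y i"] y[OF that] by (simp add: \<beta>_def)
  ultimately show ?thesis by simp
qed

text \<open>
  If \<open>a\<close> and \<open>b\<close> have the largest distance, then their midpoint is at
  least as close to \<open>c\<close> as to \<open>a\<close> and \<open>b\<close>.
\<close>

lemma center_of_three:
  assumes K: "a \<in> K" "b \<in> K" "c \<in> K" and m: "len a b \<le> m" "len b c \<le> m" "len c a \<le> m"
  obtains p where "p \<in> K" "len p a \<le> m / 2" "len p b \<le> m / 2" "len p c \<le> m / 2"
proof -
  have *: "\<exists>p\<in>K. len p a \<le> m / 2 \<and> len p b \<le> m / 2 \<and> len p c \<le> m / 2"
    if K: "a \<in> K" "b \<in> K" "c \<in> K" and "len a b \<le> m" "len a c \<le> len a b" "len b c \<le> len a b" for a b c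
  proof -
    obtain p where p: "p \<in> K" "len p a = len a b / 2" "len p b = len a b / 2"
      "\<And>z. z \<in> K \<Longrightarrow> len p z = len a z - len a b / 2 \<or> len p z = len b z - len a b / 2"
      using midpoint[OF K(1,2)] by metis
    have "len p c \<le> len a b / 2" using p(4)[OF K(3)] that(5,6) by auto
    then show ?thesis using p(1,2,3) that(4) by (intro bexI[of _ p]) auto
  qed
  have s: "len b a = len a b" "len c b = len b c" "len a c = len c a" using len_sym K by auto
  have "\<exists>p\<in>K. len p a \<le> m / 2 \<and> len p b \<le> m / 2 \<and> len p c \<le> m / 2"
  proof -
    consider "len a c \<le> len a b" "len b c \<le> len a b" | "len b a \<le> len b c" "len c a \<le> len b c"
      | "len c b \<le> len c a" "len a b \<le> len c a" using s by linarith
    then show ?thesis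
    proof cases
      case 1 then show ?thesis using *[OF K(1,2,3)] m by blast
    next
      case 2 then show ?thesis using *[OF K(2,3,1)] m by blast
    next
      case 3 then show ?thesis using *[OF K(3,1,2)] m by blast
    qed
  qed
  then show ?thesis using that by blast
qed

text \<open>
  Take the midpoint of \<open>a\<close> and \<open>c\<close>. It lies on the way from
  \<open>a\<close> or from \<open>c\<close> to each of the other two points, and these ways have
  length at most \<open>1\<close>.
\<close>

lemma center_of_quadrilateral:
  assumes K: "a \<in> K" "b \<in> K" "c \<in> K" "d \<in> K"
    and m: "len a b \<le> 1" "len b c \<le> 1" "len c d \<le> 1" "len d a \<le> 1" "len a c \<le> 2"
  obtains p \<alpha> where "p \<in> K" "0 \<le> \<alpha>" "\<alpha> \<le> 1" "len p a = \<alpha>" "len p c = \<alpha>" "len p b \<le> 1 - \<alpha>" "len p d \<le> 1 - \<alpha>"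
proof -
  obtain p where p: "p \<in> K" "len p a = len a c / 2" "len p c = len a c / 2"
      "\<And>z. z \<in> K \<Longrightarrow> len p z = len a z - len a c / 2 \<or> len p z = len c z - len a c / 2"
    using midpoint[OF K(1,3)] by metis
  have s: "len c b = len b c" "len a d = len d a" using len_sym K by auto
  show ?thesis
  proof (rule that[of p "len a c / 2"])
    show "len p b \<le> 1 - len a c / 2" using p(4)[OF K(2)] m s by auto
    show "len p d \<le> 1 - len a c / 2" using p(4)[OF K(4)] m s by auto
  qed (use p m len_nonneg[of a c] in auto)
qed

end

context circle_space
begin

text \<open>
  The Kuratowski embedding: a point is sent to the function of its distances from the points of the
  image curve. Since this curve exhausts the image, the embedding is an isometry into the Banach
  space of bounded continuous functions.
\<close>

lemma circle_image_in_tree: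
  fixes T :: "'t metric"
  assumes T: "tree T" and f: "one_lipschitz X T f"
  obtains K :: "(real \<Rightarrow>\<^sub>C real) set" and \<phi> h
  where "unique_arc_set K" "h \<in> K \<rightarrow> mspace T" "\<And>a b. a \<in> K \<Longrightarrow> b \<in> K \<Longrightarrow> mdist T (h a) (h b) = dist a b"
    "\<And>t. 0 \<le> t \<Longrightarrow> t \<le> real n \<Longrightarrow> \<phi> t \<in> K \<and> h (\<phi> t) = f (pt t)" "\<phi> (real n) = \<phi> 0"
    "\<And>s t. 0 \<le> s \<Longrightarrow> s \<le> t \<Longrightarrow> t \<le> real n \<Longrightarrow> unique_arc_set.len K (\<phi> s) (\<phi> t) \<le> t - s"
proof -
  have fX: "f x \<in> mspace T" if "x \<in> mspace X" for x using f that by (auto simp: one_lipschitz_def)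
  have fL: "mdist T (f x) (f y) \<le> mdist X x y" if "x \<in> mspace X" "y \<in> mspace X" for x y
    using f that by (auto simp: one_lipschitz_def)
  define cl where "cl s = max 0 (min (real n) s)" for s
  have cl: "cl s \<in> {0..real n}" "\<bar>cl s - cl t\<bar> \<le> \<bar>s - t\<bar>" for s t by (auto simp: cl_def)
  define c where "c s = f (pt (cl s))" for s
  have ptX: "pt s \<in> mspace X" if "s \<in> {0..real n}" for s using nonexpanding_on_image[OF nonexpanding_pt] that by blast
  have cT: "c s \<in> mspace T" for s unfolding c_def using fX ptX cl by blast
  have cL: "mdist T (c s) (c t) \<le> \<bar>s - t\<bar>" for s t
  proof -
    have "mdist T (c s) (c t) \<le> mdist X (pt (cl s)) (pt (cl t))" unfolding c_def using fL ptX cl by blast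
    also have "\<dots> \<le> \<bar>cl s - cl t\<bar>" using nonexpanding_pt cl(1) unfolding nonexpanding_on_def by blast
    also have "\<dots> \<le> \<bar>s - t\<bar>" by (rule cl(2))
    finally show ?thesis .
  qed
  define F where "F = f ` mspace X"
  have FT: "F \<subseteq> mspace T" using fX by (auto simp: F_def)
  have Fc: "\<exists>s. z = c s" if z: "z \<in> F" for z
  proof -
    obtain x where x: "x \<in> mspace X" "z = f x" using z by (auto simp: F_def)
    obtain t where t: "0 \<le> t" "t < real n" "x = pt t" using ptE[OF x(1)] by metis
    then show ?thesis using x(2) by (intro exI[of _ t]) (simp add: c_def cl_def)
  qed
  \<comment> \<open>the Kuratowski embedding of the image of the circle\<close>
  define E where "E z = Bcontfun (\<lambda>s. mdist T (c s) z)" for z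
  have E: "apply_bcontfun (E z) s = mdist T (c s) z" if z: "z \<in> mspace T" for z s
  proof -
    have L: "\<bar>mdist T (c s) z - mdist T (c t) z\<bar> \<le> \<bar>s - t\<bar>" for s t
      using mdist_triangle[OF cT[of s] cT[of t] z] mdist_triangle[OF cT[of t] cT[of s] z]
        mdist_commute[of T "c s" "c t"] cL[of s t] by linarith
    then have "1-lipschitz_on UNIV (\<lambda>s. mdist T (c s) z)" by (simp add: lipschitz_on_def dist_real_def)
    then have "continuous_on UNIV (\<lambda>s. mdist T (c s) z)" by (rule lipschitz_on_continuous_on)
    moreover have "norm (mdist T (c s) z) \<le> real n + mdist T (c 0) z" for s
    proof -
      have "c s = c (cl s)" by (simp add: c_def cl_def)
      then have "\<bar>mdist T (c s) z - mdist T (c 0) z\<bar> \<le> \<bar>cl s - 0\<bar>" using L[of "cl s" 0] by simp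
      moreover have "\<bar>cl s - 0\<bar> \<le> real n" using cl(1)[of s] by simp
      ultimately have "mdist T (c s) z \<le> real n + mdist T (c 0) z" by linarith
      then show ?thesis by simp
    qed
    ultimately have "(\<lambda>s. mdist T (c s) z) \<in> bcontfun" by (rule bcontfun_normI)
    then show ?thesis unfolding E_def by (simp add: Bcontfun_inverse)
  qed
  have Eiso: "dist (E z) (E w) = mdist T z w" if zw: "z \<in> F" "w \<in> F" for z w
  proof (rule antisym)
    have zT: "z \<in> mspace T" "w \<in> mspace T" using zw FT by auto
    show "dist (E z) (E w) \<le> mdist T z w"
    proof (rule dist_bound)
      fix s
      show "dist (apply_bcontfun (E z) s) (apply_bcontfun (E w) s) \<le> mdist T z w"
        unfolding E[OF zT(1)] E[OF zT(2)] dist_real_def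
        using mdist_triangle[OF cT[of s] zT(1,2)] mdist_triangle[OF cT[of s] zT(2,1)] mdist_commute[of T z w] by linarith
    qed
    obtain s where s: "z = c s" using Fc[OF zw(1)] by blast
    have "dist (apply_bcontfun (E z) s) (apply_bcontfun (E w) s) \<le> dist (E z) (E w)" by (rule dist_bounded)
    then show "mdist T z w \<le> dist (E z) (E w)"
      unfolding E[OF zT(1)] E[OF zT(2)] dist_real_def s[symmetric] mdist_refl[OF zT(1)] by simp
  qed
  have injE: "inj_on E F"
  proof (rule inj_onI)
    fix z w assume zw: "z \<in> F" "w \<in> F" "E z = E w"
    have "dist (E z) (E w) = 0" using zw(3) by simp
    then have "mdist T z w = 0" unfolding Eiso[OF zw(1,2)] .
    moreover have "z \<in> mspace T" "w \<in> mspace T" using zw(1,2) FT by blast+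
    ultimately show "z = w" by simp
  qed
  define K where "K = E ` F"
  define h where "h = inv_into F E"
  have hE: "h (E z) = z" if "z \<in> F" for z unfolding h_def using injE that by (rule inv_into_f_f)
  have hK: "h \<in> K \<rightarrow> mspace T" using hE FT by (auto simp: K_def)
  have hiso: "mdist T (h a) (h b) = dist a b" if "a \<in> K" "b \<in> K" for a b
    using that hE Eiso by (auto simp: K_def)
  have curve: "nonexpanding_on euclidean_metric A (\<lambda>t. E (f (\<gamma> t)))" "(\<lambda>t. E (f (\<gamma> t))) ` A \<subseteq> K"
    if \<gamma>: "nonexpanding_on X A \<gamma>" for A \<gamma>
  proof -
    have gX: "\<gamma> t \<in> mspace X" if "t \<in> A" for t using nonexpanding_on_image[OF \<gamma>] that by blast
    then have gF: "f (\<gamma> t) \<in> F" if "t \<in> A" for t using that by (auto simp: F_def)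
    show "(\<lambda>t. E (f (\<gamma> t))) ` A \<subseteq> K" using gF by (auto simp: K_def)
    show "nonexpanding_on euclidean_metric A (\<lambda>t. E (f (\<gamma> t)))"
      unfolding nonexpanding_on_euclidean
    proof (intro ballI)
      fix s t assume st: "s \<in> A" "t \<in> A"
      have "dist (E (f (\<gamma> s))) (E (f (\<gamma> t))) = mdist T (f (\<gamma> s)) (f (\<gamma> t))" using Eiso gF st by blast
      also have "\<dots> \<le> mdist X (\<gamma> s) (\<gamma> t)" using fL gX st by blast
      also have "\<dots> \<le> \<bar>s - t\<bar>" using \<gamma> st unfolding nonexpanding_on_def by blast
      finally show "dist (E (f (\<gamma> s))) (E (f (\<gamma> t))) \<le> \<bar>s - t\<bar>" .
    qed
  qed
  have U: "unique_arc_set K"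
  proof (rule unique_arc_set_isometric_image[OF T hK hiso])
    fix a b assume "a \<in> K" "b \<in> K"
    then obtain x y where x: "x \<in> mspace X" "a = E (f x)" and y: "y \<in> mspace X" "b = E (f y)"
      by (auto simp: K_def F_def)
    obtain \<gamma> :: "real \<Rightarrow> 'x" where g: "\<gamma> \<in> {0..mdist X x y} \<rightarrow> mspace X" "\<gamma> 0 = x" "\<gamma> (mdist X x y) = y"
      "\<forall>s\<in>{0..mdist X x y}. \<forall>t\<in>{0..mdist X x y}. mdist X (\<gamma> s) (\<gamma> t) = \<bar>s - t\<bar>"
      using geodesic_X x(1) y(1) unfolding geodesic_space_def by blast
    have "nonexpanding_on X {0..mdist X x y} \<gamma>" using g(1,4) by (simp add: nonexpanding_on_def)
    from curve[OF this] show "\<exists>D c. 0 \<le> D \<and> nonexpanding_on euclidean_metric {0..D} c \<and> c ` {0..D} \<subseteq> K \<and> c 0 = a \<and> c D = b"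
      using g(2,3) x(2) y(2) by (intro exI[of _ "mdist X x y"] exI[of _ "\<lambda>t. E (f (\<gamma> t))"]) auto
  qed
  interpret U: unique_arc_set K by (rule U)
  define \<phi> where "\<phi> t = E (f (pt t))" for t
  show ?thesis
  proof (rule that[OF U hK hiso, of \<phi>])
    fix t assume t: "0 \<le> t" "t \<le> real n"
    then have "f (pt t) \<in> F" using ptX by (auto simp: F_def)
    then show "\<phi> t \<in> K \<and> h (\<phi> t) = f (pt t)" using hE by (auto simp: \<phi>_def K_def)
  next
    show "\<phi> (real n) = \<phi> 0" using real_n by (simp add: \<phi>_def pt_def)
  next
    fix s t assume st: "0 \<le> s" "s \<le> t" "t \<le> real n"
    have "nonexpanding_on X {0..t - s} (\<lambda>u. pt (s + u))"
      unfolding nonexpanding_on_def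
    proof (intro conjI ballI Pi_I)
      fix u v assume uv: "u \<in> {0..t - s}" "v \<in> {0..t - s}"
      have "mdist X (pt (s + u)) (pt (s + v)) \<le> \<bar>(s + u) - (s + v)\<bar>"
      proof -
        have "s + u \<in> {0..real n}" "s + v \<in> {0..real n}" using uv st by auto
        then show ?thesis using nonexpanding_pt unfolding nonexpanding_on_def by blast
      qed
      then show "mdist X (pt (s + u)) (pt (s + v)) \<le> \<bar>u - v\<bar>" by simp
    qed (use st ptX in auto)
    from U.len_le[OF _ curve[OF this]] st show "U.len (\<phi> s) (\<phi> t) \<le> t - s" by (simp add: \<phi>_def)
  qed
qed

text \<open>
  Fill by the star around the centre of the three points, none of whose arcs is longer than
  \<open>1/2\<close>.
\<close>

theorem filling_length_tree_image_three:
  assumes N: "normed_ab_group N" and n: "n = 3" and T: "tree T" and f: "one_lipschitz X T f"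
    and g0: "(\<Sum>i=1..n. g i) = 0"
  shows "filling_length N T (\<Sum>i=1..n. Poly_Mapping.single (f (pt (real i))) (g i)) \<le> ennreal ((\<Sum>i=1..n. N (g i)) / 2)"
proof -
  obtain K :: "(real \<Rightarrow>\<^sub>C real) set" and \<phi> h
    where K: "unique_arc_set K" and h: "h \<in> K \<rightarrow> mspace T" "\<And>a b. a \<in> K \<Longrightarrow> b \<in> K \<Longrightarrow> mdist T (h a) (h b) = dist a b"
    and \<phi>: "\<And>t. 0 \<le> t \<Longrightarrow> t \<le> real n \<Longrightarrow> \<phi> t \<in> K \<and> h (\<phi> t) = f (pt t)" "\<phi> (real n) = \<phi> 0"
    and len: "\<And>s t. 0 \<le> s \<Longrightarrow> s \<le> t \<Longrightarrow> t \<le> real n \<Longrightarrow> unique_arc_set.len K (\<phi> s) (\<phi> t) \<le> t - s"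
    by (rule circle_image_in_tree[OF T f]) blast
  interpret U: unique_arc_set K by (rule K)
  have c: "\<phi> 1 \<in> K" "\<phi> 2 \<in> K" "\<phi> 3 \<in> K" "U.len (\<phi> 1) (\<phi> 2) \<le> 1" "U.len (\<phi> 2) (\<phi> 3) \<le> 1" "U.len (\<phi> 3) (\<phi> 1) \<le> 1"
    using \<phi>(1)[of 1] \<phi>(1)[of 2] \<phi>(1)[of 3] \<phi>(2) len[of 1 2] len[of 2 3] len[of 0 1] by (auto simp: n)
  obtain p where p: "p \<in> K" "U.len p (\<phi> 1) \<le> 1/2" "U.len p (\<phi> 2) \<le> 1/2" "U.len p (\<phi> 3) \<le> 1/2"
    using U.center_of_three[OF c] by metis
  have I: "{1..n} = {1, 2, 3}" unfolding n by auto
  have half: "U.len p (\<phi> (real i)) \<le> 1/2" if "i \<in> {1..n}" for i using that p unfolding I by auto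
  have "filling_length N T (\<Sum>i=1..n. Poly_Mapping.single (h (\<phi> (real i))) (g i)) \<le> ennreal (\<Sum>i=1..n. N (g i) * U.len p (\<phi> (real i)))"
  proof (rule U.filling_length_from_center[OF N _ h p(1) _ g0])
    fix i assume i: "i \<in> {1..n}"
    then show "\<phi> (real i) \<in> K \<and> U.len p (\<phi> (real i)) \<le> 1" using \<phi>(1)[of "real i"] half[OF i] by auto
  qed simp
  also have "\<dots> \<le> ennreal (\<Sum>i=1..n. N (g i) * (1/2))"
    using half normed_ab_groupD(1)[OF N] by (intro ennreal_leI sum_mono mult_left_mono) auto
  also have "(\<Sum>i=1..n. N (g i) * (1/2)) = (\<Sum>i=1..n. N (g i)) / 2" by (simp add: sum_divide_distrib)
  finally show ?thesis using \<phi>(1) by simp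
qed

theorem filling_length_tree_image_four:
  assumes N: "normed_ab_group N" and n: "n = 4" and T: "tree T" and f: "one_lipschitz X T f"
    and g0: "(\<Sum>i=1..n. g i) = 0"
  obtains \<alpha> where "0 \<le> \<alpha>" "\<alpha> \<le> 1"
    "filling_length N T (\<Sum>i=1..n. Poly_Mapping.single (f (pt (real i))) (g i))
      \<le> ennreal (\<alpha> * (N (g 1) + N (g 3)) + (1 - \<alpha>) * (N (g 2) + N (g 4)))"
proof -
  obtain K :: "(real \<Rightarrow>\<^sub>C real) set" and \<phi> h
    where K: "unique_arc_set K" and h: "h \<in> K \<rightarrow> mspace T" "\<And>a b. a \<in> K \<Longrightarrow> b \<in> K \<Longrightarrow> mdist T (h a) (h b) = dist a b"
    and \<phi>: "\<And>t. 0 \<le> t \<Longrightarrow> t \<le> real n \<Longrightarrow> \<phi> t \<in> K \<and> h (\<phi> t) = f (pt t)" "\<phi> (real n) = \<phi> 0"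
    and len: "\<And>s t. 0 \<le> s \<Longrightarrow> s \<le> t \<Longrightarrow> t \<le> real n \<Longrightarrow> unique_arc_set.len K (\<phi> s) (\<phi> t) \<le> t - s"
    by (rule circle_image_in_tree[OF T f]) blast
  interpret U: unique_arc_set K by (rule K)
  have c: "\<phi> 1 \<in> K" "\<phi> 2 \<in> K" "\<phi> 3 \<in> K" "\<phi> 4 \<in> K" "U.len (\<phi> 1) (\<phi> 2) \<le> 1" "U.len (\<phi> 2) (\<phi> 3) \<le> 1"
    "U.len (\<phi> 3) (\<phi> 4) \<le> 1" "U.len (\<phi> 4) (\<phi> 1) \<le> 1" "U.len (\<phi> 1) (\<phi> 3) \<le> 2"
    using \<phi>(1)[of 1] \<phi>(1)[of 2] \<phi>(1)[of 3] \<phi>(1)[of 4] \<phi>(2) len[of 1 2] len[of 2 3] len[of 3 4] len[of 0 1] len[of 1 3]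
    by (auto simp: n)
  obtain p \<alpha> where p: "p \<in> K" "0 \<le> \<alpha>" "\<alpha> \<le> 1" "U.len p (\<phi> 1) = \<alpha>" "U.len p (\<phi> 3) = \<alpha>"
    "U.len p (\<phi> 2) \<le> 1 - \<alpha>" "U.len p (\<phi> 4) \<le> 1 - \<alpha>"
    using U.center_of_quadrilateral[OF c] by metis
  have I: "{1..n} = {1, 2, 3, 4}" unfolding n by auto
  have "filling_length N T (\<Sum>i=1..n. Poly_Mapping.single (h (\<phi> (real i))) (g i)) \<le> ennreal (\<Sum>i=1..n. N (g i) * U.len p (\<phi> (real i)))"
  proof (rule U.filling_length_from_center[OF N _ h p(1) _ g0])
    fix i assume i: "i \<in> {1..n}"
    then have "U.len p (\<phi> (real i)) \<le> 1" using p unfolding I by auto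
    then show "\<phi> (real i) \<in> K \<and> U.len p (\<phi> (real i)) \<le> 1" using \<phi>(1)[of "real i"] i by auto
  qed simp
  also have "(\<Sum>i=1..n. N (g i) * U.len p (\<phi> (real i)))
      = N (g 1) * \<alpha> + N (g 3) * \<alpha> + N (g 2) * U.len p (\<phi> 2) + N (g 4) * U.len p (\<phi> 4)"
    unfolding I using p by simp
  also have "ennreal \<dots> \<le> ennreal (N (g 1) * \<alpha> + N (g 3) * \<alpha> + N (g 2) * (1 - \<alpha>) + N (g 4) * (1 - \<alpha>))"
    using p normed_ab_groupD(1)[OF N] by (intro ennreal_leI add_mono mult_left_mono) auto
  also have "N (g 1) * \<alpha> + N (g 3) * \<alpha> + N (g 2) * (1 - \<alpha>) + N (g 4) * (1 - \<alpha>)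
      = \<alpha> * (N (g 1) + N (g 3)) + (1 - \<alpha>) * (N (g 2) + N (g 4))" by (simp add: algebra_simps)
  finally show ?thesis using that[OF p(2,3)] \<phi>(1) by simp
qed

end

section \<open>From cyclic transport to nonbranching plans\<close>

lemma Metric_space_distances_one_or_two:
  fixes d :: "nat \<Rightarrow> nat \<Rightarrow> real"
  assumes "\<And>i j. d i j = d j i" "\<And>i. d i i = 0" "\<And>i j. i \<noteq> j \<Longrightarrow> 1 \<le> d i j \<and> d i j \<le> 2"
  shows "Metric_space A d"
proof
  fix x y z
  show "0 \<le> d x y" using assms(2)[of x] assms(3)[of x y] by (cases "x = y") auto
  show "d x y = d y x" by (rule assms(1))
  show "d x y = 0 \<longleftrightarrow> x = y" using assms(2)[of x] assms(3)[of x y] by (cases "x = y") auto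
  show "d x z \<le> d x y + d y z"
    using assms(2)[of x] assms(2)[of y] assms(3)[of x y] assms(3)[of y z] assms(3)[of x z]
    by (cases "x = y"; cases "y = z"; cases "x = z") auto
qed

lemma optimal_plan_le:
  assumes N: "normed_ab_group N" and otp: "optimal_transport_plans N"
    and n: "1 \<le> n" and g: "(\<Sum>i=1..n. g i) = 0" and d: "Metric_space {1..n} d"
  obtains h where "transport_plan n g h" "\<And>h'. transport_plan n g h' \<Longrightarrow> transport_cost N n d h \<le> transport_cost N n d h'"
proof -
  obtain h where h: "transport_plan n g h"
    "transport_cost N n d h = (INF h'\<in>{h'. transport_plan n g h'}. transport_cost N n d h')"
    using otp n g d unfolding optimal_transport_plans_def by blast
  have "0 \<le> transport_cost N n d h'" for h'
    unfolding transport_cost_def using normed_ab_groupD(1)[OF N] Metric_space.nonneg[OF d]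
    by (intro sum_nonneg mult_nonneg_nonneg)
  then have bdd: "bdd_below (transport_cost N n d ` {h'. transport_plan n g h'})"
    by (intro bdd_belowI[of _ 0]) auto
  have "transport_cost N n d h \<le> transport_cost N n d h'" if "transport_plan n g h'" for h'
    unfolding h(2) using bdd that by (intro cINF_lower) auto
  then show ?thesis using that h(1) by blast
qed

text \<open>
  This is the nonbranching condition for the three elements \<open>a\<close>, \<open>b\<close> and
  \<open>- (a + b)\<close>. It says that the points \<open>0\<close>, \<open>a\<close> and \<open>a
  + b\<close> have a median, namely \<open>y\<close>, for the distance \<open>N (g - h)\<close>.
\<close>

definition three_point_splitting :: "('g::ab_group_add \<Rightarrow> real) \<Rightarrow> bool" where
  "three_point_splitting N \<longleftrightarrow> (\<forall>a b. \<exists>x y z. a = x + y \<and> b = z - x \<and> a + b = y + z \<and>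
     N a = N x + N y \<and> N b = N x + N z \<and> N (a + b) = N y + N z)"

text \<open>
  A Riesz refinement property with additive norms: the transports from \<open>a1\<close> and
  \<open>a2\<close> to \<open>b1\<close> and \<open>b2\<close> form a matrix in which the norm is
  additive along rows and columns.
\<close>

definition norm_refinement :: "('g::ab_group_add \<Rightarrow> real) \<Rightarrow> bool" where
  "norm_refinement N \<longleftrightarrow> (\<forall>a1 a2 b1 b2. a1 + a2 = b1 + b2 \<longrightarrow> N a1 + N a2 = N b1 + N b2 \<longrightarrow>
     (\<exists>p q r s. a1 = p + q \<and> a2 = r + s \<and> b1 = p + r \<and> b2 = q + s \<and>
        N a1 = N p + N q \<and> N a2 = N r + N s \<and> N b1 = N p + N r \<and> N b2 = N q + N s))"

text \<open>
  The assumption makes the norm additive on partial sums as well, so one summand \<open>h k\<close>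
  can be split off against the sum of the others by \<^const>\<open>norm_refinement\<close>.
\<close>

lemma norm_refinement_sum:
  fixes N :: "'b::ab_group_add \<Rightarrow> real" and h :: "'i \<Rightarrow> 'b"
  assumes N: "normed_ab_group N" and R: "norm_refinement N" and J: "finite J"
    and "sum h J = b + c" "N (b + c) = (\<Sum>j\<in>J. N (h j))" "N (b + c) = N b + N c"
  shows "\<exists>u v. (\<forall>j\<in>J. h j = u j + v j \<and> N (h j) = N (u j) + N (v j)) \<and> sum u J = b \<and> sum v J = c
    \<and> N b = (\<Sum>j\<in>J. N (u j)) \<and> N c = (\<Sum>j\<in>J. N (v j))"
  using J assms(4-6)
proof (induction J arbitrary: b c rule: finite_induct)
  case empty
  have "N b = 0" "N c = 0" using empty normed_ab_groupD(1)[OF N, of b] normed_ab_groupD(1)[OF N, of c] by auto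
  then show ?case using N by (simp add: normed_ab_group_def)
next
  case (insert k J)
  have H: "h k + sum h J = b + c" using insert by simp
  have "N (b + c) \<le> N (h k) + N (sum h J)" unfolding H[symmetric] by (rule normed_ab_groupD(2)[OF N])
  moreover have "N (sum h J) \<le> (\<Sum>j\<in>J. N (h j))" by (rule norm_sum_le[OF N])
  moreover have "N (b + c) = N (h k) + (\<Sum>j\<in>J. N (h j))" using insert by simp
  ultimately have HJ: "N (sum h J) = (\<Sum>j\<in>J. N (h j))" "N (h k) + N (sum h J) = N b + N c"
    using insert.prems(3) by linarith+
  obtain p q r s where pq: "h k = p + q" "sum h J = r + s" "b = p + r" "c = q + s"
    "N (h k) = N p + N q" "N (sum h J) = N r + N s" "N b = N p + N r" "N c = N q + N s"
    using R H HJ(2) unfolding norm_refinement_def by metis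
  obtain u v where uv: "\<forall>j\<in>J. h j = u j + v j \<and> N (h j) = N (u j) + N (v j)" "sum u J = r" "sum v J = s"
    "N r = (\<Sum>j\<in>J. N (u j))" "N s = (\<Sum>j\<in>J. N (v j))"
    using insert.IH[of r s] pq(2,6) HJ(1) by auto
  have ext: "(\<Sum>j\<in>J. F ((w(k := x)) j)) = (\<Sum>j\<in>J. F (w j))" for F :: "'b \<Rightarrow> real" and x w
    using insert.hyps(2) by (intro sum.cong) auto
  have ext': "(\<Sum>j\<in>J. (w(k := x)) j) = sum w J" for x :: 'b and w
    using insert.hyps(2) by (intro sum.cong) auto
  show ?case
  proof (rule exI[of _ "u(k := p)"], rule exI[of _ "v(k := q)"], intro conjI)
    show "\<forall>j\<in>insert k J. h j = (u(k := p)) j + (v(k := q)) j \<and> N (h j) = N ((u(k := p)) j) + N ((v(k := q)) j)"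
      using uv(1) pq(1,5) by auto
    show "sum (u(k := p)) (insert k J) = b" "sum (v(k := q)) (insert k J) = c"
      unfolding sum.insert[OF insert.hyps] ext' using pq(3,4) uv(2,3) by simp_all
    show "N b = (\<Sum>j\<in>insert k J. N ((u(k := p)) j))" "N c = (\<Sum>j\<in>insert k J. N ((v(k := q)) j))"
      unfolding sum.insert[OF insert.hyps] ext[of N] using pq(7,8) uv(4,5) by simp_all
  qed
qed

text \<open>
  Induction on the number of points: a plan for the configuration in which \<open>k\<close> is
  merged into another point \<open>m\<close> is refined. The element \<open>g m + g k\<close> is
  split into the amounts \<open>b\<close> and \<open>c\<close> that \<open>m\<close> and
  \<open>k\<close> exchange with the other points, and its transports are split accordingly.
\<close>

lemma nonbranching_plan_exists:
  assumes N: "normed_ab_group N" and T: "three_point_splitting N" and R: "norm_refinement N" and I: "finite I"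
    and "sum g I = 0"
  shows "\<exists>h. (\<forall>i\<in>I. \<forall>j\<in>I. h i j = - h j i) \<and> (\<forall>i\<in>I. h i i = 0) \<and>
     (\<forall>i\<in>I. g i = (\<Sum>j\<in>I. h i j) \<and> N (g i) = (\<Sum>j\<in>I. N (h i j)))"
  using I assms(5)
proof (induction I arbitrary: g rule: finite_induct)
  case empty
  show ?case by simp
next
  case (insert k I)
  have N0: "N 0 = 0" by (rule normed_ab_groupD(4)[OF N])
  show ?case
  proof (cases "I = {}")
    case True
    then have "g k = 0" using insert.prems by simp
    then show ?thesis using True N0 by (intro exI[of _ "\<lambda>_ _. 0"]) simp
  next
    case False
    then obtain m where m: "m \<in> I" by blast
    have mk: "m \<noteq> k" using m insert.hyps(2) by auto
    define g' where "g' i = (if i = m then g m + g k else g i)" for i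
    have "sum g' I = g' m + sum g' (I - {m})" using insert.hyps(1) m by (rule sum.remove)
    also have "sum g' (I - {m}) = sum g (I - {m})" by (rule sum.cong) (auto simp: g'_def)
    also have "g' m + sum g (I - {m}) = g k + (g m + sum g (I - {m}))" by (simp add: g'_def ac_simps)
    also have "g m + sum g (I - {m}) = sum g I" using insert.hyps(1) m by (rule sum.remove[symmetric])
    also have "g k + sum g I = 0" using insert.prems insert.hyps by simp
    finally obtain h where h: "\<forall>i\<in>I. \<forall>j\<in>I. h i j = - h j i" "\<forall>i\<in>I. h i i = 0"
      "\<forall>i\<in>I. g' i = (\<Sum>j\<in>I. h i j) \<and> N (g' i) = (\<Sum>j\<in>I. N (h i j))" using insert.IH[of g'] by blast
    obtain a b c where abc: "g m = a + b" "g k = c - a" "g m + g k = b + c"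
      "N (g m) = N a + N b" "N (g k) = N a + N c" "N (g m + g k) = N b + N c"
      using T unfolding three_point_splitting_def by metis
    define J where "J = I - {m}"
    have J: "finite J" "I = insert m J" "m \<notin> J" "k \<notin> J" using insert.hyps m by (auto simp: J_def)
    have hm0: "h m m = 0" using h(2) m by blast
    have "b + c = (\<Sum>j\<in>I. h m j)" "N (b + c) = (\<Sum>j\<in>I. N (h m j))"
      using h(3) m abc(3) by (auto simp: g'_def)
    then have hJ: "sum (h m) J = b + c" "N (b + c) = (\<Sum>j\<in>J. N (h m j))"
      using J hm0 N0 by auto
    have "N (b + c) = N b + N c" using abc(3,6) by simp
    then obtain u v where uv: "\<forall>j\<in>J. h m j = u j + v j \<and> N (h m j) = N (u j) + N (v j)" "sum u J = b" "sum v J = c"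
      "N b = (\<Sum>j\<in>J. N (u j))" "N c = (\<Sum>j\<in>J. N (v j))"
      using norm_refinement_sum[OF N R J(1) hJ] by blast
    \<comment> \<open>\<open>m\<close> sends \<open>a\<close> to \<open>k\<close>, and the transports of the merged point to the others are divided into \<open>u\<close> and \<open>v\<close>\<close>
    define H where "H i j = (if i = m \<and> j = k then a else if i = k \<and> j = m then - a
      else if i = m \<and> j \<in> J then u j else if i = k \<and> j \<in> J then v j
      else if j = m \<and> i \<in> J then - u i else if j = k \<and> i \<in> J then - v i
      else if i \<in> J \<and> j \<in> J then h i j else 0)" for i j
    have mJ: "j \<noteq> m" "j \<noteq> k" if "j \<in> J" for j using that J by auto
    have Hm: "H m k = a" "H k m = - a" "H m m = 0" "H k k = 0" using mk J by (auto simp: H_def)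
    have HJ: "H m j = u j" "H k j = v j" "H j m = - u j" "H j k = - v j" if "j \<in> J" for j
      using that mJ[OF that] mk J by (auto simp: H_def)
    have HJJ: "H i j = h i j" if "i \<in> J" "j \<in> J" for i j
      using that mJ[OF that(1)] mJ[OF that(2)] by (auto simp: H_def)
    have set: "insert k I = insert k (insert m J)" using J by simp
    have split: "(\<Sum>j\<in>insert k I. F j) = F k + (F m + sum F J)" for F :: "'b \<Rightarrow> 'c::comm_monoid_add"
      unfolding set using J mk by simp
    have negN: "N (- x) = N x" for x by (rule normed_ab_groupD(3)[OF N])
    show ?thesis
    proof (intro exI[of _ H] conjI ballI)
      fix i j assume "i \<in> insert k I" "j \<in> insert k I"
      then consider "i \<in> J" "j \<in> J" | "i \<in> J" "j = m \<or> j = k" | "i = m \<or> i = k" "j \<in> J" | "i = m \<or> i = k" "j = m \<or> j = k"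
        unfolding set by blast
      then show "H i j = - H j i"
      proof cases
        case 1
        then have "h i j = - h j i" using h(1) J(2) by blast
        then show ?thesis using 1 HJJ by simp
      qed (use HJ Hm in auto)
    next
      fix i assume "i \<in> insert k I"
      then show "H i i = 0" using Hm HJJ h(2) J(2) unfolding set by auto
    next
      fix i assume "i \<in> insert k I"
      then consider "i = k" | "i = m" | "i \<in> J" unfolding set by blast
      then show "g i = (\<Sum>j\<in>insert k I. H i j)"
      proof cases
        case 1
        have "sum (H k) J = c" using uv(3) HJ(2) by (simp cong: sum.cong)
        then show ?thesis unfolding split 1 using Hm abc(2) by simp
      next
        case 2
        have "sum (H m) J = b" using uv(2) HJ(1) by (simp cong: sum.cong)
        then show ?thesis unfolding split 2 using Hm abc(1) by simp
      next
        case 3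
        have eq: "sum (H i) J = sum (h i) J" using HJJ[OF 3] by (simp cong: sum.cong)
        have "h i m = - h m i" using h(1) 3 J(2) m by blast
        then have him: "h i m = - u i - v i" using uv(1) 3 by simp
        have "g i = g' i" using mJ[OF 3] by (simp add: g'_def)
        also have "\<dots> = h i m + sum (h i) J" using h(3) 3 J by simp
        finally show ?thesis unfolding split eq using HJ[OF 3] him by simp
      qed
    next
      fix i assume "i \<in> insert k I"
      then consider "i = k" | "i = m" | "i \<in> J" unfolding set by blast
      then show "N (g i) = (\<Sum>j\<in>insert k I. N (H i j))"
      proof cases
        case 1
        have "(\<Sum>j\<in>J. N (H k j)) = N c" using uv(5) HJ(2) by (simp cong: sum.cong)
        then show ?thesis unfolding split 1 using Hm abc(5) negN N0 by simp
      next
        case 2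
        have "(\<Sum>j\<in>J. N (H m j)) = N b" using uv(4) HJ(1) by (simp cong: sum.cong)
        then show ?thesis unfolding split 2 using Hm abc(4) negN N0 by simp
      next
        case 3
        have eq: "(\<Sum>j\<in>J. N (H i j)) = (\<Sum>j\<in>J. N (h i j))" using HJJ[OF 3] by (simp cong: sum.cong)
        have "h i m = - h m i" using h(1) 3 J(2) m by blast
        then have "N (h i m) = N (h m i)" by (simp only: negN)
        moreover have "N (h m i) = N (u i) + N (v i)" using uv(1) 3 by blast
        ultimately have him: "N (h i m) = N (u i) + N (v i)" by (rule trans)
        have "N (g i) = N (g' i)" using mJ[OF 3] by (simp add: g'_def)
        also have "\<dots> = (\<Sum>j\<in>I. N (h i j))" using h(3) 3 J(2) by blast
        also have "\<dots> = N (h i m) + (\<Sum>j\<in>J. N (h i j))" unfolding J(2) by (rule sum.insert[OF J(1,3)])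
        finally have "N (g i) = N (h i m) + (\<Sum>j\<in>J. N (h i j))" .
        then show ?thesis unfolding split eq using HJ[OF 3] him negN by simp
      qed
    qed
  qed
qed

lemma nonbranching_if_splitting:
  assumes N: "normed_ab_group N" and otp: "optimal_transport_plans N" and T: "three_point_splitting N" and R: "norm_refinement N"
  shows "nonbranching_optimal_transport_plans N"
  unfolding nonbranching_optimal_transport_plans_def
proof (intro conjI otp allI impI)
  fix n and g :: "nat \<Rightarrow> 'a" assume "(\<Sum>i=1..n. g i) = 0"
  from nonbranching_plan_exists[OF N T R finite_atLeastAtMost this]
  obtain h where h: "\<forall>i\<in>{1..n}. \<forall>j\<in>{1..n}. h i j = - h j i" "\<forall>i\<in>{1..n}. h i i = 0"
     "\<forall>i\<in>{1..n}. g i = (\<Sum>j=1..n. h i j) \<and> N (g i) = (\<Sum>j=1..n. N (h i j))" by blast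
  show "\<exists>h. transport_plan n g h \<and> (\<forall>i\<in>{1..n}. N (g i) = (\<Sum>j=1..n. N (h i j)))"
    unfolding transport_plan_def
  proof (intro exI[of _ h] conjI)
    show "\<forall>i\<in>{1..n}. \<forall>j\<in>{1..n}. h i j = - h j i" "\<forall>i\<in>{1..n}. h i i = 0" by (fact h)+
    show "\<forall>i\<in>{1..n}. g i = (\<Sum>j=1..n. h i j)" "\<forall>i\<in>{1..n}. N (g i) = (\<Sum>j=1..n. N (h i j))"
      using h(3) by blast+
  qed
qed

lemma tight_three:
  fixes x y z :: real
  assumes "a \<le> x + y" "b \<le> x + z" "c \<le> y + z" "2 * (x + y + z) \<le> a + b + c"
  shows "a = x + y" "b = x + z" "c = y + z"
  using assms by auto

lemma tight_four:
  fixes p q r t :: real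
  assumes "a \<le> p + q" "a' \<le> r + t" "b \<le> p + r" "b' \<le> q + t" "p + q + r + t \<le> a + a'" "a + a' = b + b'"
  shows "a = p + q" "a' = r + t" "b = p + r" "b' = q + t"
  using assms by auto

lemma sum_three: "(\<Sum>i=1..3. F i) = F 1 + F 2 + F (3::nat)" for F :: "nat \<Rightarrow> 'a::comm_monoid_add"
  by (simp add: eval_nat_numeral ac_simps)

lemma sum_four: "(\<Sum>i=1..4. F i) = F 1 + F 2 + F 3 + F (4::nat)" for F :: "nat \<Rightarrow> 'a::comm_monoid_add"
  by (simp add: eval_nat_numeral ac_simps)

lemma lessThan_sum_three: "(\<Sum>k<3. F k) = F 0 + F 1 + F (2::nat)" for F :: "nat \<Rightarrow> 'a::comm_monoid_add"
  by (simp add: eval_nat_numeral ac_simps)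

lemma lessThan_sum_four: "(\<Sum>k<4. F k) = F 0 + F 1 + F 2 + F (3::nat)" for F :: "nat \<Rightarrow> 'a::comm_monoid_add"
  by (simp add: eval_nat_numeral ac_simps)

lemma sum_one_two:
  fixes F :: "nat \<Rightarrow> 'a::comm_monoid_add"
  shows "(\<Sum>i=1..0. F i) = 0" "(\<Sum>i=1..1. F i) = F 1" "(\<Sum>i=1..2. F i) = F 1 + F 2"
  by (simp_all add: eval_nat_numeral ac_simps)

lemma transport_cost_three: "transport_cost N 3 d h = N (h 1 2) * d 1 2 + N (h 1 3) * d 1 3 + N (h 2 3) * d 2 3"
proof -
  have "{1<..3} = {2, 3::nat}" "{2<..3} = {3::nat}" "{3<..3} = ({}::nat set)" by auto
  then show ?thesis unfolding transport_cost_def sum_three by simp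
qed

lemma transport_cost_four: "transport_cost N 4 d h = N (h 1 2) * d 1 2 + N (h 1 3) * d 1 3 + N (h 1 4) * d 1 4
    + N (h 2 3) * d 2 3 + N (h 2 4) * d 2 4 + N (h 3 4) * d 3 4"
proof -
  have "{1<..4} = {2, 3, 4::nat}" "{2<..4} = {3, 4::nat}" "{3<..4} = {4::nat}" "{4<..4} = ({}::nat set)" by auto
  then show ?thesis unfolding transport_cost_def sum_four by simp
qed

lemma ball_three: "(\<forall>i\<in>{1..3}. P i) \<longleftrightarrow> P 1 \<and> P 2 \<and> P (3::nat)"
proof -
  have "{1..3} = {1, 2, 3::nat}" by auto
  then show ?thesis by simp
qed

lemma ball_four: "(\<forall>i\<in>{1..4}. P i) \<longleftrightarrow> P 1 \<and> P 2 \<and> P 3 \<and> P (4::nat)"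
proof -
  have "{1..4} = {1, 2, 3, 4::nat}" by auto
  then show ?thesis by simp
qed

text \<open>
  The element \<open>c\<close> determines a transport plan along the sides of a triangle with sides
  of length \<open>1\<close>, so the optimal plan costs at most half of the sum of the norms. It
  cannot cost less, because the two transports at each point add up to the element there.
\<close>

lemma three_point_splitting_if_cyclic:
  fixes N :: "'g::ab_group_add \<Rightarrow> real"
  assumes N: "normed_ab_group N" and otp: "optimal_transport_plans N"
    and cyc: "\<And>(g :: nat \<Rightarrow> 'g) e. (\<Sum>i=1..3. g i) = 0 \<Longrightarrow> 0 < e \<Longrightarrow>
      \<exists>c. (\<Sum>k<3. N (c - (\<Sum>i=1..k. g i))) < (\<Sum>i=1..3. N (g i)) / 2 + e"
  shows "three_point_splitting N"
  unfolding three_point_splitting_def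
proof (intro allI)
  fix a b :: 'g
  define g where "g i = (if i = 1 then a else if i = 2 then b else - (a + b))" for i :: nat
  have g: "g 1 = a" "g 2 = b" "g 3 = - (a + b)" by (auto simp: g_def)
  have g0: "(\<Sum>i=1..3. g i) = 0" unfolding sum_three g by simp
  define d :: "nat \<Rightarrow> nat \<Rightarrow> real" where "d i j = (if i = j then 0 else 1)" for i j
  have d: "Metric_space {1..3} d" by (rule Metric_space_distances_one_or_two) (auto simp: d_def)
  obtain h where h: "transport_plan 3 g h" "\<And>h'. transport_plan 3 g h' \<Longrightarrow> transport_cost N 3 d h \<le> transport_cost N 3 d h'"
    by (rule optimal_plan_le[OF N otp _ g0 d]) auto
  note Nm = normed_ab_groupD[OF N]
  define s where "s = (\<Sum>i=1..3. N (g i)) / 2"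
  have s: "s = (N a + N b + N (a + b)) / 2" unfolding s_def sum_three g Nm(3) ..
  have "transport_cost N 3 d h \<le> s + e" if e: "0 < e" for e
  proof -
    obtain c where "(\<Sum>k<3. N (c - (\<Sum>i=1..k. g i))) < s + e" using cyc[OF g0 e] unfolding s_def by blast
    moreover have "(\<Sum>k<3. N (c - (\<Sum>i=1..k. g i))) = N c + N (c - a) + N (c - a - b)"
      unfolding lessThan_sum_three sum_one_two g by (simp add: algebra_simps)
    ultimately have c: "N c + N (c - a) + N (c - a - b) < s + e" by simp
    define H where "H i j = (if (i, j) = (1, 2) then a - c else if (i, j) = (2, 1) then c - a
        else if (i, j) = (1, 3) then c else if (i, j) = (3, 1) then - c
        else if (i, j) = (2, 3) then a + b - c else if (i, j) = (3, 2) then c - a - b else 0)" for i j :: nat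
    have "transport_plan 3 g H"
      unfolding transport_plan_def ball_three sum_three g by (simp add: H_def algebra_simps)
    then have "transport_cost N 3 d h \<le> transport_cost N 3 d H" by (rule h(2))
    also have "\<dots> = N (a - c) + N c + N (a + b - c)" unfolding transport_cost_three by (simp add: H_def d_def)
    also have "\<dots> = N (c - a) + N c + N (c - a - b)"
      using Nm(3)[of "c - a"] Nm(3)[of "c - a - b"] by (simp add: algebra_simps)
    finally show ?thesis using c by linarith
  qed
  then have "transport_cost N 3 d h \<le> s" by (rule field_le_epsilon)
  then have le: "N (h 1 2) + N (h 1 3) + N (h 2 3) \<le> s" unfolding transport_cost_three by (simp add: d_def)
  have hp: "h 2 1 = - h 1 2" "h 3 1 = - h 1 3" "h 3 2 = - h 2 3" "a = h 1 2 + h 1 3" "b = h 2 1 + h 2 3" "- (a + b) = h 3 1 + h 3 2"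
  proof -
    note P = h(1)[unfolded transport_plan_def ball_three sum_three g]
    show "h 2 1 = - h 1 2" "h 3 1 = - h 1 3" "h 3 2 = - h 2 3" using P by blast+
    have z: "h 1 1 = 0" "h 2 2 = 0" "h 3 3 = 0" using P by blast+
    have "a = h 1 1 + h 1 2 + h 1 3" "b = h 2 1 + h 2 2 + h 2 3" "- (a + b) = h 3 1 + h 3 2 + h 3 3" using P by blast+
    then show "a = h 1 2 + h 1 3" "b = h 2 1 + h 2 3" "- (a + b) = h 3 1 + h 3 2"
      unfolding z add_0_left add_0_right by blast+
  qed
  have "b = h 2 3 - h 1 2" using hp(5) unfolding hp(1) by simp
  moreover have "a + b = h 1 3 + h 2 3" unfolding hp(4) hp(5)[unfolded hp(1)] by simp
  ultimately have eqs: "a = h 1 2 + h 1 3" "b = h 2 3 - h 1 2" "a + b = h 1 3 + h 2 3" using hp(4) by blast+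
  have "N a \<le> N (h 1 2) + N (h 1 3)" unfolding eqs(1) by (rule Nm(2))
  moreover have "N b \<le> N (h 1 2) + N (h 2 3)"
    unfolding eqs(2) using Nm(2)[of "h 2 3" "- h 1 2"] Nm(3)[of "h 1 2"] by simp
  moreover have "N (a + b) \<le> N (h 1 3) + N (h 2 3)" unfolding eqs(3) by (rule Nm(2))
  moreover have "2 * (N (h 1 2) + N (h 1 3) + N (h 2 3)) \<le> N a + N b + N (a + b)" using le s by simp
  ultimately have "N a = N (h 1 2) + N (h 1 3)" "N b = N (h 1 2) + N (h 2 3)" "N (a + b) = N (h 1 3) + N (h 2 3)"
    by (rule tight_three)+
  then show "\<exists>x y z. a = x + y \<and> b = z - x \<and> a + b = y + z \<and> N a = N x + N y \<and> N b = N x + N z \<and> N (a + b) = N y + N z"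
    using eqs by blast
qed

text \<open>
  The elements \<open>a1\<close>, \<open>- b1\<close>, \<open>a2\<close>, \<open>- b2\<close> are
  placed in this order on a square with sides of length \<open>1\<close> and diagonals of length
  \<open>2\<close>. An optimal plan may use the diagonals, but these transports can be routed along
  two sides at no additional cost.
\<close>

lemma norm_refinement_if_cyclic:
  fixes N :: "'g::ab_group_add \<Rightarrow> real"
  assumes N: "normed_ab_group N" and otp: "optimal_transport_plans N"
    and cyc: "\<And>(g :: nat \<Rightarrow> 'g) e. (\<Sum>i=1..4. g i) = 0 \<Longrightarrow> 0 < e \<Longrightarrow>
      \<exists>c \<alpha>. 0 \<le> \<alpha> \<and> \<alpha> \<le> 1 \<and>
        (\<Sum>k<4. N (c - (\<Sum>i=1..k. g i))) < \<alpha> * (N (g 1) + N (g 3)) + (1 - \<alpha>) * (N (g 2) + N (g 4)) + e"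
  shows "norm_refinement N"
  unfolding norm_refinement_def
proof (intro allI impI)
  fix a1 a2 b1 b2 :: 'g
  assume ab: "a1 + a2 = b1 + b2" "N a1 + N a2 = N b1 + N b2"
  define g where "g i = (if i = 1 then a1 else if i = 2 then - b1 else if i = 3 then a2 else - b2)" for i :: nat
  have g: "g 1 = a1" "g 2 = - b1" "g 3 = a2" "g 4 = - b2" by (auto simp: g_def)
  have g0: "(\<Sum>i=1..4. g i) = 0" unfolding sum_four g using ab(1) by (simp add: algebra_simps)
  define d :: "nat \<Rightarrow> nat \<Rightarrow> real" where "d i j = (if i = j then 0 else if even (i + j) then 2 else 1)" for i j
  have d: "Metric_space {1..4} d" by (rule Metric_space_distances_one_or_two) (auto simp: d_def add.commute)
  obtain h where h: "transport_plan 4 g h" "\<And>h'. transport_plan 4 g h' \<Longrightarrow> transport_cost N 4 d h \<le> transport_cost N 4 d h'"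
    by (rule optimal_plan_le[OF N otp _ g0 d]) auto
  note Nm = normed_ab_groupD[OF N]
  define s where "s = N a1 + N a2"
  have "transport_cost N 4 d h \<le> s + e" if e: "0 < e" for e
  proof -
    obtain c \<alpha> where c0: "0 \<le> \<alpha>" "\<alpha> \<le> 1"
      "(\<Sum>k<4. N (c - (\<Sum>i=1..k. g i))) < \<alpha> * (N (g 1) + N (g 3)) + (1 - \<alpha>) * (N (g 2) + N (g 4)) + e"
      using cyc[OF g0 e] by blast
    have "\<alpha> * (N (g 1) + N (g 3)) + (1 - \<alpha>) * (N (g 2) + N (g 4)) = s"
      unfolding g Nm(3) s_def ab(2)[symmetric] by (simp add: algebra_simps)
    moreover have "(\<Sum>k<4. N (c - (\<Sum>i=1..k. g i))) = N c + N (c - a1) + N (c - a1 + b1) + N (c - a1 + b1 - a2)"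
      unfolding lessThan_sum_four sum_one_two sum_three g by (simp add: algebra_simps)
    ultimately have c: "N c + N (c - a1) + N (c - a1 + b1) + N (c - a1 + b1 - a2) < s + e" using c0(3) by simp
    define H where "H i j = (if (i, j) = (1, 2) then a1 - c else if (i, j) = (2, 1) then c - a1
        else if (i, j) = (1, 4) then c else if (i, j) = (4, 1) then - c
        else if (i, j) = (2, 3) then a1 - b1 - c else if (i, j) = (3, 2) then c - a1 + b1
        else if (i, j) = (3, 4) then a1 - b1 + a2 - c else if (i, j) = (4, 3) then c - a1 + b1 - a2 else 0)" for i j :: nat
    have "transport_plan 4 g H"
      unfolding transport_plan_def ball_four sum_four g using ab(1) by (simp add: H_def algebra_simps)
    then have "transport_cost N 4 d h \<le> transport_cost N 4 d H" by (rule h(2))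
    also have "\<dots> = N (a1 - c) + N c + N (a1 - b1 - c) + N (a1 - b1 + a2 - c)"
      unfolding transport_cost_four using Nm(4) by (simp add: H_def d_def)
    also have "\<dots> = N (c - a1) + N c + N (c - a1 + b1) + N (c - a1 + b1 - a2)"
      using Nm(3)[of "c - a1"] Nm(3)[of "c - a1 + b1"] Nm(3)[of "c - a1 + b1 - a2"] by (simp add: algebra_simps)
    finally show ?thesis using c by linarith
  qed
  then have "transport_cost N 4 d h \<le> s" by (rule field_le_epsilon)
  then have le: "N (h 1 2) + 2 * N (h 1 3) + N (h 1 4) + N (h 2 3) + 2 * N (h 2 4) + N (h 3 4) \<le> s"
    unfolding transport_cost_four by (simp add: d_def)
  have hp: "h 2 1 = - h 1 2" "h 3 1 = - h 1 3" "h 4 1 = - h 1 4" "h 3 2 = - h 2 3" "h 4 2 = - h 2 4" "h 4 3 = - h 3 4"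
    "a1 = h 1 2 + h 1 3 + h 1 4" "- b1 = h 2 1 + h 2 3 + h 2 4" "a2 = h 3 1 + h 3 2 + h 3 4" "- b2 = h 4 1 + h 4 2 + h 4 3"
  proof -
    note P = h(1)[unfolded transport_plan_def ball_four sum_four g]
    show "h 2 1 = - h 1 2" "h 3 1 = - h 1 3" "h 4 1 = - h 1 4" "h 3 2 = - h 2 3" "h 4 2 = - h 2 4" "h 4 3 = - h 3 4"
      using P by blast+
    have z: "h 1 1 = 0" "h 2 2 = 0" "h 3 3 = 0" "h 4 4 = 0" using P by blast+
    have "a1 = h 1 1 + h 1 2 + h 1 3 + h 1 4" "- b1 = h 2 1 + h 2 2 + h 2 3 + h 2 4"
      "a2 = h 3 1 + h 3 2 + h 3 3 + h 3 4" "- b2 = h 4 1 + h 4 2 + h 4 3 + h 4 4" using P by blast+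
    then show "a1 = h 1 2 + h 1 3 + h 1 4" "- b1 = h 2 1 + h 2 3 + h 2 4" "a2 = h 3 1 + h 3 2 + h 3 4" "- b2 = h 4 1 + h 4 2 + h 4 3"
      unfolding z add_0_left add_0_right by blast+
  qed
  \<comment> \<open>route the diagonal transports along the sides of the square\<close>
  define p q r t where "p = h 1 2 + h 1 3" and "q = h 1 4" and "r = - h 2 3 - h 1 3 - h 2 4" and "t = h 3 4 + h 2 4"
  have b: "b1 = - (h 2 1 + h 2 3 + h 2 4)" "b2 = - (h 4 1 + h 4 2 + h 4 3)"
    unfolding hp(8,10)[symmetric] by simp_all
  have "a1 = p + q" unfolding hp(7) p_def q_def by simp
  moreover have "a2 = r + t" unfolding hp(9) hp(2) hp(4) r_def t_def by simp
  moreover have "b1 = p + r" unfolding b(1) hp(1) p_def r_def by simp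
  moreover have "b2 = q + t" unfolding b(2) hp(3) hp(5) hp(6) q_def t_def by simp
  ultimately have eqs: "a1 = p + q" "a2 = r + t" "b1 = p + r" "b2 = q + t" by blast+
  have "N p \<le> N (h 1 2) + N (h 1 3)" unfolding p_def by (rule Nm(2))
  moreover have "N r \<le> N (h 2 3) + N (h 1 3) + N (h 2 4)"
  proof -
    have "N r = N (h 2 3 + h 1 3 + h 2 4)" using Nm(3)[of r] by (simp add: r_def algebra_simps)
    then show ?thesis using Nm(2)[of "h 2 3 + h 1 3" "h 2 4"] Nm(2)[of "h 2 3" "h 1 3"] by linarith
  qed
  moreover have "N t \<le> N (h 3 4) + N (h 2 4)" unfolding t_def by (rule Nm(2))
  moreover have "N q = N (h 1 4)" by (simp add: q_def)
  ultimately have tot: "N p + N q + N r + N t \<le> s" using le by linarith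
  have "N a1 \<le> N p + N q" unfolding eqs(1) by (rule Nm(2))
  moreover have "N a2 \<le> N r + N t" unfolding eqs(2) by (rule Nm(2))
  moreover have "N b1 \<le> N p + N r" unfolding eqs(3) by (rule Nm(2))
  moreover have "N b2 \<le> N q + N t" unfolding eqs(4) by (rule Nm(2))
  moreover note tot[unfolded s_def] ab(2)
  ultimately have "N a1 = N p + N q" "N a2 = N r + N t" "N b1 = N p + N r" "N b2 = N q + N t"
    by (rule tight_four)+
  then show "\<exists>p q r s. a1 = p + q \<and> a2 = r + s \<and> b1 = p + r \<and> b2 = q + s \<and>
        N a1 = N p + N q \<and> N a2 = N r + N s \<and> N b1 = N p + N r \<and> N b2 = N q + N s"
    using eqs by blast
qed

theorem lemma5p1:
  fixes N :: "'g::ab_group_add \<Rightarrow> real"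
  assumes universe: "\<exists>e :: real \<Rightarrow> 'x. inj e"
    and normed: "normed_ab_group N"
    and otp: "optimal_transport_plans N"
    and trees: "\<And>(X :: 'x metric) (n :: nat) (x :: nat \<Rightarrow> 'x) (g :: nat \<Rightarrow> 'g).
      \<lbrakk>geodesic_space X; \<forall>i\<in>{1..n}. x i \<in> mspace X; (\<Sum>i=1..n. g i) = 0\<rbrakk> \<Longrightarrow>
      \<exists>(T :: 't metric) f. tree T \<and> one_lipschitz X T f \<and>
        filling_length N T (\<Sum>i=1..n. Poly_Mapping.single (f (x i)) (g i)) =
        filling_length N X (\<Sum>i=1..n. Poly_Mapping.single (x i) (g i))"
  shows "nonbranching_optimal_transport_plans N"
proof (rule nonbranching_if_splitting[OF normed otp])
  obtain e :: "real \<Rightarrow> 'x" where e: "inj e" using universe by blast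
  show "three_point_splitting N"
  proof (rule three_point_splitting_if_cyclic[OF normed otp])
    fix g :: "nat \<Rightarrow> 'g" and \<epsilon> :: real
    assume g0: "(\<Sum>i=1..3. g i) = 0" and eps: "0 < \<epsilon>"
    interpret C: circle_space 3 e by unfold_locales (rule e, simp)
    have xs: "\<forall>i\<in>{1..3}. C.pt (real i) \<in> mspace C.X" by (auto intro!: C.pt_in)
    obtain T :: "'t metric" and f where T: "tree T" "one_lipschitz C.X T f"
      "filling_length N T (\<Sum>i=1..3. Poly_Mapping.single (f (C.pt (real i))) (g i)) =
        filling_length N C.X (\<Sum>i=1..3. Poly_Mapping.single (C.pt (real i)) (g i))"
      using trees[OF C.geodesic_X xs g0] by blast
    let ?b = "(\<Sum>i=1..3. N (g i)) / 2"
    have "filling_length N C.X (\<Sum>i=1..3. Poly_Mapping.single (C.pt (real i)) (g i)) \<le> ennreal ?b"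
      using C.filling_length_tree_image_three[OF normed refl T(1,2) g0] unfolding T(3) .
    also have "ennreal ?b < ennreal (?b + \<epsilon>)"
      using eps normed_ab_groupD(1)[OF normed] by (intro ennreal_lessI add_nonneg_pos divide_nonneg_nonneg sum_nonneg) auto
    finally obtain c where "(\<Sum>k<3. N (c - (\<Sum>i=1..k. g i))) < ?b + \<epsilon>"
      by (rule C.filling_length_circle[OF normed])
    then show "\<exists>c. (\<Sum>k<3. N (c - (\<Sum>i=1..k. g i))) < ?b + \<epsilon>" by blast
  qed
  show "norm_refinement N"
  proof (rule norm_refinement_if_cyclic[OF normed otp])
    fix g :: "nat \<Rightarrow> 'g" and \<epsilon> :: real
    assume g0: "(\<Sum>i=1..4. g i) = 0" and eps: "0 < \<epsilon>"
    interpret C: circle_space 4 e by unfold_locales (rule e, simp)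
    have xs: "\<forall>i\<in>{1..4}. C.pt (real i) \<in> mspace C.X" by (auto intro!: C.pt_in)
    obtain T :: "'t metric" and f where T: "tree T" "one_lipschitz C.X T f"
      "filling_length N T (\<Sum>i=1..4. Poly_Mapping.single (f (C.pt (real i))) (g i)) =
        filling_length N C.X (\<Sum>i=1..4. Poly_Mapping.single (C.pt (real i)) (g i))"
      using trees[OF C.geodesic_X xs g0] by blast
    obtain \<alpha> where \<alpha>: "0 \<le> \<alpha>" "\<alpha> \<le> 1"
      "filling_length N T (\<Sum>i=1..4. Poly_Mapping.single (f (C.pt (real i))) (g i))
        \<le> ennreal (\<alpha> * (N (g 1) + N (g 3)) + (1 - \<alpha>) * (N (g 2) + N (g 4)))"
      by (rule C.filling_length_tree_image_four[OF normed refl T(1,2) g0])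
    let ?b = "\<alpha> * (N (g 1) + N (g 3)) + (1 - \<alpha>) * (N (g 2) + N (g 4))"
    have "0 \<le> ?b"
      using \<alpha>(1,2) normed_ab_groupD(1)[OF normed] by (intro add_nonneg_nonneg mult_nonneg_nonneg) auto
    have "filling_length N C.X (\<Sum>i=1..4. Poly_Mapping.single (C.pt (real i)) (g i)) \<le> ennreal ?b"
      using \<alpha>(3) unfolding T(3) .
    also have "ennreal ?b < ennreal (?b + \<epsilon>)" using eps \<open>0 \<le> ?b\<close> by (intro ennreal_lessI) auto
    finally obtain c where "(\<Sum>k<4. N (c - (\<Sum>i=1..k. g i))) < ?b + \<epsilon>"
      by (rule C.filling_length_circle[OF normed])
    then show "\<exists>c \<alpha>. 0 \<le> \<alpha> \<and> \<alpha> \<le> 1 \<and>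
        (\<Sum>k<4. N (c - (\<Sum>i=1..k. g i))) < \<alpha> * (N (g 1) + N (g 3)) + (1 - \<alpha>) * (N (g 2) + N (g 4)) + \<epsilon>"
      using \<alpha>(1,2) by blast
  qed
qed

end
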